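(* Let $V$ be a real inner product space with $2\le\dim V<\infty$, and let $\mu=\sum_{l\in\Lambda}p_l\delta_{A_l}$ be a finitely supported probability measure on $\mathrm{GL}(V)$ ($\Lambda$ finite, $A_l$ distinct, $p_l>0$) such that $S_\mu$ is strongly irreducible and proximal. Let $\nu$ be the Furstenberg measure of $\mu$ on $\mathrm{P}(V)$ (which is exact dimensional, with dimension $\dim\nu$), and let $\dim_{\mathrm{LY}}\mu$ be the Lyapunov dimension corresponding to $\mu$, defined in the context. Then $$\dim\nu\le\dim_{\mathrm{LY}}\mu .$$
   Context: Projective space. $V$ has inner product $\langle\cdot,\cdot\rangle$ and norm $|\cdot|$. $\mathrm{P}(V)$ is the projective space, with metric $d(\overline x,\overline y)=(1-\langle x,y\rangle^2)^{1/2}$ for unit vectors $x\in\overline x$, $y\in\overline y$; $\mathrm{GL}(V)$ acts by $A\overline x=\overline{Ax}$. Assumptions on $\mu$. $S_\mu$ is the smallest closed subsemigroup of $\mathrm{GL}(V)$ with $\mu(S_\mu)=1$. Strongly irreducible: there is no finite family of proper nonzero linear subspaces $W_1,\dots,W_k$ of $V$ with $A(\bigcup_i W_i)=\bigcup_i W_i$ for all $A\in S_\mu$. Proximal: there are $B_n\in S_\mu$ and $\alpha_n\in\mathbb R$ such that $\alpha_nB_n$ converges in norm to a rank $1$ endomorphism. Then there is a unique Borel probability measure $\nu$ on $\mathrm{P}(V)$ with $\nu=\sum_lp_lA_l\nu$ (the Furstenberg measure). Dimension. A Borel probability measure $\theta$ on a metric space is exact dimensional with $\dim\theta=\alpha$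 if $\lim_{r\downarrow0}\frac{\log\theta(B(x,r))}{\log r}=\alpha$ for $\theta$-a.e. $x$ ($B(x,r)$ the closed ball). Lyapunov exponents. Let $\lambda_0>\lambda_1>\dots>\lambda_s$ be the distinct Lyapunov exponents of the random product $A_{\omega_{-n}}\cdots A_{\omega_{-1}}$, where the $\omega_j$ are i.i.d. with law $p=(p_l)_{l\in\Lambda}$ (given by Oseledets' theorem), and let $d_0,\dots,d_s$ be their multiplicities, so $\sum_{i=0}^sd_i=\dim V$; under the assumptions $d_0=1$. Set $\tilde\lambda_i=\lambda_i-\lambda_0$ for $1\le i\le s$. Lyapunov dimension. Let $\mathrm{H}(p)=-\sum_lp_l\log p_l$ and $L_i=-\sum_{j=1}^i\tilde\lambda_jd_j$ for $0\le i\le s$. Let $m=\max\{0\le i\le s:\mathrm{H}(p)\ge L_i\}$. Then $\dim_{\mathrm{LY}}\mu=\sum_{j=1}^md_j+\frac{\mathrm{H}(p)-L_m}{-\tilde\lambda_{m+1}}$ if $m<s$, and $\dim_{\mathrm{LY}}\mu=\dim V-1$ if $m=s$. *)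

theory Defs
  imports "HOL-Probability.Probability"
begin

section \<open>Projective space\<close>

definition proj_rel :: "'a::euclidean_space \<Rightarrow> 'a \<Rightarrow> bool" where
  "proj_rel x y \<longleftrightarrow> x \<noteq> 0 \<and> y \<noteq> 0 \<and> (\<exists>c. y = c *\<^sub>R x)"

lemma part_equivp_proj_rel: "part_equivp (proj_rel :: 'a::euclidean_space \<Rightarrow> 'a \<Rightarrow> bool)"
proof (rule part_equivpI)
  obtain b :: 'a where "b \<in> Basis" by (meson nonempty_Basis ex_in_conv)
  then have "b \<noteq> 0" by (rule nonzero_Basis)
  then show "\<exists>x :: 'a. proj_rel x x"
    unfolding proj_rel_def by (metis scaleR_one)
  show "symp (proj_rel :: 'a \<Rightarrow> 'a \<Rightarrow> bool)"
  proof (rule sympI)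
    fix x y :: 'a assume h: "proj_rel x y"
    then obtain c where c: "y = c *\<^sub>R x" "x \<noteq> 0" "y \<noteq> 0" by (auto simp: proj_rel_def)
    then have "x = (1 / c) *\<^sub>R y" by auto
    with c show "proj_rel y x" unfolding proj_rel_def by blast
  qed
  show "transp (proj_rel :: 'a \<Rightarrow> 'a \<Rightarrow> bool)"
    by (rule transpI) (auto simp: proj_rel_def intro: exI[of _ "_ * _"])
qed

quotient_type (overloaded) 'a projective = "'a::euclidean_space" / partial: proj_rel
  by (rule part_equivp_proj_rel)

lemma proj_rel_sgn:
  assumes "proj_rel x y"
  shows "sgn y = sgn x \<or> sgn y = - sgn x"
proof -
  from assms obtain c where "y = c *\<^sub>R x" "y \<noteq> 0" by (auto simp: proj_rel_def)
  then show ?thesis by (cases "c > 0") (auto simp: sgn_scaleR sgn_if)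
qed

lemma sqrt_inner_L2_set:
  fixes x y :: "'a::euclidean_space"
  assumes "norm x = 1" "norm y = 1"
  shows "sqrt (1 - (x \<bullet> y)\<^sup>2) =
    L2_set (\<lambda>(i, j). (x \<bullet> i) * (x \<bullet> j) - (y \<bullet> i) * (y \<bullet> j)) (Basis \<times> Basis) / sqrt 2"
proof -
  have P: "(\<Sum>(i, j)\<in>Basis \<times> Basis. ((u \<bullet> i) * (u \<bullet> j)) * ((v \<bullet> i) * (v \<bullet> j))) = (u \<bullet> v)\<^sup>2"
    for u v :: 'a
    by (subst euclidean_inner[of u v])
      (simp add: power2_eq_square sum_product sum.cartesian_product algebra_simps)
  have "(\<Sum>(i, j)\<in>Basis \<times> Basis. ((x \<bullet> i) * (x \<bullet> j) - (y \<bullet> i) * (y \<bullet> j))\<^sup>2)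
     = (x \<bullet> x)\<^sup>2 + (y \<bullet> y)\<^sup>2 - 2 * (x \<bullet> y)\<^sup>2"
    unfolding P[symmetric] sum_distrib_left sum.distrib[symmetric] sum_subtractf[symmetric]
    by (rule sum.cong) (auto simp: power2_eq_square algebra_simps)
  also have "\<dots> = 2 * (1 - (x \<bullet> y)\<^sup>2)"
    using assms by (simp add: dot_square_norm)
  finally show ?thesis
    unfolding L2_set_def case_prod_unfold by (simp only: real_sqrt_mult) simp
qed

instantiation projective :: (euclidean_space) metric_space
begin

lift_definition dist_projective :: "'a projective \<Rightarrow> 'a projective \<Rightarrow> real"
  is "\<lambda>x y. sqrt (1 - (sgn x \<bullet> sgn y)\<^sup>2)"
  by (auto dest!: proj_rel_sgn)

definition uniformity_projective :: "('a projective \<times> 'a projective) filter" where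
  "uniformity_projective = (INF e\<in>{0<..}. principal {(x, y). dist x y < e})"

definition open_projective :: "'a projective set \<Rightarrow> bool" where
  "open_projective U \<longleftrightarrow> (\<forall>x\<in>U. eventually (\<lambda>(x', y). x' = x \<longrightarrow> y \<in> U) uniformity)"

instance
proof
  show "dist x y = 0 \<longleftrightarrow> x = y" for x y :: "'a projective"
  proof (transfer, goal_cases)
    case (1 x y)
    then have nz: "x \<noteq> 0" "y \<noteq> 0" by (auto simp: proj_rel_def)
    then have n: "norm (sgn x) = 1" "norm (sgn y) = 1" by (auto simp: norm_sgn)
    show ?case
    proof
      assume "sqrt (1 - (sgn x \<bullet> sgn y)\<^sup>2) = 0"
      then have "\<bar>sgn x \<bullet> sgn y\<bar> = norm (sgn x) * norm (sgn y)"
        using n by (auto simp: power2_eq_1_iff)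
      then have "sgn x = sgn y \<or> sgn x = - sgn y"
        unfolding norm_cauchy_schwarz_abs_eq using n by auto
      moreover have "x = norm x *\<^sub>R sgn x" "y = norm y *\<^sub>R sgn y"
        using nz by (auto simp: sgn_div_norm)
      moreover have "sgn x = (1 / norm x) *\<^sub>R x"
        by (simp add: sgn_div_norm divide_inverse)
      ultimately have "y = (norm y / norm x) *\<^sub>R x \<or> y = (- norm y / norm x) *\<^sub>R x"
        by (metis (no_types, opaque_lifting) divide_inverse inverse_eq_divide minus_divide_left
            minus_minus scaleR_minus_left scaleR_minus_right scaleR_scaleR)
      with nz show "proj_rel x y" unfolding proj_rel_def by blast
    next
      assume "proj_rel x y"
      then show "sqrt (1 - (sgn x \<bullet> sgn y)\<^sup>2) = 0"
        using n by (auto dest!: proj_rel_sgn simp: dot_square_norm)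
    qed
  qed
  show "dist x y \<le> dist x z + dist y z" for x y z :: "'a projective"
  proof (transfer, goal_cases)
    case (1 x y z)
    define X where "X u = (\<lambda>(i, j). (sgn u \<bullet> i) * (sgn u \<bullet> j))" for u :: 'a
    have S: "sqrt (1 - (sgn u \<bullet> sgn v)\<^sup>2)
        = L2_set (\<lambda>k. X u k - X v k) (Basis \<times> Basis) / sqrt 2"
      if "u \<noteq> 0" "v \<noteq> 0" for u v
      using that by (subst sqrt_inner_L2_set) (auto simp: norm_sgn X_def case_prod_unfold)
    have nz: "x \<noteq> 0" "y \<noteq> 0" "z \<noteq> 0" using 1 by (auto simp: proj_rel_def)
    have "L2_set (\<lambda>k. X x k - X y k) (Basis \<times> Basis)
       = L2_set (\<lambda>k. (X x k - X z k) + (X z k - X y k)) (Basis \<times> Basis)" by simp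
    also have "\<dots> \<le> L2_set (\<lambda>k. X x k - X z k) (Basis \<times> Basis)
        + L2_set (\<lambda>k. X z k - X y k) (Basis \<times> Basis)"
      by (rule L2_set_triangle_ineq)
    also have "L2_set (\<lambda>k. X z k - X y k) (Basis \<times> Basis)
        = L2_set (\<lambda>k. X y k - X z k) (Basis \<times> Basis)"
      by (simp add: L2_set_def power2_commute)
    finally show ?case
      by (simp add: S nz add_divide_distrib[symmetric] divide_right_mono)
  qed
qed (simp_all add: uniformity_projective_def open_projective_def)

end


section \<open>The general linear group and its action\<close>

definition GL :: "('a::euclidean_space \<Rightarrow>\<^sub>L 'a) set" where
  "GL = {A. bij (blinfun_apply A)}"

text \<open>The action of \<^term>\<open>GL\<close>; other endomorphisms are given a junk value, as they need not
  map lines to lines.\<close>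

lift_definition gl_act :: "('a::euclidean_space \<Rightarrow>\<^sub>L 'a) \<Rightarrow> 'a projective \<Rightarrow> 'a projective"
  is "\<lambda>A x. if A \<in> GL then blinfun_apply A x else x"
proof (goal_cases)
  case (1 A x y)
  have "blinfun_apply A u \<noteq> 0" if "A \<in> GL" "u \<noteq> 0" for u
    using that by (metis GL_def bij_is_inj blinfun.zero_right injD mem_Collect_eq)
  with 1 show ?case by (auto simp: proj_rel_def blinfun.scaleR_right)
qed


section \<open>Assumptions on the measure\<close>

definition closed_semigroup_of :: "('a::euclidean_space \<Rightarrow>\<^sub>L 'a) pmf \<Rightarrow> ('a \<Rightarrow>\<^sub>L 'a) set" where
  "closed_semigroup_of \<mu> = \<Inter>{S. closedin (top_of_set GL) S \<and>
     (\<forall>A\<in>S. \<forall>B\<in>S. A o\<^sub>L B \<in> S) \<and> measure_pmf.prob \<mu> S = 1}"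

text \<open>The family of subspaces must be nonempty: the empty one is invariant under everything.\<close>

definition strongly_irreducible :: "('a::euclidean_space \<Rightarrow>\<^sub>L 'a) set \<Rightarrow> bool" where
  "strongly_irreducible S \<longleftrightarrow>
     \<not> (\<exists>F. finite F \<and> F \<noteq> {} \<and> (\<forall>W\<in>F. subspace W \<and> W \<noteq> {0} \<and> W \<noteq> UNIV) \<and>
           (\<forall>A\<in>S. blinfun_apply A ` (\<Union>F) = \<Union>F))"

definition proximal :: "('a::euclidean_space \<Rightarrow>\<^sub>L 'a) set \<Rightarrow> bool" where
  "proximal S \<longleftrightarrow>
     (\<exists>B (\<alpha>::nat \<Rightarrow> real) L. (\<forall>n. B n \<in> S) \<and> (\<lambda>n. \<alpha> n *\<^sub>R B n) \<longlonglongrightarrow> L \<and>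
        dim (range (blinfun_apply L)) = 1)"

definition furstenberg_measure ::
    "'l pmf \<Rightarrow> ('l \<Rightarrow> 'a::euclidean_space \<Rightarrow>\<^sub>L 'a) \<Rightarrow> 'a projective measure \<Rightarrow> bool" where
  "furstenberg_measure p A \<nu> \<longleftrightarrow> prob_space \<nu> \<and> sets \<nu> = sets borel \<and>
     (\<forall>E\<in>sets borel.
        measure \<nu> E = (\<Sum>l\<in>set_pmf p. pmf p l * measure (distr \<nu> borel (gl_act (A l))) E))"


section \<open>Exact dimensionality\<close>

text \<open>Positivity of the ball measures is stated separately because \<^term>\<open>ln 0 = (0::real)\<close>:
  a vanishing measure would otherwise count as local dimension \<open>0\<close> instead of \<open>\<infinity>\<close>.\<close>

definition exact_dimensional :: "'b::metric_space measure \<Rightarrow> real \<Rightarrow> bool" where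
  "exact_dimensional \<theta> \<alpha> \<longleftrightarrow>
     (AE x in \<theta>. (\<forall>r>0. measure \<theta> (cball x r) > 0) \<and>
        ((\<lambda>r. ln (measure \<theta> (cball x r)) / ln r) \<longlongrightarrow> \<alpha>) (at_right 0))"


section \<open>Lyapunov exponents and Lyapunov dimension\<close>

text \<open>Here \<open>\<omega> k\<close> stands for the letter with index \<open>-(k + 1)\<close>, so that \<open>random_product A \<omega> n\<close> is
  the product of \<open>A\<close> at the letters with indices \<open>-n\<close>, ..., \<open>-1\<close>, the last one acting first.\<close>

primrec random_product ::
    "('l \<Rightarrow> 'a::euclidean_space \<Rightarrow>\<^sub>L 'a) \<Rightarrow> (nat \<Rightarrow> 'l) \<Rightarrow> nat \<Rightarrow> 'a \<Rightarrow>\<^sub>L 'a" where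
  "random_product A \<omega> 0 = id_blinfun"
| "random_product A \<omega> (Suc n) = A (\<omega> n) o\<^sub>L random_product A \<omega> n"

text \<open>The distinct exponents \<open>lam 0 > ... > lam s\<close> with multiplicities \<open>d 0, ..., d s\<close>, through the
  (random) Oseledets filtration \<open>UNIV = F 0 \<supset> ... \<supset> F (s + 1) = {0}\<close>.\<close>

definition lyapunov_spectrum ::
    "'l pmf \<Rightarrow> ('l \<Rightarrow> 'a::euclidean_space \<Rightarrow>\<^sub>L 'a) \<Rightarrow> nat \<Rightarrow> (nat \<Rightarrow> real) \<Rightarrow> (nat \<Rightarrow> nat) \<Rightarrow> bool" where
  "lyapunov_spectrum p A s lam d \<longleftrightarrow>
     (\<forall>i<s. lam (Suc i) < lam i) \<and> (\<forall>i\<le>s. 0 < d i) \<and>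
     (AE \<omega> in PiM (UNIV :: nat set) (\<lambda>_. measure_pmf p).
        \<exists>F :: nat \<Rightarrow> 'a set.
          (\<forall>i\<le>Suc s. subspace (F i)) \<and> F 0 = UNIV \<and> F (Suc s) = {0} \<and>
          (\<forall>i\<le>s. F (Suc i) \<subseteq> F i \<and> dim (F i) = dim (F (Suc i)) + d i \<and>
             (\<forall>v \<in> F i - F (Suc i).
                (\<lambda>n. ln (norm (random_product A \<omega> n v)) / real n) \<longlonglongrightarrow> lam i)))"

definition shannon_entropy :: "'l pmf \<Rightarrow> real" where
  "shannon_entropy p = - (\<Sum>l\<in>set_pmf p. pmf p l * ln (pmf p l))"

definition lyapunov_sum :: "(nat \<Rightarrow> real) \<Rightarrow> (nat \<Rightarrow> nat) \<Rightarrow> nat \<Rightarrow> real" where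
  "lyapunov_sum lam d i = - (\<Sum>j=1..i. (lam j - lam 0) * real (d j))"

text \<open>The first argument is the dimension of the space.\<close>

definition lyapunov_dimension ::
    "nat \<Rightarrow> 'l pmf \<Rightarrow> nat \<Rightarrow> (nat \<Rightarrow> real) \<Rightarrow> (nat \<Rightarrow> nat) \<Rightarrow> real" where
  "lyapunov_dimension N p s lam d =
     (let m = Max {i. i \<le> s \<and> shannon_entropy p \<ge> lyapunov_sum lam d i}
      in if m < s
         then (\<Sum>j=1..m. real (d j)) +
              (shannon_entropy p - lyapunov_sum lam d m) / (- (lam (Suc m) - lam 0))
         else real N - 1)"

end

theory Submission
  imports Defs
begin

text \<open>
  The bound is a covering argument. By stationarity \<open>\<nu>\<close> is the average of the images of \<open>\<nu>\<close> under
  the products \<open>g\<close> along words of length \<open>n\<close>. About \<open>exp (n H)\<close> words carry most of the mass, and the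
  product along a typical word maps a set of definite \<open>\<nu>\<close>-measure into an ellipsoid with \<open>d j\<close> axes of
  length about \<open>exp (n (lam j - lam 0))\<close>. At scale \<open>exp (n (lam (m + 1) - lam 0))\<close> each ellipsoid is
  covered by the number of balls obtained by slicing the axes of the blocks \<open>1, ..., m\<close>, and comparing
  with the measure of balls given by exact dimensionality yields the claim.

  The top block must not contribute, that is \<open>d 0 = 1\<close> is needed. Strong irreducibility shows that
  a random product \<open>g\<close> is small, relative to its norm, on a given line only with small probability. With
  proximality it follows that the image of a pair of lines has a small angle with large probability,
  while the ratio of angles is bounded in a small moment along the whole orbit; together this gives
  exponential contraction of angles. If \<open>d 0\<close> were at least \<open>2\<close>, then two vectors independent modulo the
  second space of the Oseledets filtration would become tangent exponentially fast, and a combination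
  of them would grow at a smaller rate than \<open>lam 0\<close>.
\<close>

section \<open>Averages over random words\<close>

text \<open>Exact dimensionality controls balls only around points of a set G of measure close to 1,
  and G depends on the mass c that the covers must catch. The covers are therefore built with
  centres in a prescribed G and only have to catch a fixed positive mass. Hence it is enough that
  the growth estimates hold with one constant Q on a set of sequences of positive probability. Per
  word there are about \<open>exp (n (lam j - lam (m + 1)) d j)\<close> slices for each block j in
  1..m. Together with the number of words this gives the exponent
  \<open>H - L_m + (lam 0 - lam (m + 1)) (d 1 + ... + d m)\<close>, which is
  \<open>lam 0 - lam (m + 1)\<close> times the expression for the Lyapunov dimension when
  \<open>m < s\<close>.

  The estimates for irreducible and proximal walks are stated as means over words of finite length:
  these are finite sums, defined for every function of the word, and open to induction on the first
  letter. Several of these inductions carry the product h of the letters already read, since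
  \<open>norm (g o h)\<close> cannot be recovered from g and the position of a single orbit.\<close>

primrec word_prod :: "('l \<Rightarrow> 'a::euclidean_space \<Rightarrow>\<^sub>L 'a) \<Rightarrow> 'l list \<Rightarrow> 'a \<Rightarrow>\<^sub>L 'a" where
  "word_prod A [] = id_blinfun"
| "word_prod A (l # w) = word_prod A w o\<^sub>L A l"

lemma word_prod_append: "word_prod A (u @ w) = word_prod A w o\<^sub>L word_prod A u"
  by (induction u) (auto intro!: blinfun_eqI)

text \<open>Letters of smaller index act first in \<open>random_product\<close> and the head acts
  first in \<open>word_prod\<close>, so an initial segment is read off without reversal.\<close>

lemma random_product_eq_word_prod: "random_product A \<omega> n = word_prod A (map \<omega> [0..<n])"
  by (induction n) (auto simp: word_prod_append intro!: blinfun_eqI)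

text \<open>The mean of a function of a random word with independent letters of law \<open>p\<close>. The recursion is on
  the first letter, which acts first, so that unfolding it once is the Markov property.\<close>

primrec word_mean :: "'l pmf \<Rightarrow> nat \<Rightarrow> ('l list \<Rightarrow> real) \<Rightarrow> real" where
  "word_mean p 0 f = f []"
| "word_mean p (Suc n) f = (\<Sum>l\<in>set_pmf p. pmf p l * word_mean p n (\<lambda>w. f (l # w)))"

abbreviation word_prob :: "'l pmf \<Rightarrow> nat \<Rightarrow> ('l list \<Rightarrow> bool) \<Rightarrow> real" where
  "word_prob p n P \<equiv> word_mean p n (\<lambda>w. of_bool (P w))"

definition words :: "'l pmf \<Rightarrow> nat \<Rightarrow> 'l list set" where
  "words p n = {w. length w = n \<and> set w \<subseteq> set_pmf p}"

definition word_weight :: "'l pmf \<Rightarrow> 'l list \<Rightarrow> real" where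
  "word_weight p w = prod_list (map (pmf p) w)"

lemma words_0: "words p 0 = {[]}"
  by (auto simp: words_def)

lemma words_Suc: "words p (Suc n) = (\<lambda>(l, w). l # w) ` (set_pmf p \<times> words p n)"
  by (auto simp: words_def length_Suc_conv image_iff)

lemma words_SucI: "l \<in> set_pmf p \<Longrightarrow> w \<in> words p n \<Longrightarrow> l # w \<in> words p (Suc n)"
  by (auto simp: words_Suc)

lemma word_mean_add: "word_mean p n (\<lambda>w. f w + g w) = word_mean p n f + word_mean p n g"
  by (induction n arbitrary: f g) (simp_all add: algebra_simps sum.distrib)

lemma word_mean_cmult: "word_mean p n (\<lambda>w. c * f w) = c * word_mean p n f"
  by (induction n arbitrary: f) (simp_all add: sum_distrib_left algebra_simps)

lemma word_mean_zero [simp]: "word_mean p n (\<lambda>w. 0) = 0"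
  by (induction n) auto

lemma word_mean_sum: "word_mean p n (\<lambda>w. \<Sum>i\<in>I. f i w) = (\<Sum>i\<in>I. word_mean p n (f i))"
proof (cases "finite I")
  case True
  then show ?thesis by (induction I rule: finite_induct) (auto simp: word_mean_add)
qed auto

lemma word_mean_mono:
  "(\<And>w. w \<in> words p n \<Longrightarrow> f w \<le> g w) \<Longrightarrow> word_mean p n f \<le> word_mean p n g"
proof (induction n arbitrary: f g)
  case (Suc n)
  have "word_mean p n (\<lambda>w. f (l # w)) \<le> word_mean p n (\<lambda>w. g (l # w))" if "l \<in> set_pmf p" for l
    using that by (intro Suc) (auto intro: words_SucI)
  then show ?case by (auto intro!: sum_mono mult_left_mono)
qed (simp add: words_0)

lemma word_mean_cong:
  "(\<And>w. w \<in> words p n \<Longrightarrow> f w = g w) \<Longrightarrow> word_mean p n f = word_mean p n g"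
  by (rule antisym; rule word_mean_mono; simp)

lemma word_mean_nonneg: "(\<And>w. w \<in> words p n \<Longrightarrow> 0 \<le> f w) \<Longrightarrow> 0 \<le> word_mean p n f"
  using word_mean_mono[of p n "\<lambda>_. 0" f] by simp

locale finite_letters =
  fixes p :: "'l pmf"
  assumes finite_letters: "finite (set_pmf p)"
begin

lemma sum_letters: "(\<Sum>l\<in>set_pmf p. pmf p l) = 1"
  using finite_letters by (simp add: sum_pmf_eq_1)

lemma finite_words: "finite (words p n)"
  by (induction n) (auto simp: words_0 words_Suc finite_letters)

lemma word_mean_const [simp]: "word_mean p n (\<lambda>w. c) = c"
proof (induction n)
  case (Suc n)
  have "(\<Sum>l\<in>set_pmf p. pmf p l * c) = c"
    using sum_letters by (simp only: sum_distrib_right[symmetric])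
  with Suc show ?case by (simp only: word_mean.simps)
qed simp

lemma word_prob_le_1: "word_prob p n P \<le> 1"
  using word_mean_mono[of p n "\<lambda>w. of_bool (P w)" "\<lambda>_. 1"] by simp

lemma word_prob_nonneg: "0 \<le> word_prob p n P"
  by (rule word_mean_nonneg) auto

lemma word_prob_mono:
  "(\<And>w. w \<in> words p n \<Longrightarrow> P w \<Longrightarrow> Q w) \<Longrightarrow> word_prob p n P \<le> word_prob p n Q"
  by (rule word_mean_mono) auto

lemma word_mean_append:
  "word_mean p (m + n) f = word_mean p m (\<lambda>u. word_mean p n (\<lambda>w. f (u @ w)))"
  by (induction m arbitrary: f) auto

lemma word_mean_eq_sum: "word_mean p n f = (\<Sum>w\<in>words p n. word_weight p w * f w)"
proof (induction n arbitrary: f)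
  case 0
  then show ?case by (simp add: words_0 word_weight_def)
next
  case (Suc n)
  have "(\<Sum>w\<in>words p (Suc n). word_weight p w * f w)
      = (\<Sum>(l, w)\<in>set_pmf p \<times> words p n. word_weight p (l # w) * f (l # w))"
    unfolding words_Suc by (subst sum.reindex) (auto simp: inj_on_def case_prod_unfold)
  also have "\<dots> = (\<Sum>l\<in>set_pmf p. pmf p l * (\<Sum>w\<in>words p n. word_weight p w * f (l # w)))"
    by (subst sum.cartesian_product[symmetric])
      (simp add: word_weight_def sum_distrib_left mult.assoc)
  finally show ?case by (simp add: Suc)
qed

lemma letter_sum_mono:
  "(\<And>l. l \<in> set_pmf p \<Longrightarrow> f l \<le> g l) \<Longrightarrow>
    (\<Sum>l\<in>set_pmf p. pmf p l * f l) \<le> (\<Sum>l\<in>set_pmf p. pmf p l * g l)"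
  by (intro sum_mono mult_left_mono) auto

lemma letter_sum_affine:
  "(\<Sum>l\<in>set_pmf p. pmf p l * (c + b * f l)) = c + b * (\<Sum>l\<in>set_pmf p. pmf p l * f l)"
proof -
  have "(\<Sum>l\<in>set_pmf p. pmf p l * (c + b * f l))
      = (\<Sum>l\<in>set_pmf p. pmf p l) * c + b * (\<Sum>l\<in>set_pmf p. pmf p l * f l)"
    by (simp add: distrib_left sum.distrib sum_distrib_right sum_distrib_left mult.left_commute)
  then show ?thesis by (simp add: sum_letters)
qed

lemma word_weight_pos: "w \<in> words p n \<Longrightarrow> 0 < word_weight p w"
proof (induction n arbitrary: w)
  case (Suc n)
  then obtain l w' where "w = l # w'" "l \<in> set_pmf p" "w' \<in> words p n" by (auto simp: words_Suc)
  with Suc.IH[of w'] show ?case by (auto simp: word_weight_def pmf_positive_iff)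
qed (simp add: words_0 word_weight_def)

lemma word_weight_nonneg: "0 \<le> word_weight p w"
  unfolding word_weight_def by (rule prod_list_nonneg) auto

end

section \<open>Areas and invertible maps\<close>

text \<open>The norm of the exterior product of x and y, as the square root of a Gram determinant.
  Estimates on the second exterior power of g become estimates on areas of images.\<close>

definition area :: "'a::real_inner \<Rightarrow> 'a \<Rightarrow> real" where
  "area x y = sqrt ((norm x)\<^sup>2 * (norm y)\<^sup>2 - (x \<bullet> y)\<^sup>2)"

lemma area_sq_nonneg: "(norm x)\<^sup>2 * (norm y)\<^sup>2 - (x \<bullet> y)\<^sup>2 \<ge> 0"
  using Cauchy_Schwarz_ineq[of x y] by (simp add: power2_norm_eq_inner)

lemma area_nonneg: "area x y \<ge> 0"
  unfolding area_def using area_sq_nonneg by simp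

lemma area_power2: "(area x y)\<^sup>2 = (norm x)\<^sup>2 * (norm y)\<^sup>2 - (x \<bullet> y)\<^sup>2"
  unfolding area_def using area_sq_nonneg by simp

lemma area_commute: "area x y = area y x"
  by (simp add: area_def inner_commute mult.commute)

lemma area_le: "area x y \<le> norm x * norm y"
proof -
  have "(area x y)\<^sup>2 \<le> (norm x * norm y)\<^sup>2" by (simp add: area_power2 power_mult_distrib)
  then show ?thesis by (rule power2_le_imp_le) simp
qed

lemma area_add_scaleR: "area x (y + t *\<^sub>R x) = area x y"
  unfolding area_def power2_norm_eq_inner
  by (rule arg_cong[of _ _ sqrt])
    (simp add: inner_simps power2_eq_square algebra_simps inner_commute)

lemma area_diff_scaleR: "area x (y - t *\<^sub>R x) = area x y"
  using area_add_scaleR[of x y "-t"] by simp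

lemma area_orthogonal: "x \<bullet> y = 0 \<Longrightarrow> area x y = norm x * norm y"
  by (simp add: area_def real_sqrt_mult)

lemma area_zero [simp]: "area 0 y = 0" "area x 0 = 0"
  by (auto simp: area_def)

lemma area_scaleR: "area (s *\<^sub>R x) (t *\<^sub>R y) = \<bar>s\<bar> * \<bar>t\<bar> * area x y"
proof -
  have "(area (s *\<^sub>R x) (t *\<^sub>R y))\<^sup>2 = (\<bar>s\<bar> * \<bar>t\<bar> * area x y)\<^sup>2"
    by (simp add: area_power2 power_mult_distrib algebra_simps)
  then show ?thesis using area_nonneg by (metis abs_ge_zero mult_nonneg_nonneg power2_eq_iff_nonneg)
qed

lemma area_height:
  assumes "x \<noteq> 0"
  shows "area x y = norm x * norm (y - ((y \<bullet> x) / (norm x)\<^sup>2) *\<^sub>R x)"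
proof -
  have "x \<bullet> (y - ((y \<bullet> x) / (norm x)\<^sup>2) *\<^sub>R x) = 0"
    using assms by (simp add: inner_simps power2_norm_eq_inner inner_commute)
  from area_orthogonal[OF this] show ?thesis by (simp add: area_diff_scaleR)
qed

text \<open>Subtracting from y its projection on x changes neither area, because g maps the shear to
  a shear. Base and height are then each stretched by at most \<open>norm g\<close>.\<close>

lemma area_image_le: "area (blinfun_apply g x) (blinfun_apply g y) \<le> (norm g)\<^sup>2 * area x y"
proof (cases "x = 0")
  case False
  define t where "t = (y \<bullet> x) / (norm x)\<^sup>2"
  have "area (g x) (g y) = area (g x) (g (y - t *\<^sub>R x))"
    by (simp add: blinfun.diff_right blinfun.scaleR_right area_diff_scaleR)
  also have "\<dots> \<le> norm (g x) * norm (g (y - t *\<^sub>R x))" by (rule area_le)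
  also have "\<dots> \<le> (norm g * norm x) * (norm g * norm (y - t *\<^sub>R x))"
    by (intro mult_mono norm_blinfun) auto
  also have "\<dots> = (norm g)\<^sup>2 * area x y"
    using area_height[OF False, of y] by (simp add: t_def power2_eq_square)
  finally show ?thesis .
qed simp

lemma area_le_dist: "area x y \<le> norm (x - y) * norm y"
proof -
  have "area x y = area (x - y) y"
    using area_diff_scaleR[of y x 1] by (simp add: area_commute)
  then show ?thesis using area_le by metis
qed

lemma GL_inj: "g \<in> GL \<Longrightarrow> inj (blinfun_apply g)"
  by (auto simp: GL_def bij_is_inj)

lemma GL_nonzero: "g \<in> GL \<Longrightarrow> x \<noteq> 0 \<Longrightarrow> blinfun_apply g x \<noteq> 0"
  by (metis GL_inj blinfun.zero_right injD)

lemma blinfun_linear: "linear (blinfun_apply g)"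
  by (simp add: blinfun.bounded_linear_right bounded_linear.linear)

lemma GL_dim_image: "g \<in> GL \<Longrightarrow> dim (blinfun_apply g ` U) = dim U"
  by (rule dim_image_eq[OF blinfun_linear]) (rule inj_on_subset[OF GL_inj subset_UNIV])

lemma GL_norm_pos: "g \<in> GL \<Longrightarrow> 0 < norm g"
proof -
  assume g: "g \<in> GL"
  obtain b :: 'a where "b \<in> Basis" by (meson nonempty_Basis ex_in_conv)
  then have "blinfun_apply g b \<noteq> 0" using GL_nonzero[OF g] nonzero_Basis by blast
  then show ?thesis by auto
qed

lemma id_in_GL: "id_blinfun \<in> GL"
  by (simp add: GL_def bij_def inj_def surj_def)

lemma compose_in_GL: "g \<in> GL \<Longrightarrow> h \<in> GL \<Longrightarrow> g o\<^sub>L h \<in> GL"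
  by (simp add: GL_def blinfun_compose.rep_eq bij_comp)

lemma GL_lower_bound:
  assumes "g \<in> GL"
  obtains c where "c > 0" "\<And>x. c * norm x \<le> norm (blinfun_apply g x)"
proof -
  from linear_inj_bounded_below_pos[OF blinfun_linear GL_inj[OF assms]] show ?thesis
    using that by metis
qed

text \<open>Supplies the direction v stretched most by g. Comparing a later product at
  \<open>g v\<close> with its norm is how lower bounds for norms of products arise below.\<close>

lemma norm_attained:
  fixes g :: "'a::euclidean_space \<Rightarrow>\<^sub>L 'a"
  obtains v where "norm v = 1" "norm (blinfun_apply g v) = norm g"
proof -
  have "compact (sphere (0::'a) 1)" "sphere (0::'a) 1 \<noteq> {}" by auto
  moreover have "continuous_on (sphere 0 1) (\<lambda>x. norm (blinfun_apply g x))"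
    by (intro continuous_intros)
  ultimately obtain v where v: "v \<in> sphere 0 1"
    "\<And>y. y \<in> sphere 0 1 \<Longrightarrow> norm (blinfun_apply g y) \<le> norm (blinfun_apply g v)"
    using continuous_attains_sup[of "sphere (0::'a) 1" "\<lambda>x. norm (blinfun_apply g x)"] by metis
  have "norm g \<le> norm (blinfun_apply g v)"
  proof (rule norm_blinfun_bound)
    show "norm (blinfun_apply g x) \<le> norm (blinfun_apply g v) * norm x" for x
    proof (cases "x = 0")
      case False
      then have "sgn x \<in> sphere 0 1" by (simp add: norm_sgn)
      from v(2)[OF this] have "norm (blinfun_apply g x) / norm x \<le> norm (blinfun_apply g v)"
        by (simp add: sgn_div_norm blinfun.scaleR_right divide_inverse mult.commute)
      with False show ?thesis by (simp add: divide_le_eq)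
    qed simp
  qed simp
  moreover have "norm (blinfun_apply g v) \<le> norm g" using norm_blinfun[of g v] v(1) by simp
  ultimately show ?thesis using that[of v] v(1) by simp
qed

section \<open>Irreducible and proximal walks\<close>

lemma closedin_GL_I:
  assumes "T \<subseteq> GL"
    and "\<And>g h. (\<And>n. g n \<in> T) \<Longrightarrow> g \<longlonglongrightarrow> h \<Longrightarrow> h \<in> GL \<Longrightarrow> h \<in> T"
  shows "closedin (top_of_set GL) T"
proof -
  have "T = GL \<inter> closure T"
  proof
    show "T \<subseteq> GL \<inter> closure T" using assms(1) closure_subset[of T] by auto
    show "GL \<inter> closure T \<subseteq> T"
    proof
      fix h assume h: "h \<in> GL \<inter> closure T"
      then obtain g where "\<And>n. g n \<in> T" "g \<longlonglongrightarrow> h" unfolding Int_iff closure_sequential by blast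
      with h show "h \<in> T" using assms(2) by blast
    qed
  qed
  then show ?thesis using closedin_closed_Int[of "closure T" GL] by (metis closed_closure)
qed

locale gl_walk = finite_letters p for p :: "'l pmf" +
  fixes A :: "'l \<Rightarrow> 'a::euclidean_space \<Rightarrow>\<^sub>L 'a"
  assumes letters_GL: "l \<in> set_pmf p \<Longrightarrow> A l \<in> GL"
begin

lemma word_prod_GL: "set w \<subseteq> set_pmf p \<Longrightarrow> word_prod A w \<in> GL"
  by (induction w) (auto intro: id_in_GL compose_in_GL letters_GL)

lemma letters_bounds:
  obtains K where "K \<ge> 1" "\<And>l x. l \<in> set_pmf p \<Longrightarrow> norm (A l x) \<le> K * norm x"
    "\<And>l x. l \<in> set_pmf p \<Longrightarrow> norm x \<le> K * norm (A l x)"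
proof -
  have "\<exists>c>0. \<forall>x. c * norm x \<le> norm (A l x)" if "l \<in> set_pmf p" for l
    using GL_lower_bound[OF letters_GL[OF that]] by metis
  then obtain c where c: "\<And>l. l \<in> set_pmf p \<Longrightarrow> c l > 0"
    "\<And>l x. l \<in> set_pmf p \<Longrightarrow> c l * norm x \<le> norm (A l x)" by metis
  define K where "K = 1 + (\<Sum>l\<in>set_pmf p. norm (A l) + 1 / c l)"
  have nn: "0 \<le> norm (A l) + 1 / c l" if "l \<in> set_pmf p" for l using c(1)[OF that] by simp
  have K: "norm (A l) + 1 / c l \<le> K" if "l \<in> set_pmf p" for l
    using member_le_sum[OF that, of "\<lambda>l. norm (A l) + 1 / c l"] nn finite_letters
    by (auto simp: K_def)
  show ?thesis
  proof (rule that)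
    show "K \<ge> 1" unfolding K_def using sum_nonneg[of "set_pmf p", OF nn] by simp
    fix l x assume l: "l \<in> set_pmf p"
    have "0 \<le> 1 / c l" using c(1)[OF l] by simp
    then have "norm (A l) \<le> K" "1 / c l \<le> K"
      using K[OF l] norm_ge_zero[of "A l"] by linarith+
    show "norm (A l x) \<le> K * norm x"
      using norm_blinfun[of "A l" x] \<open>norm (A l) \<le> K\<close> by (meson mult_right_mono norm_ge_zero order_trans)
    have "norm x \<le> (1 / c l) * norm (A l x)" using c[OF l] by (simp add: field_simps)
    also have "\<dots> \<le> K * norm (A l x)" using \<open>1 / c l \<le> K\<close> by (rule mult_right_mono) simp
    finally show "norm x \<le> K * norm (A l x)" .
  qed
qed

text \<open>The link between the letters and S_\<mu>: as the intersection of all closed semigroups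
  of full mass, S_\<mu> lies in every closed semigroup that contains the letters.\<close>

lemma closed_semigroup_subset:
  assumes "T \<subseteq> GL"
    and "\<And>g h. (\<And>n. g n \<in> T) \<Longrightarrow> g \<longlonglongrightarrow> h \<Longrightarrow> h \<in> GL \<Longrightarrow> h \<in> T"
    and "\<And>g h. g \<in> T \<Longrightarrow> h \<in> T \<Longrightarrow> g o\<^sub>L h \<in> T"
    and "\<And>l. l \<in> set_pmf p \<Longrightarrow> A l \<in> T"
  shows "closed_semigroup_of (map_pmf A p) \<subseteq> T"
proof -
  have cl: "closedin (top_of_set GL) T"
    by (rule closedin_GL_I[OF assms(1)]) (rule assms(2))
  have "measure_pmf.prob (map_pmf A p) T = 1"
    by (subst measure_pmf.prob_eq_1) (auto simp: AE_measure_pmf_iff assms(4))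
  then show ?thesis
    unfolding closed_semigroup_of_def using cl assms(3) by (intro Inter_lower) blast
qed

end

locale proximal_walk = gl_walk p A
  for p :: "'l pmf" and A :: "'l \<Rightarrow> 'a::euclidean_space \<Rightarrow>\<^sub>L 'a" +
  assumes strongly_irreducible: "strongly_irreducible (closed_semigroup_of (map_pmf A p))"
    and proximal: "proximal (closed_semigroup_of (map_pmf A p))"
begin

text \<open>T is the stabiliser of the family Y, a semigroup containing the letters. Once T is
  closed it contains S_\<mu>; an element of T permutes the finite set Y and so preserves its union,
  against strong irreducibility.\<close>

lemma no_invariant_family:
  assumes "finite Y" "Y \<noteq> {}"
    and Y: "\<And>U. U \<in> Y \<Longrightarrow> subspace U \<and> U \<noteq> {0} \<and> U \<noteq> UNIV"
    and inv: "\<And>l U. l \<in> set_pmf p \<Longrightarrow> U \<in> Y \<Longrightarrow> blinfun_apply (A l) ` U \<in> Y"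
  shows False
proof -
  define T where "T = {g \<in> GL. \<forall>U\<in>Y. blinfun_apply g ` U \<in> Y}"
  note lin = blinfun_linear and dimg = GL_dim_image
  have "closed_semigroup_of (map_pmf A p) \<subseteq> T"
  proof (rule closed_semigroup_subset)
    show "T \<subseteq> GL" by (auto simp: T_def)
    show "A l \<in> T" if "l \<in> set_pmf p" for l using that inv letters_GL by (auto simp: T_def)
    show "g o\<^sub>L h \<in> T" if "g \<in> T" "h \<in> T" for g h
      using that by (auto simp: T_def compose_in_GL image_image[symmetric, of "blinfun_apply g" "blinfun_apply h"])
    fix g h assume g: "\<And>n. g n \<in> T" and lim: "g \<longlonglongrightarrow> h" and h: "h \<in> GL"
    have "blinfun_apply h ` U \<in> Y" if U: "U \<in> Y" for U
    proof -
      \<comment> \<open>By pigeonhole infinitely many \<open>g n\<close> send U to the same member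
        U'. The limit h sends U into U', and onto it because h is invertible and the dimensions
        agree.\<close>
      have "(\<lambda>n. blinfun_apply (g n) ` U) ` UNIV \<subseteq> Y" using g U by (auto simp: T_def)
      then have "finite (range (\<lambda>n. blinfun_apply (g n) ` U))" using assms(1) finite_subset by blast
      with pigeonhole_infinite[OF infinite_UNIV_nat this] obtain n0 where
        inf: "infinite {n. blinfun_apply (g n) ` U = blinfun_apply (g n0) ` U}" by auto
      define U' where "U' = blinfun_apply (g n0) ` U"
      have U': "U' \<in> Y" using g U by (auto simp: T_def U'_def)
      from infinite_enumerate[OF inf] obtain r :: "nat \<Rightarrow> nat" where
        r: "strict_mono r" "\<And>n. blinfun_apply (g (r n)) ` U = U'" by (auto simp: U'_def)
      have "blinfun_apply h u \<in> U'" if u: "u \<in> U" for u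
      proof (rule closed_sequentially[OF closed_subspace])
        show "subspace U'" using Y[OF U'] by simp
        show "\<And>n. blinfun_apply (g (r n)) u \<in> U'" using r(2) u by blast
        show "(\<lambda>n. blinfun_apply (g (r n)) u) \<longlonglongrightarrow> blinfun_apply h u"
          using LIMSEQ_subseq_LIMSEQ[OF lim r(1)] by (auto simp: o_def intro!: tendsto_intros)
      qed
      then have sub: "blinfun_apply h ` U \<subseteq> U'" by auto
      have "dim U' = dim U" using dimg g by (auto simp: U'_def T_def)
      then have "blinfun_apply h ` U = U'"
        using sub dimg[OF h, of U] Y[OF U] Y[OF U']
        by (intro subspace_dim_equal) (auto intro: linear_subspace_image[OF lin])
      then show ?thesis using U' by simp
    qed
    then show "h \<in> T" using h by (auto simp: T_def)
  qed
  moreover have "blinfun_apply g ` (\<Union>Y) = \<Union>Y" if "g \<in> T" for g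
  proof -
    have "inj (blinfun_apply g)" using that GL_inj by (auto simp: T_def)
    then have "inj_on ((`) (blinfun_apply g)) Y"
      by (intro inj_onI) (simp add: inj_image_eq_iff)
    then have "(`) (blinfun_apply g) ` Y = Y"
      using that assms(1) by (intro endo_inj_surj) (auto simp: T_def)
    then show ?thesis by (metis image_Union)
  qed
  ultimately have fix_Y: "\<forall>g\<in>closed_semigroup_of (map_pmf A p). blinfun_apply g ` (\<Union>Y) = \<Union>Y"
    by (meson subsetD)
  have "\<forall>W\<in>Y. subspace W \<and> W \<noteq> {0} \<and> W \<noteq> UNIV" using Y by simp
  then show False
    using strongly_irreducible assms(1,2) fix_Y unfolding strongly_irreducible_def
    by (metis (no_types))
qed

lemma no_invariant_subspace:
  assumes "subspace U" "U \<noteq> {0}" "U \<noteq> UNIV" "\<And>l. l \<in> set_pmf p \<Longrightarrow> blinfun_apply (A l) ` U \<subseteq> U"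
  shows False
proof (rule no_invariant_family[of "{U}"])
  show "blinfun_apply (A l) ` V \<in> {U}" if l: "l \<in> set_pmf p" and V: "V \<in> {U}" for l V
  proof -
    have "blinfun_apply (A l) ` U = U" using assms l GL_dim_image[OF letters_GL[OF l], of U]
      by (intro subspace_dim_equal) (auto intro: linear_subspace_image[OF blinfun_linear])
    then show ?thesis using V by simp
  qed
qed (use assms in auto)

lemma orbit_spans:
  assumes "u \<noteq> 0"
  shows "span ((\<lambda>w. word_prod A w u) ` lists (set_pmf p)) = UNIV"
proof (rule ccontr)
  let ?S = "(\<lambda>w. word_prod A w u) ` lists (set_pmf p)"
  assume *: "span ?S \<noteq> UNIV"
  have "u \<in> ?S" by (rule image_eqI[of _ _ "[]"]) auto
  then have "u \<in> span ?S" by (rule span_base)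
  then have "span ?S \<noteq> {0}" using assms by auto
  moreover have "blinfun_apply (A l) ` span ?S \<subseteq> span ?S" if l: "l \<in> set_pmf p" for l
  proof -
    note lin = blinfun_linear[of "A l"]
    have "blinfun_apply (A l) ` ?S \<subseteq> ?S"
    proof (intro subsetI, elim imageE, simp only:)
      fix w assume "w \<in> lists (set_pmf p)"
      then show "A l (word_prod A w u) \<in> ?S" using l
        by (intro image_eqI[of _ _ "w @ [l]"]) (auto simp: word_prod_append)
    qed
    then show ?thesis unfolding linear_span_image[OF lin, symmetric] by (rule span_mono)
  qed
  ultimately show False using no_invariant_subspace[of "span ?S"] * by auto
qed

text \<open>Products of words are dense in S_\<mu>, since \<open>GL\<close> intersected with their
  closure is a closed semigroup containing the letters. The proximal sequence can thus be moved to
  products of words.\<close>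

lemma proximal_words:
  obtains w \<alpha> L where "\<forall>n. w n \<in> lists (set_pmf p)"
    "(\<lambda>n. \<alpha> n *\<^sub>R word_prod A (w n)) \<longlonglongrightarrow> L" "dim (range (blinfun_apply L)) = 1"
proof -
  let ?W = "word_prod A ` lists (set_pmf p)"
  define T where "T = GL \<inter> closure ?W"
  have "closed_semigroup_of (map_pmf A p) \<subseteq> T"
  proof (rule closed_semigroup_subset)
    show "T \<subseteq> GL" by (auto simp: T_def)
    show "A l \<in> T" if "l \<in> set_pmf p" for l
    proof -
      have "A l \<in> ?W"
        by (rule image_eqI[of _ _ "[l]"]) (use that in \<open>auto intro!: blinfun_eqI\<close>)
      then show ?thesis using letters_GL[OF that] closure_subset[of ?W] unfolding T_def by blast
    qed
    show "h \<in> T" if "\<And>n. g n \<in> T" "g \<longlonglongrightarrow> h" "h \<in> GL" for g h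
      using that closed_sequentially[OF closed_closure, of g ?W h] by (auto simp: T_def)
    show "g o\<^sub>L h \<in> T" if "g \<in> T" "h \<in> T" for g h
    proof -
      obtain a where a: "\<And>n. a n \<in> ?W" "a \<longlonglongrightarrow> g" using \<open>g \<in> T\<close> by (auto simp: T_def closure_sequential)
      obtain b where b: "\<And>n. b n \<in> ?W" "b \<longlonglongrightarrow> h" using \<open>h \<in> T\<close> by (auto simp: T_def closure_sequential)
      have "a n o\<^sub>L b n \<in> ?W" for n
      proof -
        obtain u w where "a n = word_prod A u" "b n = word_prod A w"
          "u \<in> lists (set_pmf p)" "w \<in> lists (set_pmf p)" using a(1)[of n] b(1)[of n] by blast
        then show ?thesis by (intro image_eqI[of _ _ "w @ u"]) (auto simp: word_prod_append)
      qed
      moreover have "(\<lambda>n. a n o\<^sub>L b n) \<longlonglongrightarrow> (g o\<^sub>L h)"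
        by (rule bounded_bilinear.tendsto[OF bounded_bilinear_blinfun_compose a(2) b(2)])
      ultimately have "g o\<^sub>L h \<in> closure ?W" unfolding closure_sequential
        by (intro exI[of _ "\<lambda>n. a n o\<^sub>L b n"]) blast
      then show ?thesis using that unfolding T_def by (auto intro: compose_in_GL)
    qed
  qed
  then obtain B \<alpha> L where B: "\<And>n. B n \<in> T" and lim: "(\<lambda>n. \<alpha> n *\<^sub>R B n) \<longlonglongrightarrow> L"
    and L: "dim (range (blinfun_apply L)) = 1"
    using proximal unfolding proximal_def by blast
  \<comment> \<open>The tolerance is divided by \<open>1 + \<bar>\<alpha> n\<bar>\<close> because
    the error is multiplied by \<open>\<alpha> n\<close> afterwards.\<close>
  have "\<exists>w\<in>lists (set_pmf p). dist (word_prod A w) (B n) < 1 / ((real n + 1) * (1 + \<bar>\<alpha> n\<bar>))" for n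
  proof -
    have "B n \<in> closure ?W" using B[of n] by (simp add: T_def)
    moreover have "0 < 1 / ((real n + 1) * (1 + \<bar>\<alpha> n\<bar>))" by (simp add: add_pos_nonneg)
    ultimately show ?thesis unfolding closure_approachable by blast
  qed
  then obtain w where w: "\<And>n. w n \<in> lists (set_pmf p)"
    "\<And>n. dist (word_prod A (w n)) (B n) < 1 / ((real n + 1) * (1 + \<bar>\<alpha> n\<bar>))" by metis
  have "(\<lambda>n. \<alpha> n *\<^sub>R word_prod A (w n) - \<alpha> n *\<^sub>R B n) \<longlonglongrightarrow> 0"
  proof (rule Lim_null_comparison)
    show "\<forall>\<^sub>F n in sequentially. norm (\<alpha> n *\<^sub>R word_prod A (w n) - \<alpha> n *\<^sub>R B n) \<le> 1 / (real n + 1)"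
    proof (rule always_eventually, rule allI)
      fix n
      have nz: "1 + \<bar>\<alpha> n\<bar> \<noteq> 0" by linarith
      have "norm (\<alpha> n *\<^sub>R word_prod A (w n) - \<alpha> n *\<^sub>R B n) = \<bar>\<alpha> n\<bar> * dist (word_prod A (w n)) (B n)"
        by (simp add: dist_norm scaleR_diff_right[symmetric])
      also have "\<dots> \<le> (1 + \<bar>\<alpha> n\<bar>) * (1 / ((real n + 1) * (1 + \<bar>\<alpha> n\<bar>)))"
        using w(2)[of n] by (intro mult_mono) auto
      also have "\<dots> = 1 / (real n + 1)" using nz by simp
      finally show "norm (\<alpha> n *\<^sub>R word_prod A (w n) - \<alpha> n *\<^sub>R B n) \<le> 1 / (real n + 1)" .
    qed
    show "(\<lambda>n. 1 / (real n + 1)) \<longlonglongrightarrow> 0"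
      using LIMSEQ_inverse_real_of_nat by (simp add: inverse_eq_divide add.commute)
  qed
  from tendsto_add[OF this lim] have "(\<lambda>n. \<alpha> n *\<^sub>R word_prod A (w n)) \<longlonglongrightarrow> L" by simp
  then show ?thesis using that w(1) L by blast
qed

end

section \<open>Non-concentration on subspaces\<close>

text \<open>Compactness of the Grassmannian. Every \<open>U k\<close> is the image of one fixed
  coordinate subspace E under a linear isometry; these operators are bounded, so a subsequence
  converges in norm, and the limit is again isometric on E. Norm convergence makes the approximation
  uniform over V.\<close>

lemma subspace_sequence_limit:
  fixes U :: "nat \<Rightarrow> 'a::euclidean_space set"
  assumes U: "\<And>k. subspace (U k)" "\<And>k. dim (U k) = r"
  obtains \<sigma> V where "strict_mono (\<sigma>::nat \<Rightarrow> nat)" "subspace V" "dim V = r"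
    "\<forall>\<epsilon>>0. \<forall>\<^sub>F k in sequentially. \<forall>u\<in>V. \<exists>u'\<in>U (\<sigma> k). norm u' \<le> norm u \<and> norm (u - u') \<le> \<epsilon> * norm u"
proof -
  have "r \<le> DIM('a)" using U(2) dim_subset_UNIV by metis
  then obtain B0 :: "'a set" where B0: "B0 \<subseteq> Basis" "card B0 = r"
    by (metis obtain_subset_with_card_n)
  have finB0: "finite B0" using B0(1) finite_subset finite_Basis by blast
  define E where "E = span B0"
  have E: "subspace E" "dim E = r"
    using B0 independent_mono[OF independent_Basis B0(1)] by (auto simp: E_def dim_eq_card_independent)
  have "\<exists>f. linear f \<and> f \<in> E \<rightarrow> U k \<and> (\<forall>x\<in>E. norm (f x) = norm x)" for k
    using isometry_subset_subspace[OF E(1) U(1)[of k]] E(2) U(2)[of k] by (metis order_refl)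
  then obtain f where f: "\<And>k. linear (f k)" "\<And>k. f k \<in> E \<rightarrow> U k" "\<And>k x. x \<in> E \<Longrightarrow> norm (f k x) = norm x"
    by metis
  \<comment> \<open>\<open>f k\<close> composed with the orthogonal projection onto E, so that
    convergence takes place in the finite-dimensional space of operators.\<close>
  define T where "T k = Blinfun (\<lambda>x. \<Sum>b\<in>B0. (x \<bullet> b) *\<^sub>R f k b)" for k
  have T: "blinfun_apply (T k) x = (\<Sum>b\<in>B0. (x \<bullet> b) *\<^sub>R f k b)" for k x
    unfolding T_def by (subst bounded_linear_Blinfun_apply) (auto intro!: bounded_linear_intros)
  have Tf: "blinfun_apply (T k) x = f k x" if "x \<in> E" for k x
  proof -
    have "x = (\<Sum>b\<in>B0. (x \<bullet> b) *\<^sub>R b)"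
    proof (rule euclidean_eqI)
      fix i :: 'a assume i: "i \<in> Basis"
      have "(\<Sum>b\<in>B0. (x \<bullet> b) *\<^sub>R b) \<bullet> i = (\<Sum>b\<in>B0. if b = i then x \<bullet> i else 0)"
        unfolding inner_sum_left using i B0(1) by (intro sum.cong) (auto simp: inner_Basis)
      also have "\<dots> = (if i \<in> B0 then x \<bullet> i else 0)" using finB0 by simp
      also have "\<dots> = x \<bullet> i"
      proof (cases "i \<in> B0")
        case False
        have "orthogonal i x" using that unfolding E_def
        proof (rule orthogonal_to_span)
          show "\<And>y. y \<in> B0 \<Longrightarrow> orthogonal i y" using i B0(1) False
            by (auto simp: orthogonal_def inner_Basis)
        qed
        then show ?thesis using False by (simp add: orthogonal_def inner_commute)
      qed simp
      finally show "x \<bullet> i = (\<Sum>b\<in>B0. (x \<bullet> b) *\<^sub>R b) \<bullet> i" by simp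
    qed
    then have "f k x = f k (\<Sum>b\<in>B0. (x \<bullet> b) *\<^sub>R b)" by simp
    also have "\<dots> = blinfun_apply (T k) x"
      unfolding T using f(1)[of k] by (simp add: linear_sum linear_scale)
    finally show ?thesis by simp
  qed
  have "norm (T k) \<le> real r" for k
  proof (rule norm_blinfun_bound)
    fix x :: 'a
    have "norm (blinfun_apply (T k) x) \<le> (\<Sum>b\<in>B0. norm x)"
      unfolding T
    proof (rule sum_norm_le)
      fix b assume b: "b \<in> B0"
      have "norm (f k b) = 1" using f(3)[of b k] b B0(1) by (auto simp: E_def span_base)
      then show "norm ((x \<bullet> b) *\<^sub>R f k b) \<le> norm x" using Basis_le_norm[of b x] b B0(1) by auto
    qed
    then show "norm (blinfun_apply (T k) x) \<le> real r * norm x" using B0(2) by simp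
  qed simp
  then have "bounded (range T)" by (auto simp: bounded_iff)
  from bounded_imp_convergent_subsequence[OF this] obtain \<sigma> T' where
    \<sigma>: "strict_mono \<sigma>" and lim: "(T \<circ> \<sigma>) \<longlonglongrightarrow> T'" by metis
  have norm_T': "norm (blinfun_apply T' x) = norm x" if "x \<in> E" for x
  proof -
    have "(\<lambda>k. norm (blinfun_apply ((T \<circ> \<sigma>) k) x)) \<longlonglongrightarrow> norm (blinfun_apply T' x)"
      by (intro tendsto_intros lim)
    moreover have "(\<lambda>k. norm (blinfun_apply ((T \<circ> \<sigma>) k) x)) = (\<lambda>k. norm x)"
      using that by (auto simp: Tf f)
    ultimately show ?thesis by (metis LIMSEQ_unique tendsto_const)
  qed
  have inj: "inj_on (blinfun_apply T') E"
  proof (rule inj_onI)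
    fix x y assume xy: "x \<in> E" "y \<in> E" "blinfun_apply T' x = blinfun_apply T' y"
    then have "norm (blinfun_apply T' (x - y)) = norm (x - y)"
      using norm_T' E(1) by (simp add: subspace_diff)
    with xy(3) show "x = y" by (simp add: blinfun.diff_right)
  qed
  show ?thesis
  proof (rule that[OF \<sigma>])
    show "subspace (blinfun_apply T' ` E)" by (rule linear_subspace_image[OF blinfun_linear E(1)])
    have "span E = E" using E(1) by (simp only: span_eq_iff)
    then have "inj_on (blinfun_apply T') (span E)" using inj by (simp only:)
    from dim_image_eq[OF blinfun_linear this] show "dim (blinfun_apply T' ` E) = r" using E(2) by simp
    show "\<forall>\<epsilon>>0. \<forall>\<^sub>F k in sequentially. \<forall>u\<in>blinfun_apply T' ` E. \<exists>u'\<in>U (\<sigma> k).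
        norm u' \<le> norm u \<and> norm (u - u') \<le> \<epsilon> * norm u"
    proof (intro allI impI)
      fix \<epsilon> :: real assume "\<epsilon> > 0"
      with lim have "\<forall>\<^sub>F k in sequentially. dist ((T \<circ> \<sigma>) k) T' < \<epsilon>" by (rule tendstoD)
      then show "\<forall>\<^sub>F k in sequentially. \<forall>u\<in>blinfun_apply T' ` E. \<exists>u'\<in>U (\<sigma> k).
          norm u' \<le> norm u \<and> norm (u - u') \<le> \<epsilon> * norm u"
      proof eventually_elim
        case (elim k)
        show ?case
        proof
          fix u assume "u \<in> blinfun_apply T' ` E"
          then obtain x where x: "x \<in> E" "u = blinfun_apply T' x" by blast
          have "norm (blinfun_apply (T' - T (\<sigma> k)) x) \<le> norm (T' - T (\<sigma> k)) * norm x"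
            by (rule norm_blinfun)
          also have "\<dots> \<le> \<epsilon> * norm x" using elim
            by (intro mult_right_mono) (auto simp: dist_norm norm_minus_commute)
          finally have "norm (u - f (\<sigma> k) x) \<le> \<epsilon> * norm u"
            using x Tf[OF x(1)] norm_T'[OF x(1)] by (simp add: blinfun.diff_left)
          moreover have "f (\<sigma> k) x \<in> U (\<sigma> k)" using f(2) x(1) by auto
          ultimately show "\<exists>u'\<in>U (\<sigma> k). norm u' \<le> norm u \<and> norm (u - u') \<le> \<epsilon> * norm u"
            using f(3)[OF x(1)] norm_T'[OF x(1)] x(2) by (intro bexI[of _ "f (\<sigma> k) x"]) auto
        qed
      qed
    qed
  qed
qed

text \<open>Measured against \<open>norm g\<close>, so unchanged when g is scaled: for small \<eta>
  the normalised map nearly kills U.\<close>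

definition small_on :: "('a::euclidean_space \<Rightarrow>\<^sub>L 'a) \<Rightarrow> 'a set \<Rightarrow> real \<Rightarrow> bool" where
  "small_on g U \<eta> \<longleftrightarrow> (\<forall>u\<in>U. norm (blinfun_apply g u) \<le> \<eta> * norm g * norm u)"

lemma small_on_mono: "small_on g U \<eta> \<Longrightarrow> \<eta> \<le> \<eta>' \<Longrightarrow> small_on g U \<eta>'"
  unfolding small_on_def by (meson mult_right_mono norm_ge_zero order_trans)

text \<open>A vector u2 of U' outside U splits as q + z with q in U and z orthogonal to U, and g is
  small at z because it is small at u2 and at q. The constant c depends on U and U' but not on
  g.\<close>

lemma small_on_span_insert:
  fixes U U' :: "'a::euclidean_space set"
  assumes U: "subspace U" "dim U = r" and U': "subspace U'" "dim U' = r" and "U \<noteq> U'"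
  obtains V c where "subspace V" "dim V = Suc r" "c > 0"
    "\<And>g \<eta>. \<eta> \<ge> 0 \<Longrightarrow> small_on g U \<eta> \<Longrightarrow> small_on g U' \<eta> \<Longrightarrow> small_on g V (c * \<eta>)"
proof -
  have "\<not> U' \<subseteq> U" using assms subspace_dim_equal[of U' U] by auto
  then obtain u2 where u2: "u2 \<in> U'" "u2 \<notin> U" by blast
  have spU: "span U = U" using U(1) by (simp only: span_eq_iff)
  obtain q z where qz: "q \<in> span U" "\<And>w. w \<in> span U \<Longrightarrow> orthogonal z w" "u2 = q + z"
    using orthogonal_subspace_decomp_exists[of U u2] by metis
  have q: "q \<in> U" using qz(1) spU by simp
  have z: "z \<noteq> 0" using u2 qz q by auto
  \<comment> \<open>The 1 pays for the component in U. The quotient comes from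
    \<open>\<bar>k\<bar> <= norm u / norm z\<close> for the coefficient k of z in u.\<close>
  define c where "c = 1 + (norm u2 + norm q) / norm z"
  show ?thesis
  proof (rule that[of "span (insert u2 U)" c])
    show "dim (span (insert u2 U)) = Suc r"
      using u2(2) U(2) by (simp add: dim_insert spU del: span_eq_iff)
    show "c > 0" unfolding c_def by (intro add_pos_nonneg divide_nonneg_nonneg add_nonneg_nonneg) auto
    fix g :: "'a \<Rightarrow>\<^sub>L 'a" and \<eta> :: real
    assume \<eta>: "\<eta> \<ge> 0" and s: "small_on g U \<eta>" "small_on g U' \<eta>"
    show "small_on g (span (insert u2 U)) (c * \<eta>)"
      unfolding small_on_def
    proof
      fix u assume "u \<in> span (insert u2 U)"
      then obtain k where k: "u - k *\<^sub>R u2 \<in> U" using spU by (auto simp: span_breakdown_eq)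
      define u1 where "u1 = (u - k *\<^sub>R u2) + k *\<^sub>R q"
      have u1: "u1 \<in> U" unfolding u1_def by (intro subspace_add[OF U(1)] subspace_scale[OF U(1)] k q)
      have u: "u = u1 + k *\<^sub>R z" unfolding u1_def qz(3) by (simp add: algebra_simps)
      have "orthogonal z u1" using qz(2) u1 spU by simp
      then have pyth: "(norm u)\<^sup>2 = (norm u1)\<^sup>2 + (norm (k *\<^sub>R z))\<^sup>2"
        unfolding u by (intro norm_add_Pythagorean) (simp add: orthogonal_def inner_commute)
      have "(norm u1)\<^sup>2 \<le> (norm u)\<^sup>2" "(norm (k *\<^sub>R z))\<^sup>2 \<le> (norm u)\<^sup>2" using pyth by auto
      then have n1: "norm u1 \<le> norm u" and n2: "norm (k *\<^sub>R z) \<le> norm u"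
        by (auto intro: power2_le_imp_le)
      have gz: "norm (blinfun_apply g z) \<le> \<eta> * norm g * (norm u2 + norm q)"
      proof -
        have "blinfun_apply g z = blinfun_apply g u2 - blinfun_apply g q"
          using qz(3) by (simp add: blinfun.add_right)
        then have "norm (blinfun_apply g z) \<le> norm (blinfun_apply g u2) + norm (blinfun_apply g q)"
          by (simp add: norm_triangle_ineq4)
        also have "\<dots> \<le> \<eta> * norm g * norm u2 + \<eta> * norm g * norm q"
          using s u2(1) q unfolding small_on_def by (intro add_mono) auto
        finally show ?thesis by (simp add: algebra_simps)
      qed
      have "norm (blinfun_apply g u) \<le> norm (blinfun_apply g u1) + \<bar>k\<bar> * norm (blinfun_apply g z)"
        unfolding u by (simp add: blinfun.add_right blinfun.scaleR_right norm_triangle_le)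
      also have "\<dots> \<le> \<eta> * norm g * norm u1 + \<bar>k\<bar> * (\<eta> * norm g * (norm u2 + norm q))"
        using s(1) u1 gz unfolding small_on_def by (intro add_mono mult_left_mono) auto
      also have "\<dots> \<le> \<eta> * norm g * norm u + (norm u / norm z) * (\<eta> * norm g * (norm u2 + norm q))"
        using n1 n2 \<eta> z by (intro add_mono mult_left_mono mult_right_mono) (auto simp: field_simps)
      also have "\<dots> = c * \<eta> * norm g * norm u" using z by (simp add: c_def field_simps)
      finally show "norm (blinfun_apply g u) \<le> c * \<eta> * norm g * norm u" .
    qed
  qed auto
qed

context gl_walk
begin

text \<open>The averages over time make the concentration on subspaces stationary up to an error \<open>1 / n\<close>;
  see \<open>avg_small_step\<close>.\<close>

definition avg_small :: "nat \<Rightarrow> 'a set \<Rightarrow> real \<Rightarrow> real" where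
  "avg_small n U \<eta> = (\<Sum>m<n. word_prob p m (\<lambda>w. small_on (word_prod A w) U \<eta>)) / real n"

lemma avg_small_le_1: "avg_small n U \<eta> \<le> 1"
proof -
  have "(\<Sum>m<n. word_prob p m (\<lambda>w. small_on (word_prod A w) U \<eta>)) \<le> (\<Sum>m<n. 1)"
    by (intro sum_mono word_prob_le_1)
  then show ?thesis unfolding avg_small_def by (auto simp: divide_le_eq_1)
qed

lemma avg_small_mono:
  assumes "\<And>g. small_on g U \<eta> \<Longrightarrow> small_on g V \<eta>'"
  shows "avg_small n U \<eta> \<le> avg_small n V \<eta>'"
  unfolding avg_small_def using assms
  by (intro divide_right_mono sum_mono word_prob_mono) auto

text \<open>The first letter is moved from the word to the subspace, which turns time
  \<open>m + 1\<close> into time m; the term at time 0 costs at most \<open>1 / n\<close>. One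
  factor K compares \<open>g o A l\<close> with g, the other compares u with
  \<open>A l u\<close>.\<close>

lemma avg_small_step:
  assumes K: "K \<ge> 1" "\<And>l x. l \<in> set_pmf p \<Longrightarrow> norm (A l x) \<le> K * norm x"
    "\<And>l x. l \<in> set_pmf p \<Longrightarrow> norm x \<le> K * norm (A l x)"
    and \<eta>: "\<eta> \<ge> 0" and n: "n > 0"
  shows "avg_small n U \<eta> \<le> 1 / real n + (\<Sum>l\<in>set_pmf p. pmf p l * avg_small n (blinfun_apply (A l) ` U) (K\<^sup>2 * \<eta>))"
proof -
  define P where "P m V \<theta> = word_prob p m (\<lambda>w. small_on (word_prod A w) V \<theta>)" for m V \<theta>
  have step: "P (Suc m) U \<eta> \<le> (\<Sum>l\<in>set_pmf p. pmf p l * P m (blinfun_apply (A l) ` U) (K\<^sup>2 * \<eta>))" for m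
  proof -
    have "small_on g (blinfun_apply (A l) ` U) (K\<^sup>2 * \<eta>)"
      if l: "l \<in> set_pmf p" and s: "small_on (g o\<^sub>L A l) U \<eta>" for l g
      unfolding small_on_def
    proof
      fix v assume "v \<in> blinfun_apply (A l) ` U"
      then obtain u where u: "u \<in> U" "v = A l u" by blast
      have "norm (A l) \<le> K" using K(1,2) l by (intro norm_blinfun_bound) auto
      then have "norm (g o\<^sub>L A l) \<le> norm g * K"
        using norm_blinfun_compose[of g "A l"] by (meson mult_left_mono norm_ge_zero order_trans)
      moreover have "norm (g v) \<le> \<eta> * norm (g o\<^sub>L A l) * norm u"
        using s u unfolding small_on_def by auto
      moreover have "norm u \<le> K * norm v" using K(3)[OF l] u by simp
      ultimately have "norm (g v) \<le> \<eta> * (norm g * K) * (K * norm v)"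
        using \<eta> K(1) by (meson mult_left_mono mult_mono mult_nonneg_nonneg norm_ge_zero order_trans)
      then show "norm (g v) \<le> K\<^sup>2 * \<eta> * norm g * norm v" by (simp add: power2_eq_square mult_ac)
    qed
    then show ?thesis unfolding P_def
      by (auto intro!: letter_sum_mono word_prob_mono)
  qed
  obtain n' where n': "n = Suc n'" using n by (cases n) auto
  have "(\<Sum>m<n. P m U \<eta>) = P 0 U \<eta> + (\<Sum>m<n'. P (Suc m) U \<eta>)"
    unfolding n' by (rule sum.lessThan_Suc_shift)
  also have "\<dots> \<le> 1 + (\<Sum>m<n'. \<Sum>l\<in>set_pmf p. pmf p l * P m (blinfun_apply (A l) ` U) (K\<^sup>2 * \<eta>))"
    by (intro add_mono sum_mono step) (auto simp: P_def intro: word_prob_le_1)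
  also have "\<dots> \<le> 1 + (\<Sum>m<n. \<Sum>l\<in>set_pmf p. pmf p l * P m (blinfun_apply (A l) ` U) (K\<^sup>2 * \<eta>))"
    unfolding n' by (auto simp: P_def intro!: sum_nonneg mult_nonneg_nonneg word_prob_nonneg)
  also have "(\<Sum>m<n. \<Sum>l\<in>set_pmf p. pmf p l * P m (blinfun_apply (A l) ` U) (K\<^sup>2 * \<eta>))
      = (\<Sum>l\<in>set_pmf p. pmf p l * (\<Sum>m<n. P m (blinfun_apply (A l) ` U) (K\<^sup>2 * \<eta>)))"
    by (subst sum.swap) (simp add: sum_distrib_left)
  finally have "(\<Sum>m<n. P m U \<eta>) / real n \<le>
      (1 + (\<Sum>l\<in>set_pmf p. pmf p l * (\<Sum>m<n. P m (blinfun_apply (A l) ` U) (K\<^sup>2 * \<eta>)))) / real n"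
    by (rule divide_right_mono) simp
  then show ?thesis unfolding avg_small_def P_def
    by (simp add: add_divide_distrib sum_divide_distrib[where A = "set_pmf p"])
qed

text \<open>The estimate is uniform in U once \<open>n >= n0\<close>. Downward induction on r,
  starting from the full dimension, reaches the case of lines.\<close>

definition spread :: "nat \<Rightarrow> bool" where
  "spread r \<longleftrightarrow> (\<forall>\<delta>>0. \<exists>\<eta>>0. \<exists>n0. \<forall>n\<ge>n0. \<forall>U. subspace U \<and> dim U = r \<longrightarrow> avg_small n U \<eta> \<le> \<delta>)"

text \<open>A nonzero map attains its norm, so with \<eta> = 1/2 it is never small on the whole
  space.\<close>

lemma spread_DIM: "spread DIM('a)"
proof -
  have "avg_small n U (1/2) = 0" if "dim U = DIM('a)" "subspace U" for n and U :: "'a set"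
  proof -
    have U: "U = UNIV" using that by (metis dim_eq_full span_eq_iff)
    have "\<not> small_on (word_prod A w) U (1/2)" if "w \<in> words p m" for w m
    proof
      assume s: "small_on (word_prod A w) U (1/2)"
      obtain v where v: "norm v = 1" "norm (word_prod A w v) = norm (word_prod A w)"
        by (rule norm_attained)
      have "0 < norm (word_prod A w)"
        using that by (intro GL_norm_pos word_prod_GL) (auto simp: words_def)
      moreover have "norm (word_prod A w v) \<le> 1/2 * norm (word_prod A w) * norm v"
        using s unfolding U small_on_def by blast
      ultimately show False using v by simp
    qed
    then have "word_prob p m (\<lambda>w. small_on (word_prod A w) U (1/2)) = 0" for m
      using word_mean_cong[of p m "\<lambda>w. of_bool (small_on (word_prod A w) U (1/2))" "\<lambda>_. 0"] by simp
    then show ?thesis by (simp add: avg_small_def)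
  qed
  then show ?thesis unfolding spread_def
    by (intro allI impI exI[of _ "1/2"] exI[of _ 0] conjI) auto
qed

text \<open>If T members of J are small at once, then \<open>T <= 1 + T (T - 1)\<close>, since
  \<open>(T - 1)^2 >= 0\<close>. This is averaged over words and times. Many subspaces of definite
  concentration therefore force some pair to be small together.\<close>

lemma sum_avg_small_le:
  assumes "finite J" "n > 0"
  shows "(\<Sum>U\<in>J. avg_small n U \<eta>) \<le> 1 + (\<Sum>(U, V)\<in>{(U, V). U \<in> J \<and> V \<in> J \<and> U \<noteq> V}.
      (\<Sum>m<n. word_prob p m (\<lambda>w. small_on (word_prod A w) U \<eta> \<and> small_on (word_prod A w) V \<eta>)) / real n)"
proof -
  let ?D = "{(U, V). U \<in> J \<and> V \<in> J \<and> U \<noteq> V}"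
  have finD: "finite ?D" by (rule finite_subset[of _ "J \<times> J"]) (use assms in auto)
  have count: "(\<Sum>U\<in>J. of_bool (P U) :: real) \<le> 1 + (\<Sum>(U, V)\<in>?D. of_bool (P U \<and> P V))" for P
  proof -
    define T where "T = {U \<in> J. P U}"
    have finT: "finite T" using assms by (simp add: T_def)
    have "(\<Sum>U\<in>J. of_bool (P U) :: real) = card T"
      using assms(1) by (simp add: T_def of_bool_def sum.If_cases Int_def)
    moreover have "(\<Sum>(U, V)\<in>?D. of_bool (P U \<and> P V) :: real) = real (card T * card T) - card T"
    proof -
      have "(\<Sum>(U, V)\<in>?D. of_bool (P U \<and> P V) :: real) = card {x \<in> ?D. case x of (U, V) \<Rightarrow> P U \<and> P V}"
        using finD by (simp add: of_bool_def case_prod_unfold sum.If_cases Int_def)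
      also have "{x \<in> ?D. case x of (U, V) \<Rightarrow> P U \<and> P V} = T \<times> T - (\<lambda>U. (U, U)) ` T"
        by (auto simp: T_def)
      also have "card \<dots> = card (T \<times> T) - card ((\<lambda>U. (U, U)) ` T)"
        using finT by (intro card_Diff_subset) auto
      also have "card ((\<lambda>U. (U, U)) ` T) = card T" by (intro card_image inj_onI) auto
      also have "card (T \<times> T) = card T * card T" by (rule card_cartesian_product)
      also have "real (card T * card T - card T) = real (card T * card T) - card T"
        by (intro of_nat_diff) (metis le_square)
      finally show ?thesis .
    qed
    moreover have "0 \<le> (real (card T) - 1)\<^sup>2" by simp
    ultimately show ?thesis by (simp add: power2_eq_square algebra_simps)
  qed
  have "(\<Sum>U\<in>J. word_prob p m (\<lambda>w. small_on (word_prod A w) U \<eta>))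
      \<le> 1 + (\<Sum>(U, V)\<in>?D. word_prob p m (\<lambda>w. small_on (word_prod A w) U \<eta> \<and> small_on (word_prod A w) V \<eta>))" for m
  proof -
    have "(\<Sum>U\<in>J. word_prob p m (\<lambda>w. small_on (word_prod A w) U \<eta>))
       = word_mean p m (\<lambda>w. \<Sum>U\<in>J. of_bool (small_on (word_prod A w) U \<eta>))"
      by (rule word_mean_sum[symmetric])
    also have "\<dots> \<le> word_mean p m (\<lambda>w. 1 + (\<Sum>x\<in>?D. of_bool (small_on (word_prod A w) (fst x) \<eta> \<and> small_on (word_prod A w) (snd x) \<eta>)))"
      using count[of "\<lambda>U. small_on (word_prod A w) U \<eta>" for w]
      by (intro word_mean_mono) (simp add: case_prod_unfold)
    also have "\<dots> = 1 + (\<Sum>(U, V)\<in>?D. word_prob p m (\<lambda>w. small_on (word_prod A w) U \<eta> \<and> small_on (word_prod A w) V \<eta>))"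
      by (simp add: word_mean_add word_mean_sum case_prod_unfold)
    finally show ?thesis .
  qed
  then have "(\<Sum>m<n. \<Sum>U\<in>J. word_prob p m (\<lambda>w. small_on (word_prod A w) U \<eta>))
      \<le> (\<Sum>m<n. 1 + (\<Sum>(U, V)\<in>?D. word_prob p m (\<lambda>w. small_on (word_prod A w) U \<eta> \<and> small_on (word_prod A w) V \<eta>)))"
    by (intro sum_mono)
  also have "\<dots> = real n + (\<Sum>(U, V)\<in>?D. \<Sum>m<n. word_prob p m (\<lambda>w. small_on (word_prod A w) U \<eta> \<and> small_on (word_prod A w) V \<eta>))"
    by (simp add: sum.distrib case_prod_unfold sum.swap[of _ _ "{..<n}"])
  finally have "(\<Sum>U\<in>J. \<Sum>m<n. word_prob p m (\<lambda>w. small_on (word_prod A w) U \<eta>))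
      \<le> real n + (\<Sum>(U, V)\<in>?D. \<Sum>m<n. word_prob p m (\<lambda>w. small_on (word_prod A w) U \<eta> \<and> small_on (word_prod A w) V \<eta>))"
    by (simp add: sum.swap[of _ J])
  from divide_right_mono[OF this, of "real n"] show ?thesis using assms(2)
    by (simp add: avg_small_def add_divide_distrib sum_divide_distrib case_prod_unfold)
qed

end

context proximal_walk
begin

text \<open>Along a sequence of times realising the largest asymptotic concentration \<open>q\<close> on subspaces of
  dimension \<open>r\<close>, the subspaces that attain \<open>q\<close> are permuted by the letters. There are only finitely many
  of them, as a product cannot be small on two of them without being small on a larger subspace.\<close>

lemma spread_step:
  assumes r: "1 \<le> r" "r < DIM('a)" and spread_Suc: "spread (Suc r)"
  shows "spread r"
proof (rule ccontr)
  assume "\<not> spread r"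
  then obtain \<delta> where \<delta>: "\<delta> > 0"
    and conc: "\<And>\<eta> n0. \<eta> > 0 \<Longrightarrow> \<exists>n\<ge>n0. \<exists>U. subspace U \<and> dim U = r \<and> avg_small n U \<eta> > \<delta>"
    unfolding spread_def not_all not_imp not_ex by (metis not_le)
  obtain K where K: "K \<ge> 1" "\<And>l x. l \<in> set_pmf p \<Longrightarrow> norm (A l x) \<le> K * norm x"
    "\<And>l x. l \<in> set_pmf p \<Longrightarrow> norm x \<le> K * norm (A l x)"
    by (rule letters_bounds) blast
  \<comment> \<open>The infimum q of C is the limit, as \<eta> tends to 0, of the limsup in n of the
    largest concentration on an r-dimensional subspace.\<close>
  define C where "C = {c. \<exists>\<eta>>0. \<exists>n0. \<forall>n\<ge>n0. \<forall>U. subspace U \<and> dim U = r \<longrightarrow> avg_small n U \<eta> \<le> c}"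
  define q where "q = Inf C"
  have C1: "1 \<in> C" unfolding C_def using avg_small_le_1
    by (intro CollectI exI[of _ 1] exI[of _ 0]) auto
  have C\<delta>: "\<delta> \<le> c" if c: "c \<in> C" for c
  proof -
    obtain \<eta> n0 where *: "\<eta> > 0" "\<forall>n\<ge>n0. \<forall>U. subspace U \<and> dim U = r \<longrightarrow> avg_small n U \<eta> \<le> c"
      using c unfolding C_def by blast
    from conc[OF *(1), of n0] obtain n U where "n \<ge> n0" "subspace U" "dim U = r" "avg_small n U \<eta> > \<delta>"
      by blast
    with *(2) show ?thesis by (metis less_imp_le less_le_trans)
  qed
  have bdd: "bdd_below C" by (rule bdd_belowI[of _ \<delta>]) (rule C\<delta>)
  have q\<delta>: "q \<ge> \<delta>" unfolding q_def by (rule cInf_greatest) (use C1 C\<delta> in auto)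
  have upper: "\<exists>\<eta>>0. \<exists>n0. \<forall>n\<ge>n0. \<forall>U. subspace U \<and> dim U = r \<longrightarrow> avg_small n U \<eta> \<le> q + \<epsilon>"
    if "\<epsilon> > 0" for \<epsilon>
  proof -
    have "Inf C < q + \<epsilon>" using that by (simp add: q_def)
    then obtain c where c: "c \<in> C" "c < q + \<epsilon>" using cInf_lessD[of C] C1 by blast
    then obtain \<eta> n0 where *: "\<eta> > 0" "\<forall>n\<ge>n0. \<forall>U. subspace U \<and> dim U = r \<longrightarrow> avg_small n U \<eta> \<le> c"
      unfolding C_def by blast
    have "\<forall>n\<ge>n0. \<forall>U. subspace U \<and> dim U = r \<longrightarrow> avg_small n U \<eta> \<le> q + \<epsilon>"
      using *(2) c(2) by fastforce
    with *(1) show ?thesis by blast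
  qed
  \<comment> \<open>No number below the infimum q belongs to C; this yields nearly extremal
    subspaces at arbitrarily late times and with \<eta> tending to 0.\<close>
  have "\<exists>n\<ge>k. \<exists>U. subspace U \<and> dim U = r \<and> avg_small n U (1 / (real k + 1)) > q - 1 / (real k + 1)" for k
  proof -
    have "q - 1 / (real k + 1) \<notin> C"
    proof
      assume "q - 1 / (real k + 1) \<in> C"
      from cInf_lower[OF this bdd] show False
        by (simp add: q_def add_pos_nonneg add.commute not_le)
    qed
    moreover have "1 / (real k + 1) > 0" by simp
    ultimately show ?thesis unfolding C_def by (simp only: mem_Collect_eq) (meson not_le)
  qed
  then obtain nn UU where nn: "\<And>k. nn k \<ge> k" and UU: "\<And>k. subspace (UU k)" "\<And>k. dim (UU k) = r"
    and big: "\<And>k. avg_small (nn k) (UU k) (1 / (real k + 1)) > q - 1 / (real k + 1)" by metis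
  obtain \<sigma> V where \<sigma>: "strict_mono (\<sigma>::nat \<Rightarrow> nat)" and V: "subspace V" "dim V = r"
    and lim: "\<forall>\<epsilon>>0. \<forall>\<^sub>F k in sequentially. \<forall>u\<in>V. \<exists>u'\<in>UU (\<sigma> k). norm u' \<le> norm u \<and> norm (u - u') \<le> \<epsilon> * norm u"
    by (rule subspace_sequence_limit[of UU r, OF UU])
  define N where "N k = nn (\<sigma> k)" for k
  have N: "N k \<ge> k" for k unfolding N_def using nn[of "\<sigma> k"] seq_suble[OF \<sigma>, of k] by simp
  define Y where "Y = {U. subspace U \<and> dim U = r \<and>
    (\<forall>\<eta>>0. \<forall>\<epsilon>>0. \<forall>\<^sub>F k in sequentially. avg_small (N k) U \<eta> \<ge> q - \<epsilon>)}"
  have tend0: "(\<lambda>k. 1 / (real k + 1)) \<longlonglongrightarrow> 0"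
    using LIMSEQ_inverse_real_of_nat by (simp add: inverse_eq_divide add.commute)
  have small0: "\<forall>\<^sub>F k in sequentially. 1 / (real k + 1) < \<epsilon>" if "\<epsilon> > 0" for \<epsilon>
    using order_tendstoD(2)[OF tend0 that] .
  have smallN: "\<forall>\<^sub>F k in sequentially. 1 / real (N k) \<le> \<epsilon> \<and> N k > 0" if "\<epsilon> > 0" for \<epsilon>
  proof -
    have "\<forall>\<^sub>F k in sequentially. 1 / real k < \<epsilon>"
      using order_tendstoD(2)[OF lim_1_over_n that] .
    with eventually_gt_at_top[of 0] show ?thesis
    proof eventually_elim
      case (elim k)
      have "1 / real (N k) \<le> 1 / real k" using elim N[of k] by (intro divide_left_mono) auto
      with elim N[of k] show ?case by auto
    qed
  qed
  have "V \<in> Y" unfolding Y_def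
  proof (intro CollectI conjI allI impI V)
    fix \<eta> \<epsilon> :: real assume \<eta>: "\<eta> > 0" and \<epsilon>: "\<epsilon> > 0"
    have "\<forall>\<^sub>F k in sequentially. 1 / (real k + 1) < min (\<eta>/2) \<epsilon>" using small0[of "min (\<eta>/2) \<epsilon>"] \<eta> \<epsilon> by simp
    moreover have "\<forall>\<^sub>F k in sequentially. \<forall>u\<in>V. \<exists>u'\<in>UU (\<sigma> k). norm u' \<le> norm u \<and> norm (u - u') \<le> \<eta>/2 * norm u"
      using spec[OF lim, of "\<eta>/2"] \<eta> by simp
    ultimately show "\<forall>\<^sub>F k in sequentially. avg_small (N k) V \<eta> \<ge> q - \<epsilon>"
    proof eventually_elim
      case (elim k)
      have k: "1 / (real (\<sigma> k) + 1) \<le> 1 / (real k + 1)"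
        using seq_suble[OF \<sigma>, of k] by (intro divide_left_mono) auto
      have "avg_small (N k) (UU (\<sigma> k)) (1 / (real (\<sigma> k) + 1)) \<le> avg_small (N k) V \<eta>"
      proof (rule avg_small_mono)
        fix g :: "'a \<Rightarrow>\<^sub>L 'a" assume s: "small_on g (UU (\<sigma> k)) (1 / (real (\<sigma> k) + 1))"
        have s': "small_on g (UU (\<sigma> k)) (\<eta>/2)"
          by (rule small_on_mono[OF s]) (use k elim in auto)
        show "small_on g V \<eta>" unfolding small_on_def
        proof
          fix u assume "u \<in> V"
          with elim obtain u' where u': "u' \<in> UU (\<sigma> k)" "norm u' \<le> norm u" "norm (u - u') \<le> \<eta>/2 * norm u"
            by blast
          have "norm (blinfun_apply g u) \<le> norm (blinfun_apply g u') + norm (blinfun_apply g (u - u'))"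
            by (metis add.commute blinfun.diff_right diff_add_cancel norm_triangle_ineq)
          also have "\<dots> \<le> \<eta>/2 * norm g * norm u' + norm g * (\<eta>/2 * norm u)"
          proof (rule add_mono)
            show "norm (blinfun_apply g u') \<le> \<eta>/2 * norm g * norm u'"
              using s' u'(1) unfolding small_on_def by blast
            show "norm (blinfun_apply g (u - u')) \<le> norm g * (\<eta>/2 * norm u)"
              using norm_blinfun[of g "u - u'"] mult_left_mono[OF u'(3) norm_ge_zero[of g]] by linarith
          qed
          also have "\<dots> \<le> \<eta>/2 * norm g * norm u + norm g * (\<eta>/2 * norm u)"
            using u'(2) \<eta> by (intro add_mono mult_left_mono) auto
          finally show "norm (blinfun_apply g u) \<le> \<eta> * norm g * norm u" by (simp add: algebra_simps)
        qed
      qed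
      with big[of "\<sigma> k"] k elim show ?case unfolding N_def by auto
    qed
  qed
  moreover have "blinfun_apply (A l) ` U \<in> Y" if l: "l \<in> set_pmf p" and U: "U \<in> Y" for l U
    unfolding Y_def
  proof (intro CollectI conjI allI impI)
    show "subspace (blinfun_apply (A l) ` U)"
      using U by (auto simp: Y_def intro: linear_subspace_image[OF blinfun_linear])
    show "dim (blinfun_apply (A l) ` U) = r"
      using U GL_dim_image[OF letters_GL[OF l]] by (auto simp: Y_def)
    fix \<eta> \<epsilon> :: real assume \<eta>: "\<eta> > 0" and \<epsilon>: "\<epsilon> > 0"
    have pl: "0 < pmf p l" "pmf p l \<le> 1" using l by (auto simp: pmf_positive_iff pmf_le_1)
    \<comment> \<open>The mean over letters of the concentrations on the images is at least
      \<open>q - 2 * e\<close>, and each is at most \<open>q + e\<close>. The one for l is then at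
      least \<open>q - 3 * e / pmf p l\<close>.\<close>
    define e where "e = \<epsilon> * pmf p l / 3"
    have e: "e > 0" using \<epsilon> pl by (simp add: e_def)
    obtain \<eta>1 n1 where \<eta>1: "\<eta>1 > 0"
      "\<And>n U. n \<ge> n1 \<Longrightarrow> subspace U \<Longrightarrow> dim U = r \<Longrightarrow> avg_small n U \<eta>1 \<le> q + e"
      using upper[OF e] by blast
    define \<eta>2 where "\<eta>2 = min \<eta> \<eta>1"
    have \<eta>2: "\<eta>2 > 0" "\<eta>2 \<le> \<eta>" "\<eta>2 \<le> \<eta>1" using \<eta> \<eta>1 by (auto simp: \<eta>2_def)
    have K2: "K\<^sup>2 > 0" using K(1) by simp
    have "\<forall>\<^sub>F k in sequentially. avg_small (N k) U (\<eta>2 / K\<^sup>2) \<ge> q - e"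
      using U e \<eta>2(1) K2 unfolding Y_def by simp
    with smallN[OF e] eventually_ge_at_top[of n1]
    show "\<forall>\<^sub>F k in sequentially. avg_small (N k) (blinfun_apply (A l) ` U) \<eta> \<ge> q - \<epsilon>"
    proof eventually_elim
      case (elim k)
      let ?a = "\<lambda>l'. avg_small (N k) (blinfun_apply (A l') ` U) \<eta>2"
      have le: "?a l' \<le> q + e" if l': "l' \<in> set_pmf p" for l'
      proof -
        have "?a l' \<le> avg_small (N k) (blinfun_apply (A l') ` U) \<eta>1"
          by (rule avg_small_mono) (rule small_on_mono[OF _ \<eta>2(3)])
        also have "\<dots> \<le> q + e"
          using elim N[of k] U GL_dim_image[OF letters_GL[OF l']]
          by (intro \<eta>1(2)) (auto simp: Y_def intro: linear_subspace_image[OF blinfun_linear])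
        finally show ?thesis .
      qed
      have "avg_small (N k) U (\<eta>2 / K\<^sup>2) \<le> 1 / real (N k) +
          (\<Sum>l\<in>set_pmf p. pmf p l * avg_small (N k) (blinfun_apply (A l) ` U) (K\<^sup>2 * (\<eta>2 / K\<^sup>2)))"
        using elim \<eta>2(1) K2 by (intro avg_small_step[OF K]) auto
      then have "q - e \<le> e + (\<Sum>l\<in>set_pmf p. pmf p l * ?a l)" using elim K2 by simp
      also have "(\<Sum>l\<in>set_pmf p. pmf p l * ?a l) = pmf p l * ?a l + (\<Sum>l'\<in>set_pmf p - {l}. pmf p l' * ?a l')"
        using l finite_letters by (simp add: sum.remove)
      also have "(\<Sum>l'\<in>set_pmf p - {l}. pmf p l' * ?a l') \<le> (\<Sum>l'\<in>set_pmf p - {l}. pmf p l' * (q + e))"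
        by (intro sum_mono mult_left_mono le) auto
      also have "\<dots> = (1 - pmf p l) * (q + e)"
        using l finite_letters sum_letters by (simp add: sum_distrib_right[symmetric] sum_diff1)
      finally have "pmf p l * q \<le> pmf p l * ?a l + (3 - pmf p l) * e" by (simp add: algebra_simps)
      also have "(3 - pmf p l) * e \<le> 3 * e" using pl e by (intro mult_right_mono) auto
      also have "3 * e = pmf p l * \<epsilon>" by (simp add: e_def)
      finally have "pmf p l * q \<le> pmf p l * (?a l + \<epsilon>)" by (simp add: algebra_simps)
      then have "q \<le> ?a l + \<epsilon>" using pl by simp
      moreover have "?a l \<le> avg_small (N k) (blinfun_apply (A l) ` U) \<eta>"
        by (rule avg_small_mono) (rule small_on_mono[OF _ \<eta>2(2)])
      ultimately show ?case by simp
    qed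
  qed
  moreover have "finite Y"
  proof (rule ccontr)
    assume "infinite Y"
    \<comment> \<open>M members of Y have concentrations summing to at least
      \<open>M * q - 1/4\<close>, while the pair terms will add at most 1/4 to the 1 in
      \<open>sum_avg_small_le\<close>. This leaves \<open>M * q <= 3/2\<close>.\<close>
    obtain M :: nat where M: "real M * q \<ge> 2" using q\<delta> \<delta> reals_Archimedean3[of q] by (metis less_imp_le less_le_trans)
    obtain J where J: "J \<subseteq> Y" "finite J" "card J = M" using infinite_arbitrarily_large[OF \<open>infinite Y\<close>] by metis
    let ?D = "{(U, V). U \<in> J \<and> V \<in> J \<and> U \<noteq> V}"
    have D: "finite ?D" "card ?D \<le> M * M"
    proof -
      have "?D \<subseteq> J \<times> J" by auto
      then show "finite ?D" "card ?D \<le> M * M" using J finite_subset[of ?D "J \<times> J"] card_mono[of "J \<times> J" ?D]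
        by (auto simp: card_cartesian_product)
    qed
    define e where "e = 1 / (4 * (real M * real M + 1))"
    have e: "e > 0" "real M * real M * e \<le> 1/4"
      by (auto simp: e_def field_simps add_pos_nonneg)
    let ?b = "\<lambda>n U V \<eta>. (\<Sum>m<n. word_prob p m (\<lambda>w. small_on (word_prod A w) U \<eta> \<and> small_on (word_prod A w) V \<eta>)) / real n"
    have pair: "\<forall>\<^sub>F \<eta> in at_right 0. \<forall>\<^sub>F k in sequentially. ?b (N k) U V \<eta> \<le> e" if UV: "(U, V) \<in> ?D" for U V
    proof -
      have "U \<in> Y" "V \<in> Y" "U \<noteq> V" using UV J by auto
      \<comment> \<open>Joint smallness on two distinct members passes to a space of dimension
        \<open>r + 1\<close>, where \<open>spread (Suc r)\<close> applies.\<close>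
      then obtain W c where W: "subspace W" "dim W = Suc r" "c > 0"
        "\<And>g \<eta>. \<eta> \<ge> 0 \<Longrightarrow> small_on g U \<eta> \<Longrightarrow> small_on g V \<eta> \<Longrightarrow> small_on g W (c * \<eta>)"
        using small_on_span_insert[of U r V] unfolding Y_def by blast
      obtain \<eta>0 n0 where \<eta>0: "\<eta>0 > 0" "\<And>n. n \<ge> n0 \<Longrightarrow> avg_small n W \<eta>0 \<le> e"
        using spread_Suc e(1) W unfolding spread_def by metis
      have "\<forall>\<^sub>F \<eta> in at_right 0. \<eta> < \<eta>0 / c"
        using order_tendstoD(2)[OF tendsto_ident_at[of "0::real" "{0<..}"], of "\<eta>0 / c"] \<eta>0(1) W(3)
        by simp
      moreover have "\<forall>\<^sub>F \<eta> in at_right (0::real). 0 < \<eta>" by (rule eventually_at_right_less)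
      ultimately show ?thesis
      proof eventually_elim
        case (elim \<eta>)
        show ?case using eventually_ge_at_top[of n0]
        proof eventually_elim
          case (elim k)
          have "?b (N k) U V \<eta> \<le> avg_small (N k) W \<eta>0" unfolding avg_small_def
          proof (intro divide_right_mono sum_mono word_prob_mono)
            fix m w assume "small_on (word_prod A w) U \<eta> \<and> small_on (word_prod A w) V \<eta>"
            then have "small_on (word_prod A w) W (c * \<eta>)" using W(4)[of \<eta>] \<open>0 < \<eta>\<close> by auto
            then show "small_on (word_prod A w) W \<eta>0"
              using \<open>\<eta> < \<eta>0 / c\<close> W(3) by (rule_tac small_on_mono) (auto simp: field_simps)
          qed simp
          also have "\<dots> \<le> e" using \<eta>0(2) N[of k] elim by (meson order_trans)
          finally show ?case .
        qed
      qed
    qed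
    have "\<forall>\<^sub>F \<eta> in at_right 0. \<forall>x\<in>?D. \<forall>\<^sub>F k in sequentially. ?b (N k) (fst x) (snd x) \<eta> \<le> e"
    proof (intro eventually_ball_finite D ballI)
      fix x assume "x \<in> ?D"
      then have "(fst x, snd x) \<in> ?D" by simp
      then show "\<forall>\<^sub>F \<eta> in at_right 0. \<forall>\<^sub>F k in sequentially. ?b (N k) (fst x) (snd x) \<eta> \<le> e"
        by (rule pair)
    qed
    with eventually_at_right_less[of "0::real"]
    have "\<forall>\<^sub>F \<eta> in at_right 0. 0 < \<eta> \<and> (\<forall>x\<in>?D. \<forall>\<^sub>F k in sequentially. ?b (N k) (fst x) (snd x) \<eta> \<le> e)"
      by eventually_elim simp
    from eventually_happens'[OF trivial_limit_at_right_real this]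
    obtain \<eta> where \<eta>: "0 < \<eta> \<and> (\<forall>x\<in>?D. \<forall>\<^sub>F k in sequentially. ?b (N k) (fst x) (snd x) \<eta> \<le> e)"
      by (elim exE)
    note \<eta> = conjunct1[OF \<eta>] bspec[OF conjunct2[OF \<eta>]]
    have "\<forall>\<^sub>F k in sequentially. \<forall>x\<in>?D. ?b (N k) (fst x) (snd x) \<eta> \<le> e"
      using \<eta>(2) by (intro eventually_ball_finite D ballI)
    moreover have "\<forall>\<^sub>F k in sequentially. \<forall>U\<in>J. avg_small (N k) U \<eta> \<ge> q - 1 / (4 * (real M + 1))"
      using \<eta>(1) J unfolding Y_def by (intro eventually_ball_finite ballI) auto
    ultimately have "\<forall>\<^sub>F k in sequentially. False"
      using eventually_gt_at_top[of 0]
    proof eventually_elim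
      case (elim k)
      have Nk: "N k > 0" using elim N[of k] by simp
      have "real M * q - real M * (1 / (4 * (real M + 1))) = (\<Sum>U\<in>J. q - 1 / (4 * (real M + 1)))"
        using J by (simp add: algebra_simps)
      also have "\<dots> \<le> (\<Sum>U\<in>J. avg_small (N k) U \<eta>)" using elim by (intro sum_mono) auto
      also have "\<dots> \<le> 1 + (\<Sum>(U, V)\<in>?D. ?b (N k) U V \<eta>)" by (rule sum_avg_small_le[OF J(2) Nk])
      also have "(\<Sum>(U, V)\<in>?D. ?b (N k) U V \<eta>) \<le> (\<Sum>x\<in>?D. e)"
        using elim by (intro sum_mono) (auto simp: case_prod_unfold)
      also have "\<dots> = real (card ?D) * e" by simp
      also have "\<dots> \<le> real (M * M) * e" using D(2) e(1)
        by (intro mult_right_mono of_nat_mono) auto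
      also have "\<dots> \<le> 1/4" using e(2) by simp
      finally have "real M * q - real M * (1 / (4 * (real M + 1))) \<le> 5/4" by simp
      moreover have "real M * (1 / (4 * (real M + 1))) \<le> 1/4" by (simp add: field_simps)
      ultimately show False using M by linarith
    qed
    then show False by simp
  qed
  moreover have "subspace U \<and> U \<noteq> {0} \<and> U \<noteq> UNIV" if "U \<in> Y" for U
    using that r unfolding Y_def by auto
  ultimately show False using no_invariant_family[of Y] by blast
qed

lemma spread_1: "spread 1"
proof -
  have "spread (DIM('a) - k)" if "k < DIM('a)" for k using that
  proof (induction k)
    case 0
    then show ?case using spread_DIM by simp
  next
    case (Suc k)
    then have "spread (Suc (DIM('a) - Suc k))" using Suc_diff_Suc[of k "DIM('a)"] by simp
    then show ?case by (rule spread_step[rotated 2]) (use Suc in auto)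
  qed
  from this[of "DIM('a) - 1"] show ?thesis by simp
qed

end

section \<open>Non-degeneracy along the whole orbit\<close>

context finite_letters
begin

lemma word_prob_not: "word_prob p n (\<lambda>w. \<not> P w) = 1 - word_prob p n P"
proof -
  have "word_prob p n (\<lambda>w. \<not> P w) + word_prob p n P = word_mean p n (\<lambda>w. 1)"
    unfolding word_mean_add[symmetric] by (rule word_mean_cong) auto
  then show ?thesis by simp
qed

lemma word_prob_disj: "word_prob p n (\<lambda>w. P w \<or> Q w) \<le> word_prob p n P + word_prob p n Q"
  unfolding word_mean_add[symmetric] by (rule word_mean_mono) auto

lemma word_prob_True: "(\<And>w. w \<in> words p n \<Longrightarrow> P w) \<Longrightarrow> word_prob p n P = 1"
  using word_mean_cong[of p n "\<lambda>w. of_bool (P w)" "\<lambda>_. 1"] by simp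

lemma word_prob_False: "(\<And>w. w \<in> words p n \<Longrightarrow> \<not> P w) \<Longrightarrow> word_prob p n P = 0"
  using word_mean_cong[of p n "\<lambda>w. of_bool (P w)" "\<lambda>_. 0"] by simp

lemma word_prob_prefix:
  "u \<in> words p k \<Longrightarrow> k \<le> n \<Longrightarrow> word_prob p n (\<lambda>w. take k w = u) = word_weight p u"
proof (induction k arbitrary: u n)
  case 0
  then show ?case by (simp add: words_0 word_weight_def)
next
  case (Suc k)
  then obtain n' where n': "n = Suc n'" "k \<le> n'" by (cases n) auto
  obtain l u' where u: "u = l # u'" "l \<in> set_pmf p" "u' \<in> words p k"
    using Suc.prems(1) by (auto simp: words_Suc)
  have "word_prob p n (\<lambda>w. take (Suc k) w = u)
      = (\<Sum>l'\<in>set_pmf p. pmf p l' * word_prob p n' (\<lambda>w. l' = l \<and> take k w = u'))"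
    by (simp add: n' u)
  also have "\<dots> = (\<Sum>l'\<in>set_pmf p. if l' = l then pmf p l * word_weight p u' else 0)"
    using Suc.IH[OF u(3) n'(2)] by (intro sum.cong) auto
  also have "\<dots> = pmf p l * word_weight p u'" using finite_letters u(2) by simp
  finally show ?case by (simp add: u word_weight_def)
qed

end

lemma blinfun_compose_assoc: "(f o\<^sub>L g) o\<^sub>L h = f o\<^sub>L (g o\<^sub>L h)"
  by (rule blinfun_eqI) simp

lemma blinfun_compose_id [simp]: "f o\<^sub>L id_blinfun = f" "id_blinfun o\<^sub>L f = f"
  by (auto intro!: blinfun_eqI)

context proximal_walk
begin

lemma spread_line:
  assumes "\<delta> > 0"
  obtains \<eta> n0 where "\<eta> > 0" "\<And>n x. n \<ge> n0 \<Longrightarrow> x \<noteq> 0 \<Longrightarrow>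
    (\<Sum>m<n. word_prob p m (\<lambda>w. norm (word_prod A w x) \<le> \<eta> * norm (word_prod A w) * norm x)) \<le> \<delta> * real n"
proof -
  obtain \<eta> n0 where \<eta>: "\<eta> > 0" "\<And>n U. n \<ge> n0 \<Longrightarrow> subspace U \<Longrightarrow> dim U = 1 \<Longrightarrow> avg_small n U \<eta> \<le> \<delta>"
    using spread_1 assms unfolding spread_def by metis
  show ?thesis
  proof (rule that[OF \<eta>(1), of "Suc n0"])
    fix n and x :: 'a assume n: "n \<ge> Suc n0" and x: "x \<noteq> 0"
    have small: "small_on g (span {x}) \<eta> \<longleftrightarrow> norm (g x) \<le> \<eta> * norm g * norm x" for g
    proof
      assume "norm (g x) \<le> \<eta> * norm g * norm x"
      then have "\<bar>t\<bar> * norm (g x) \<le> \<bar>t\<bar> * (\<eta> * norm g * norm x)" for t :: real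
        by (rule mult_left_mono) simp
      then show "small_on g (span {x}) \<eta>"
        unfolding small_on_def span_singleton by (auto simp: blinfun.scaleR_right mult_ac)
    qed (auto simp: small_on_def span_base)
    have "avg_small n (span {x}) \<eta> \<le> \<delta>"
      using n x by (intro \<eta>(2)) auto
    then show "(\<Sum>m<n. word_prob p m (\<lambda>w. norm (word_prod A w x) \<le> \<eta> * norm (word_prod A w) * norm x)) \<le> \<delta> * real n"
      using n by (simp add: avg_small_def small divide_le_eq)
  qed
qed

text \<open>If an orbit degenerates once, then most later products are degenerate as well, so that the
  averaged estimate controls the first degeneration time.\<close>

lemma orbit_nondegenerate:
  assumes "\<delta> > 0"
  obtains \<eta> where "\<eta> > 0" "\<And>n x. x \<noteq> 0 \<Longrightarrow> word_prob p n (\<lambda>w. \<exists>k\<le>n.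
    norm (word_prod A (take k w) x) < \<eta> * norm (word_prod A (take k w)) * norm x) \<le> \<delta>"
proof -
  obtain \<eta>1 n1 where \<eta>1: "\<eta>1 > 0" "\<And>n x. n \<ge> n1 \<Longrightarrow> x \<noteq> 0 \<Longrightarrow>
      (\<Sum>m<n. word_prob p m (\<lambda>w. norm (word_prod A w x) \<le> \<eta>1 * norm (word_prod A w) * norm x)) \<le> 1/4 * real n"
    by (rule spread_line[of "1/4"]) auto
  obtain \<eta>2 n2 where \<eta>2: "\<eta>2 > 0" "\<And>n x. n \<ge> n2 \<Longrightarrow> x \<noteq> 0 \<Longrightarrow>
      (\<Sum>m<n. word_prob p m (\<lambda>w. norm (word_prod A w x) \<le> \<eta>2 * norm (word_prod A w) * norm x)) \<le> \<delta>/2 * real n"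
    by (rule spread_line[of "\<delta>/2"]) (use assms in auto)
  \<comment> \<open>Suppose h is degenerate at x at level \<eta>. If a further word w is not
    \<eta>1-degenerate at the most stretched image of h, then
    \<open>norm (w o h) >= \<eta>1 * norm w * norm h\<close>, and so \<open>w o h\<close> is
    \<eta>2-degenerate at x.\<close>
  define \<eta> where "\<eta> = \<eta>1 * \<eta>2"
  define \<tau> where "\<tau> x n h = word_prob p n (\<lambda>w. \<exists>k\<le>n. norm (word_prod A (take k w) (blinfun_apply h x))
      < \<eta> * norm (word_prod A (take k w) o\<^sub>L h) * norm x)"
    for n and x :: 'a and h :: "'a \<Rightarrow>\<^sub>L 'a"
  define f where "f x m h = word_prob p m (\<lambda>w. norm (word_prod A w (blinfun_apply h x))
      \<le> \<eta>2 * norm (word_prod A w o\<^sub>L h) * norm x)"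
    for m and x :: 'a and h :: "'a \<Rightarrow>\<^sub>L 'a"
  have degenerate: "3/4 * real N \<le> (\<Sum>m<N. f x m h)"
    if h: "h \<in> GL" and N: "N \<ge> n1" and bad: "norm (blinfun_apply h x) < \<eta> * norm h * norm x" for h N x
  proof -
    obtain v where v: "norm v = 1" "norm (blinfun_apply h v) = norm h" by (rule norm_attained)
    define u where "u = blinfun_apply h v"
    have "v \<noteq> 0" using v(1) by auto
    then have u: "u \<noteq> 0" using GL_nonzero[OF h] by (simp add: u_def)
    have "f x m h \<ge> 1 - word_prob p m (\<lambda>w. norm (word_prod A w u) \<le> \<eta>1 * norm (word_prod A w) * norm u)" for m
      unfolding word_prob_not[symmetric] f_def
    proof (rule word_prob_mono)
      fix w assume "\<not> norm (word_prod A w u) \<le> \<eta>1 * norm (word_prod A w) * norm u"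
      then have gu: "\<eta>1 * norm (word_prod A w) * norm u < norm (word_prod A w u)" by simp
      have "norm (word_prod A w u) \<le> norm (word_prod A w o\<^sub>L h)"
        using norm_blinfun[of "word_prod A w o\<^sub>L h" v] v by (simp add: u_def)
      with gu have gu': "\<eta>1 * norm (word_prod A w) * norm h \<le> norm (word_prod A w o\<^sub>L h)"
        using v by (simp add: u_def)
      have "norm (word_prod A w (blinfun_apply h x)) \<le> norm (word_prod A w) * norm (blinfun_apply h x)"
        by (rule norm_blinfun)
      also have "\<dots> \<le> norm (word_prod A w) * (\<eta> * norm h * norm x)"
        using bad by (intro mult_left_mono) auto
      also have "\<dots> = \<eta>2 * (\<eta>1 * norm (word_prod A w) * norm h) * norm x" by (simp add: \<eta>_def)
      also have "\<dots> \<le> \<eta>2 * norm (word_prod A w o\<^sub>L h) * norm x"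
        using gu' \<eta>2(1) by (intro mult_right_mono mult_left_mono) auto
      finally show "norm (word_prod A w (blinfun_apply h x)) \<le> \<eta>2 * norm (word_prod A w o\<^sub>L h) * norm x" .
    qed
    then have "(\<Sum>m<N. f x m h) \<ge> (\<Sum>m<N. 1 - word_prob p m (\<lambda>w. norm (word_prod A w u) \<le> \<eta>1 * norm (word_prod A w) * norm u))"
      by (intro sum_mono)
    then show ?thesis using \<eta>1(2)[OF N u] by (simp add: sum_subtractf)
  qed
  have f_nonneg: "0 \<le> f x m h" for x m h unfolding f_def by (rule word_prob_nonneg)
  \<comment> \<open>Decomposition at the first degenerate time k, by induction on n with the product
    so far in h. At least \<open>N - n\<close> times remain after k, and on average three quarters
    of them count in the sum on the right.\<close>
  have main: "\<tau> x n h * (3/4 * (real N - real n)) \<le> (\<Sum>m<N. f x m h)"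
    if "h \<in> GL" "N \<ge> n + n1" for x n h N
    using that
  proof (induction n arbitrary: h N)
    case (0 h N)
    show ?case
    proof (cases "norm (blinfun_apply h x) < \<eta> * norm h * norm x")
      case False
      then have "\<tau> x 0 h = 0" by (auto simp: \<tau>_def intro!: word_prob_False)
      then show ?thesis using f_nonneg by (auto intro!: sum_nonneg)
    next
      case True
      have "\<tau> x 0 h \<le> 1" unfolding \<tau>_def by (rule word_prob_le_1)
      then have "\<tau> x 0 h * (3/4 * (real N - real 0)) \<le> 1 * (3/4 * real N)"
        by (intro mult_mono) auto
      also have "\<dots> \<le> (\<Sum>m<N. f x m h)" using degenerate[OF _ _ True, of N] 0 by simp
      finally show ?thesis .
    qed
  next
    case (Suc n h N)
    show ?case
    proof (cases "norm (blinfun_apply h x) < \<eta> * norm h * norm x")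
      case True
      have "\<tau> x (Suc n) h \<le> 1" unfolding \<tau>_def by (rule word_prob_le_1)
      then have "\<tau> x (Suc n) h * (3/4 * (real N - real (Suc n))) \<le> 1 * (3/4 * real N)"
        using Suc.prems by (intro mult_mono) auto
      also have "\<dots> \<le> (\<Sum>m<N. f x m h)" using degenerate[OF _ _ True, of N] Suc.prems by simp
      finally show ?thesis .
    next
      case False
      obtain N' where N': "N = Suc N'" "N' \<ge> n + n1" using Suc.prems by (cases N) auto
      have "\<tau> x (Suc n) h \<le> (\<Sum>l\<in>set_pmf p. pmf p l * \<tau> x n (A l o\<^sub>L h))"
        unfolding \<tau>_def word_mean.simps
      proof (intro letter_sum_mono word_prob_mono)
        fix l w assume "\<exists>k\<le>Suc n. norm (word_prod A (take k (l # w)) (blinfun_apply h x))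
           < \<eta> * norm (word_prod A (take k (l # w)) o\<^sub>L h) * norm x"
        then obtain k where k: "k \<le> Suc n" "norm (word_prod A (take k (l # w)) (blinfun_apply h x))
           < \<eta> * norm (word_prod A (take k (l # w)) o\<^sub>L h) * norm x" by blast
        then obtain k' where "k = Suc k'" using False by (cases k) auto
        with k show "\<exists>k\<le>n. norm (word_prod A (take k w) (blinfun_apply (A l o\<^sub>L h) x))
          < \<eta> * norm (word_prod A (take k w) o\<^sub>L (A l o\<^sub>L h)) * norm x"
          by (intro exI[of _ k']) (auto simp: blinfun_compose_assoc)
      qed
      then have "\<tau> x (Suc n) h * (3/4 * (real N - real (Suc n)))
         \<le> (\<Sum>l\<in>set_pmf p. pmf p l * \<tau> x n (A l o\<^sub>L h)) * (3/4 * (real N - real (Suc n)))"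
        using Suc.prems by (intro mult_right_mono) auto
      also have "\<dots> = (\<Sum>l\<in>set_pmf p. pmf p l * (\<tau> x n (A l o\<^sub>L h) * (3/4 * (real N' - real n))))"
      proof -
        have "real N - real (Suc n) = real N' - real n" by (simp add: N')
        then show ?thesis by (simp only: sum_distrib_right mult.assoc)
      qed
      also have "\<dots> \<le> (\<Sum>l\<in>set_pmf p. pmf p l * (\<Sum>m<N'. f x m (A l o\<^sub>L h)))"
        using Suc.IH N'(2) Suc.prems(1) by (intro letter_sum_mono) (auto intro: compose_in_GL letters_GL)
      also have "\<dots> = (\<Sum>m<N'. \<Sum>l\<in>set_pmf p. pmf p l * f x m (A l o\<^sub>L h))"
        by (simp add: sum_distrib_left sum.swap[of _ "{..<N'}"])
      also have "\<dots> = (\<Sum>m<N'. f x (Suc m) h)"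
        by (simp add: f_def blinfun_compose_assoc)
      also have "\<dots> \<le> (\<Sum>m<N. f x m h)"
        unfolding N'(1) sum.lessThan_Suc_shift using f_nonneg by simp
      finally show ?thesis .
    qed
  qed
  show ?thesis
  proof (rule that)
    show "\<eta> > 0" using \<eta>1 \<eta>2 by (simp add: \<eta>_def)
    fix n and x :: 'a assume x: "x \<noteq> 0"
    \<comment> \<open>So long that the first n times are at most a quarter of all. The two factors
      3/4 then give \<open>9/16 * \<tau> <= \<delta> / 2\<close>.\<close>
    define N where "N = 4 * (n + n1 + n2 + 1)"
    have "N \<ge> n + n1" "N \<ge> n2" "real N - real n \<ge> 3/4 * real N" "N > 0" by (auto simp: N_def)
    note N = this
    have "\<tau> x n id_blinfun \<ge> 0" unfolding \<tau>_def by (rule word_prob_nonneg)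
    then have "\<tau> x n id_blinfun * (3/4 * (3/4 * real N)) \<le> \<tau> x n id_blinfun * (3/4 * (real N - real n))"
      using N by (intro mult_left_mono) auto
    also have "\<dots> \<le> (\<Sum>m<N. f x m id_blinfun)" by (rule main[OF id_in_GL N(1)])
    also have "\<dots> \<le> \<delta>/2 * real N" using \<eta>2(2)[OF N(2) x] by (simp add: f_def)
    finally have "\<tau> x n id_blinfun * 9 \<le> \<delta> * 8" using N(4) by (simp add: field_simps)
    then have "\<tau> x n id_blinfun \<le> \<delta>" using assms by simp
    then show "word_prob p n (\<lambda>w. \<exists>k\<le>n. norm (word_prod A (take k w) x) < \<eta> * norm (word_prod A (take k w)) * norm x) \<le> \<delta>"
      by (simp add: \<tau>_def)
  qed
qed

end

section \<open>Contraction of angles\<close>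

text \<open>In singular values, for nonzero g in dimension at least 2: the second is at most
  \<epsilon> times the first.\<close>

definition flat :: "real \<Rightarrow> ('a::euclidean_space \<Rightarrow>\<^sub>L 'a) \<Rightarrow> bool" where
  "flat \<epsilon> g \<longleftrightarrow> (\<forall>x y. area (blinfun_apply g x) (blinfun_apply g y) \<le> \<epsilon> * (norm g)\<^sup>2 * area x y)"

lemma flat_scaleR: "flat \<epsilon> (\<alpha> *\<^sub>R g) \<Longrightarrow> \<alpha> \<noteq> 0 \<Longrightarrow> flat \<epsilon> g"
proof -
  assume *: "flat \<epsilon> (\<alpha> *\<^sub>R g)" "\<alpha> \<noteq> 0"
  show "flat \<epsilon> g" unfolding flat_def
  proof (intro allI)
    fix x y
    have "\<alpha>\<^sup>2 * area (blinfun_apply g x) (blinfun_apply g y) \<le> \<alpha>\<^sup>2 * (\<epsilon> * (norm g)\<^sup>2 * area x y)"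
      using *(1) unfolding flat_def
      by (simp add: blinfun.scaleR_left area_scaleR power_mult_distrib power2_eq_square mult_ac)
        (metis (no_types, lifting) abs_mult_self_eq mult.assoc mult.left_commute)
    then show "area (blinfun_apply g x) (blinfun_apply g y) \<le> \<epsilon> * (norm g)\<^sup>2 * area x y"
      using *(2) by (simp add: mult_le_cancel_left)
  qed
qed

lemma area_add_le: "area x (y + z) \<le> area x y + area x z"
proof (cases "x = 0")
  case False
  let ?P = "\<lambda>y. y - ((y \<bullet> x) / (norm x)\<^sup>2) *\<^sub>R x"
  have "?P (y + z) = ?P y + ?P z" by (simp add: inner_simps algebra_simps add_divide_distrib)
  then have "norm (?P (y + z)) \<le> norm (?P y) + norm (?P z)" by (metis norm_triangle_ineq)
  then show ?thesis unfolding area_height[OF False] by (simp add: distrib_left[symmetric] mult_left_mono)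
qed simp

text \<open>With y replaced by its part z orthogonal to x, the area is expanded along B = L + R. The
  term with L twice vanishes because both images lie on one line; every other term has a factor
  \<rho>, and \<open>\<rho> <= 1\<close> reduces its square to \<rho>.\<close>

lemma flat_near_rank_one:
  fixes L B :: "'a::euclidean_space \<Rightarrow>\<^sub>L 'a"
  assumes L: "range (blinfun_apply L) \<subseteq> span {e}" and B: "norm (B - L) \<le> \<rho>" "\<rho> \<le> 1"
  shows "area (blinfun_apply B x) (blinfun_apply B y) \<le> (2 * norm L + 1) * \<rho> * area x y"
proof (cases "x = 0")
  case False
  define z where "z = y - ((y \<bullet> x) / (norm x)\<^sup>2) *\<^sub>R x"
  define R where "R = B - L"
  have \<rho>: "\<rho> \<ge> 0" using B(1) norm_ge_zero order_trans by blast
  have R: "norm (R u) \<le> \<rho> * norm u" for u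
    using norm_blinfun[of R u] B(1) unfolding R_def by (meson mult_right_mono norm_ge_zero order_trans)
  have Bu: "blinfun_apply B u = L u + R u" for u by (simp add: R_def blinfun.diff_left)
  have "L x \<in> span {e}" "L z \<in> span {e}" using L by auto
  then obtain s t where "L x = s *\<^sub>R e" "L z = t *\<^sub>R e" by (auto simp: span_singleton)
  moreover have "area e e = 0" using area_le_dist[of e e] area_nonneg[of e e] by simp
  ultimately have LL: "area (L x) (L z) = 0" by (simp add: area_scaleR)
  have "area (blinfun_apply B x) (blinfun_apply B y) = area (B x) (B z)"
    by (simp add: z_def blinfun.diff_right blinfun.scaleR_right area_diff_scaleR)
  also have "\<dots> \<le> area (B x) (L z) + area (B x) (R z)" unfolding Bu[of z] by (rule area_add_le)
  also have "area (B x) (L z) \<le> area (L x) (L z) + area (R x) (L z)"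
    unfolding Bu[of x] using area_add_le[of "L z" "L x" "R x"] by (simp add: area_commute)
  also have "area (B x) (R z) \<le> area (L x) (R z) + area (R x) (R z)"
    unfolding Bu[of x] using area_add_le[of "R z" "L x" "R x"] by (simp add: area_commute)
  also have "area (R x) (L z) \<le> norm (R x) * norm (L z)" by (rule area_le)
  also have "\<dots> \<le> (\<rho> * norm x) * (norm L * norm z)" using \<rho> by (intro mult_mono R norm_blinfun) auto
  also have "area (L x) (R z) \<le> norm (L x) * norm (R z)" by (rule area_le)
  also have "\<dots> \<le> (norm L * norm x) * (\<rho> * norm z)" using \<rho> by (intro mult_mono R norm_blinfun) auto
  also have "area (R x) (R z) \<le> norm (R x) * norm (R z)" by (rule area_le)
  also have "\<dots> \<le> (\<rho> * norm x) * (\<rho> * norm z)" using \<rho> by (intro mult_mono R) auto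
  also have "(\<rho> * norm x) * (\<rho> * norm z) \<le> (1 * norm x) * (\<rho> * norm z)"
    using \<rho> B(2) by (intro mult_right_mono) auto
  finally have "area (blinfun_apply B x) (blinfun_apply B y) \<le> (2 * norm L + 1) * \<rho> * (norm x * norm z)"
    using LL by (simp add: algebra_simps)
  also have "norm x * norm z = area x y" using area_height[OF False] by (simp add: z_def)
  finally show ?thesis .
qed simp

context proximal_walk
begin

text \<open>The constants must not depend on h. Only the direction x0 of the most stretched image
  under h matters: if L does not vanish at \<open>u x0\<close>, then u followed by a proximal word
  stretches x0 by a definite amount while it nearly collapses areas. Irreducibility gives such a
  word u for each direction, and compactness of the sphere gives finitely many for all.\<close>

lemma flat_positive_probability:
  assumes "\<epsilon> > 0"
  obtains k c where "c > 0"
    "\<forall>h\<in>GL. word_prob p k (\<lambda>w. \<exists>j\<le>k. flat \<epsilon> (word_prod A (take j w) o\<^sub>L h)) \<ge> c"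
proof -
  obtain w \<alpha> L where w: "\<forall>n. w n \<in> lists (set_pmf p)"
    and lim: "(\<lambda>n. \<alpha> n *\<^sub>R word_prod A (w n)) \<longlonglongrightarrow> L" and L: "dim (range (blinfun_apply L)) = 1"
    by (rule proximal_words)
  obtain e where e: "range (blinfun_apply L) \<subseteq> span {e}"
  proof -
    obtain E where "E \<subseteq> range (blinfun_apply L)" "independent E" "range (blinfun_apply L) \<subseteq> span E" "card E = 1"
      using basis_exists[of "range (blinfun_apply L)"] L by metis
    then show ?thesis using that by (metis card_1_singletonE)
  qed
  let ?O = "\<lambda>(u, k). {x. 1 / (real k + 1) < norm (blinfun_apply L (word_prod A u x))}"
  have "sphere (0::'a) 1 \<subseteq> (\<Union>x\<in>lists (set_pmf p) \<times> (UNIV::nat set). ?O x)"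
  proof
    fix x :: 'a assume "x \<in> sphere 0 1"
    then have x: "x \<noteq> 0" by auto
    have "\<exists>u\<in>lists (set_pmf p). blinfun_apply L (word_prod A u x) \<noteq> 0"
    proof (rule ccontr)
      assume "\<not> ?thesis"
      then have "(\<lambda>w. word_prod A w x) ` lists (set_pmf p) \<subseteq> {y. blinfun_apply L y = 0}" by auto
      then have "span ((\<lambda>w. word_prod A w x) ` lists (set_pmf p)) \<subseteq> {y. blinfun_apply L y = 0}"
        by (rule span_minimal) (auto simp: subspace_def blinfun.add_right blinfun.scaleR_right)
      then have "range (blinfun_apply L) \<subseteq> {0}" using orbit_spans[OF x] by auto
      then show False using L dim_subset[of "range (blinfun_apply L)" "{0}"] by simp
    qed
    then obtain u where u: "u \<in> lists (set_pmf p)" "0 < norm (blinfun_apply L (word_prod A u x))" by auto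
    then obtain k where "inverse (real (Suc k)) < norm (blinfun_apply L (word_prod A u x))"
      using reals_Archimedean by blast
    then have "x \<in> ?O (u, k)" by (simp add: inverse_eq_divide add.commute)
    then show "x \<in> (\<Union>x\<in>lists (set_pmf p) \<times> (UNIV::nat set). ?O x)" using u(1) by blast
  qed
  moreover have "open (?O x)" if "x \<in> lists (set_pmf p) \<times> (UNIV::nat set)" for x
    by (cases x) (auto intro!: open_Collect_less continuous_intros)
  moreover have "compact (sphere (0::'a) 1)" by simp
  ultimately obtain F where F: "F \<subseteq> lists (set_pmf p) \<times> (UNIV::nat set)" "finite F"
    "sphere (0::'a) 1 \<subseteq> (\<Union>x\<in>F. ?O x)"
    using compactE_image[of "sphere (0::'a) 1" "lists (set_pmf p) \<times> (UNIV::nat set)" ?O] by metis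
  define W where "W = fst ` F"
  have W: "finite W" "W \<subseteq> lists (set_pmf p)" using F by (auto simp: W_def)
  define k1 where "k1 = Max (insert 0 (snd ` F))"
  define c1 where "c1 = 1 / (real k1 + 1)"
  have c1: "c1 > 0" by (simp add: c1_def)
  have cover: "\<exists>u\<in>W. c1 \<le> norm (blinfun_apply L (word_prod A u x))" if x: "norm x = 1" for x
  proof -
    obtain u k where uk: "(u, k) \<in> F" "1 / (real k + 1) < norm (blinfun_apply L (word_prod A u x))"
      using F(3) x by fastforce
    have "k \<in> snd ` F" using uk(1) by force
    then have "k \<le> k1" unfolding k1_def using F(2) by (intro Max_ge) auto
    then have "c1 \<le> 1 / (real k + 1)" unfolding c1_def by (intro divide_left_mono) auto
    with uk show ?thesis unfolding W_def by force
  qed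
  define C where "C = 1 + (\<Sum>u\<in>W. norm (word_prod A u))"
  have C: "C \<ge> 1" "norm (word_prod A u) \<le> C" if "u \<in> W" for u
    using member_le_sum[OF that, of "\<lambda>u. norm (word_prod A u)"] W(1) by (auto simp: C_def sum_nonneg)
  have C1: "C \<ge> 1" by (simp add: C_def sum_nonneg)
  \<comment> \<open>The bound \<open>c1 / (2 * C)\<close> keeps \<open>B (u x0)\<close> of norm at
    least \<open>c1 / 2\<close>. The last bound makes the area factor of B, times C^2 for u, at most
    \<open>\<epsilon> * (c1 / 2)^2\<close>.\<close>
  define \<rho> where "\<rho> = min 1 (min (c1 / (2 * C)) (\<epsilon> * c1\<^sup>2 / (4 * C\<^sup>2 * (2 * norm L + 1))))"
  have L1: "2 * norm L + 1 > 0" using norm_ge_zero[of L] by linarith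
  have \<rho>: "\<rho> > 0" "\<rho> \<le> 1" "\<rho> \<le> c1 / (2 * C)" "\<rho> \<le> \<epsilon> * c1\<^sup>2 / (4 * C\<^sup>2 * (2 * norm L + 1))"
    using c1 C1 L1 assms by (auto simp: \<rho>_def)
  have \<rho>C: "\<rho> * C \<le> c1 / 2" using \<rho>(3) C1 by (simp add: field_simps)
  have \<rho>L: "(2 * norm L + 1) * \<rho> * (4 * C\<^sup>2) \<le> \<epsilon> * c1\<^sup>2"
  proof -
    have "4 * C\<^sup>2 * (2 * norm L + 1) > 0" using C1 L1 by simp
    with \<rho>(4) have "\<rho> * (4 * C\<^sup>2 * (2 * norm L + 1)) \<le> \<epsilon> * c1\<^sup>2" by (simp only: pos_le_divide_eq)
    then show ?thesis by (simp only: mult_ac)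
  qed
  obtain n where n: "norm (\<alpha> n *\<^sub>R word_prod A (w n) - L) < \<rho>"
    using LIMSEQ_D[OF lim \<rho>(1)] by blast
  define B where "B = \<alpha> n *\<^sub>R word_prod A (w n)"
  \<comment> \<open>The words \<open>u @ w n\<close> differ in length, so flatness is asked at some
    time up to the longest. A prescribed prefix has its weight as probability, whence the minimum
    c.\<close>
  define k where "k = Max (insert 0 (length ` (\<lambda>u. u @ w n) ` W))"
  define c where "c = Min (insert 1 (word_weight p ` (\<lambda>u. u @ w n) ` W))"
  have uw: "u @ w n \<in> words p (length (u @ w n))" if "u \<in> W" for u
    using that W(2) spec[OF w, of n] by (auto simp: words_def)
  show ?thesis
  proof (rule that)
    show "c > 0" unfolding c_def using W(1) word_weight_pos[OF uw] by (subst Min_gr_iff) auto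
    show "\<forall>h\<in>GL. word_prob p k (\<lambda>w. \<exists>j\<le>k. flat \<epsilon> (word_prod A (take j w) o\<^sub>L h)) \<ge> c"
    proof
      fix h :: "'a \<Rightarrow>\<^sub>L 'a" assume h: "h \<in> GL"
      obtain v where v: "norm v = 1" "norm (blinfun_apply h v) = norm h" by (rule norm_attained)
      have h0: "norm h > 0" by (rule GL_norm_pos[OF h])
      define x0 where "x0 = sgn (blinfun_apply h v)"
      have hv: "blinfun_apply h v = norm h *\<^sub>R x0" using v(2) h0 by (simp add: x0_def sgn_div_norm)
      have x0: "norm x0 = 1" using v(2) h0 by (auto simp: x0_def norm_sgn)
      obtain u where u: "u \<in> W" "c1 \<le> norm (blinfun_apply L (word_prod A u x0))" using cover[OF x0] by blast
      have "norm (blinfun_apply (B - L) (word_prod A u x0)) \<le> \<rho> * C"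
      proof -
        have "norm (blinfun_apply (B - L) (word_prod A u x0)) \<le> norm (B - L) * norm (word_prod A u x0)"
          by (rule norm_blinfun)
        also have "norm (word_prod A u x0) \<le> C"
          using norm_blinfun[of "word_prod A u" x0] C(2)[OF u(1)] x0 by simp
        finally show ?thesis using n C1 by (simp add: B_def) (meson mult_right_mono less_imp_le order_trans zero_le_one mult_left_mono norm_ge_zero)
      qed
      then have "norm (blinfun_apply (B - L) (word_prod A u x0)) \<le> c1 / 2" using \<rho>C by simp
      moreover have "norm (blinfun_apply L (word_prod A u x0)) \<le> norm (blinfun_apply B (word_prod A u x0))
          + norm (blinfun_apply (B - L) (word_prod A u x0))"
        unfolding blinfun.diff_left by (metis norm_minus_commute norm_triangle_sub)
      ultimately have Bu: "c1 / 2 \<le> norm (blinfun_apply B (word_prod A u x0))" using u(2) by linarith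
      have \<alpha>: "\<alpha> n \<noteq> 0" using Bu c1 by (auto simp: B_def blinfun.scaleR_left)
      define g where "g = B o\<^sub>L (word_prod A u o\<^sub>L h)"
      have ng: "c1 / 2 * norm h \<le> norm g"
      proof -
        have "norm (blinfun_apply g v) = norm h * norm (blinfun_apply B (word_prod A u x0))"
          by (simp add: g_def hv blinfun.scaleR_right)
        moreover have "norm (blinfun_apply g v) \<le> norm g" using norm_blinfun[of g v] v(1) by simp
        ultimately show ?thesis using mult_left_mono[OF Bu norm_ge_zero[of h]] by (simp add: mult.commute)
      qed
      have "flat \<epsilon> g" unfolding flat_def
      proof (intro allI)
        fix x y
        let ?x = "word_prod A u (blinfun_apply h x)" and ?y = "word_prod A u (blinfun_apply h y)"
        have "area (blinfun_apply g x) (blinfun_apply g y) \<le> (2 * norm L + 1) * \<rho> * area ?x ?y"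
          unfolding g_def using flat_near_rank_one[OF e, of B \<rho> ?x ?y] n \<rho>(2) by (simp add: B_def)
        also have "area ?x ?y \<le> (norm (word_prod A u))\<^sup>2 * area (blinfun_apply h x) (blinfun_apply h y)"
          by (rule area_image_le)
        also have "\<dots> \<le> C\<^sup>2 * ((norm h)\<^sup>2 * area x y)"
          using C[OF u(1)] by (intro mult_mono power_mono area_image_le) (auto simp: area_nonneg)
        finally have "area (blinfun_apply g x) (blinfun_apply g y)
            \<le> ((2 * norm L + 1) * \<rho> * (4 * C\<^sup>2)) * ((norm h)\<^sup>2 * area x y) / 4"
          using \<rho>(1) L1 by (simp add: mult_left_mono mult_ac)
        also have "\<dots> \<le> (\<epsilon> * c1\<^sup>2) * ((norm h)\<^sup>2 * area x y) / 4"
          using \<rho>L by (intro divide_right_mono mult_right_mono) (auto simp: area_nonneg)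
        also have "\<dots> = \<epsilon> * (c1 / 2 * norm h)\<^sup>2 * area x y" by (simp add: power2_eq_square)
        also have "\<dots> \<le> \<epsilon> * (norm g)\<^sup>2 * area x y"
          using ng c1 assms by (intro mult_right_mono mult_left_mono power_mono) (auto simp: area_nonneg)
        finally show "area (blinfun_apply g x) (blinfun_apply g y) \<le> \<epsilon> * (norm g)\<^sup>2 * area x y" .
      qed
      moreover have "g = \<alpha> n *\<^sub>R (word_prod A (u @ w n) o\<^sub>L h)"
        unfolding g_def B_def by (rule blinfun_eqI) (simp add: word_prod_append blinfun.scaleR_left)
      ultimately have fl: "flat \<epsilon> (word_prod A (u @ w n) o\<^sub>L h)" using flat_scaleR \<alpha> by metis
      let ?j = "length (u @ w n)"
      have j: "?j \<le> k" unfolding k_def using u(1) W(1) by (intro Max_ge insertI2 imageI) auto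
      have "c \<le> word_weight p (u @ w n)" unfolding c_def using u(1) W(1)
        by (intro Min_le insertI2 imageI) auto
      also have "\<dots> = word_prob p k (\<lambda>w'. take ?j w' = u @ w n)"
        using word_prob_prefix[OF uw[OF u(1)] j] by simp
      also have "\<dots> \<le> word_prob p k (\<lambda>w. \<exists>j\<le>k. flat \<epsilon> (word_prod A (take j w) o\<^sub>L h))"
        using fl j by (intro word_prob_mono exI[of _ ?j]) auto
      finally show "c \<le> word_prob p k (\<lambda>w. \<exists>j\<le>k. flat \<epsilon> (word_prod A (take j w) o\<^sub>L h))" .
    qed
  qed
qed

end

context proximal_walk
begin

text \<open>Blocks of length b are trials that succeed with probability at least c whatever came
  before, so a flat product occurs up to time \<open>k * b\<close> except with probability
  \<open>(1 - c) ^ k\<close>. Flatness then survives, weakened from \<epsilon>' to \<epsilon>, as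
  long as the later product is nondegenerate at the most stretched image.\<close>

lemma eventually_flat:
  assumes "\<epsilon> > 0" "\<delta> > 0"
  obtains n0 where "\<And>n. n \<ge> n0 \<Longrightarrow> word_prob p n (\<lambda>w. \<not> flat \<epsilon> (word_prod A w)) \<le> \<delta>"
proof -
  obtain \<eta> where \<eta>: "\<eta> > 0" "\<And>n x. x \<noteq> 0 \<Longrightarrow> word_prob p n (\<lambda>w. \<exists>k\<le>n.
    norm (word_prod A (take k w) x) < \<eta> * norm (word_prod A (take k w)) * norm x) \<le> \<delta>/2"
    by (rule orbit_nondegenerate[of "\<delta>/2"]) (use assms in auto)
  \<comment> \<open>The factor \<eta>^2 pays for replacing \<open>norm w * norm h\<close> by
    \<open>norm (w o h)\<close>.\<close>
  define \<epsilon>' where "\<epsilon>' = \<epsilon> * \<eta>\<^sup>2"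
  have "\<epsilon>' > 0" using assms \<eta>(1) by (simp add: \<epsilon>'_def)
  then obtain b c where c: "c > 0"
    "\<forall>h\<in>GL. word_prob p b (\<lambda>w. \<exists>j\<le>b. flat \<epsilon>' (word_prod A (take j w) o\<^sub>L h)) \<ge> c"
    by (rule flat_positive_probability)
  define never where "never m h w \<longleftrightarrow> (\<forall>j\<le>m. \<not> flat \<epsilon>' (word_prod A (take j w) o\<^sub>L h))" for m h w
  have c1: "c \<le> 1" by (rule order_trans[OF bspec[OF c(2) id_in_GL] word_prob_le_1])
  have never_b: "word_prob p b (never b h) \<le> 1 - c" if "h \<in> GL" for h
  proof -
    have "word_prob p b (never b h) = word_prob p b (\<lambda>w. \<not> (\<exists>j\<le>b. flat \<epsilon>' (word_prod A (take j w) o\<^sub>L h)))"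
      by (rule word_mean_cong) (auto simp: never_def)
    then show ?thesis using bspec[OF c(2) that] by (simp only: word_prob_not)
  qed
  have never_k: "word_prob p (k * b) (never (k * b) h) \<le> (1 - c) ^ k" if "h \<in> GL" for h k
    using that
  proof (induction k arbitrary: h)
    case 0
    then show ?case by (simp add: word_prob_le_1)
  next
    case (Suc k)
    have "word_prob p (Suc k * b) (never (Suc k * b) h)
        = word_mean p b (\<lambda>u. word_prob p (k * b) (\<lambda>w. never (Suc k * b) h (u @ w)))"
      by (simp add: word_mean_append add.commute)
    also have "\<dots> \<le> word_mean p b (\<lambda>u. (1 - c) ^ k * of_bool (never b h u))"
    proof (rule word_mean_mono)
      fix u assume u: "u \<in> words p b"
      have gu: "word_prod A u o\<^sub>L h \<in> GL"
        using u Suc.prems by (auto simp: words_def intro!: compose_in_GL word_prod_GL)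
      have "never b h u \<and> never (k * b) (word_prod A u o\<^sub>L h) w" if *: "never (Suc k * b) h (u @ w)" for w
        unfolding never_def
      proof (intro conjI allI impI)
        fix j assume "j \<le> b"
        with * u have "\<not> flat \<epsilon>' (word_prod A (take j (u @ w)) o\<^sub>L h)" by (simp add: never_def)
        then show "\<not> flat \<epsilon>' (word_prod A (take j u) o\<^sub>L h)" using u \<open>j \<le> b\<close> by (simp add: words_def)
      next
        fix j assume "j \<le> k * b"
        with * have "\<not> flat \<epsilon>' (word_prod A (take (b + j) (u @ w)) o\<^sub>L h)" by (simp add: never_def)
        then show "\<not> flat \<epsilon>' (word_prod A (take j w) o\<^sub>L (word_prod A u o\<^sub>L h))"
          using u by (simp add: words_def word_prod_append blinfun_compose_assoc)
      qed
      then have "word_prob p (k * b) (\<lambda>w. never (Suc k * b) h (u @ w))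
          \<le> word_prob p (k * b) (\<lambda>w. never b h u \<and> never (k * b) (word_prod A u o\<^sub>L h) w)"
        by (intro word_prob_mono) blast
      also have "\<dots> \<le> (1 - c) ^ k * of_bool (never b h u)"
        using Suc.IH[OF gu] c1 by (cases "never b h u") auto
      finally show "word_prob p (k * b) (\<lambda>w. never (Suc k * b) h (u @ w)) \<le> (1 - c) ^ k * of_bool (never b h u)" .
    qed
    also have "\<dots> \<le> (1 - c) ^ k * (1 - c)"
      unfolding word_mean_cmult using never_b[OF Suc.prems] c1 by (intro mult_left_mono) auto
    finally show ?case by (simp add: mult.commute)
  qed
  have persist: "word_prob p n (\<lambda>w. \<not> flat \<epsilon> (word_prod A w o\<^sub>L h)) \<le> \<delta>/2"
    if h: "h \<in> GL" "flat \<epsilon>' h" for n h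
  proof -
    obtain v where v: "norm v = 1" "norm (blinfun_apply h v) = norm h" by (rule norm_attained)
    define u where "u = blinfun_apply h v"
    have "v \<noteq> 0" using v(1) by auto
    then have u: "u \<noteq> 0" using GL_nonzero[OF h(1)] by (simp add: u_def)
    have "word_prob p n (\<lambda>w. \<not> flat \<epsilon> (word_prod A w o\<^sub>L h)) \<le> word_prob p n (\<lambda>w. \<exists>k\<le>n.
        norm (word_prod A (take k w) u) < \<eta> * norm (word_prod A (take k w)) * norm u)"
    proof (rule word_prob_mono, rule ccontr)
      fix w assume w: "w \<in> words p n" and nf: "\<not> flat \<epsilon> (word_prod A w o\<^sub>L h)"
        and "\<not> (\<exists>k\<le>n. norm (word_prod A (take k w) u) < \<eta> * norm (word_prod A (take k w)) * norm u)"
      then have "\<not> norm (word_prod A (take n w) u) < \<eta> * norm (word_prod A (take n w)) * norm u" by blast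
      then have "\<eta> * norm (word_prod A w) * norm h \<le> norm (word_prod A w u)"
        using w v(2) by (simp add: words_def u_def)
      also have "\<dots> \<le> norm (word_prod A w o\<^sub>L h)"
        using norm_blinfun[of "word_prod A w o\<^sub>L h" v] v(1) by (simp add: u_def)
      finally have ng: "\<eta> * norm (word_prod A w) * norm h \<le> norm (word_prod A w o\<^sub>L h)" .
      have "flat \<epsilon> (word_prod A w o\<^sub>L h)" unfolding flat_def
      proof (intro allI)
        fix x y
        have "area (blinfun_apply (word_prod A w o\<^sub>L h) x) (blinfun_apply (word_prod A w o\<^sub>L h) y)
            \<le> (norm (word_prod A w))\<^sup>2 * area (blinfun_apply h x) (blinfun_apply h y)"
          using area_image_le[of "word_prod A w" "blinfun_apply h x" "blinfun_apply h y"] by simp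
        also have "\<dots> \<le> (norm (word_prod A w))\<^sup>2 * (\<epsilon>' * (norm h)\<^sup>2 * area x y)"
          using h(2) unfolding flat_def by (intro mult_left_mono) auto
        also have "\<dots> = \<epsilon> * (\<eta> * norm (word_prod A w) * norm h)\<^sup>2 * area x y"
          by (simp add: \<epsilon>'_def power_mult_distrib mult_ac)
        also have "\<dots> \<le> \<epsilon> * (norm (word_prod A w o\<^sub>L h))\<^sup>2 * area x y"
          using ng \<eta>(1) assms(1) by (intro mult_right_mono mult_left_mono power_mono) (auto simp: area_nonneg)
        finally show "area (blinfun_apply (word_prod A w o\<^sub>L h) x) (blinfun_apply (word_prod A w o\<^sub>L h) y)
            \<le> \<epsilon> * (norm (word_prod A w o\<^sub>L h))\<^sup>2 * area x y" .
      qed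
      with nf show False by simp
    qed
    also have "\<dots> \<le> \<delta>/2" by (rule \<eta>(2)[OF u])
    finally show ?thesis .
  qed
  \<comment> \<open>Decomposition at the first \<epsilon>'-flat time: from there
    \<open>persist\<close> bounds the failure by \<delta>/2, and \<open>never\<close> is the event
    that no such time occurs up to j.\<close>
  have main: "word_prob p n (\<lambda>w. \<not> flat \<epsilon> (word_prod A w o\<^sub>L h)) \<le> word_prob p j (never j h) + \<delta>/2"
    if "h \<in> GL" "j \<le> n" for n h j
    using that
  proof (induction j arbitrary: n h)
    case (0 n h)
    show ?case
    proof (cases "flat \<epsilon>' h")
      case True
      then show ?thesis using persist[OF 0(1) True, of n] by (simp add: never_def)
    next
      case False
      then show ?thesis
        using word_prob_le_1[of n "\<lambda>w. \<not> flat \<epsilon> (word_prod A w o\<^sub>L h)"] assms by (simp add: never_def)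
    qed
  next
    case (Suc j n h)
    show ?case
    proof (cases "flat \<epsilon>' h")
      case True
      then show ?thesis using persist[OF Suc.prems(1) True, of n] word_prob_nonneg[of "Suc j" "never (Suc j) h"]
        by linarith
    next
      case False
      obtain n' where n': "n = Suc n'" "j \<le> n'" using Suc.prems by (cases n) auto
      have "word_prob p n (\<lambda>w. \<not> flat \<epsilon> (word_prod A w o\<^sub>L h))
          = (\<Sum>l\<in>set_pmf p. pmf p l * word_prob p n' (\<lambda>w. \<not> flat \<epsilon> (word_prod A w o\<^sub>L (A l o\<^sub>L h))))"
        by (simp add: n' blinfun_compose_assoc)
      also have "\<dots> \<le> (\<Sum>l\<in>set_pmf p. pmf p l * (\<delta>/2 + 1 * word_prob p j (never j (A l o\<^sub>L h))))"
        using Suc.IH n'(2) Suc.prems(1)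
        by (intro letter_sum_mono) (auto intro: compose_in_GL letters_GL simp: add.commute)
      also have "\<dots> = \<delta>/2 + 1 * (\<Sum>l\<in>set_pmf p. pmf p l * word_prob p j (never j (A l o\<^sub>L h)))"
        by (rule letter_sum_affine)
      also have "(\<Sum>l\<in>set_pmf p. pmf p l * word_prob p j (never j (A l o\<^sub>L h)))
          \<le> word_prob p (Suc j) (never (Suc j) h)"
        unfolding word_mean.simps
      proof (intro letter_sum_mono word_prob_mono)
        fix l w assume nv: "never j (A l o\<^sub>L h) w"
        show "never (Suc j) h (l # w)" unfolding never_def
        proof (intro allI impI)
          fix i assume "i \<le> Suc j"
          then show "\<not> flat \<epsilon>' (word_prod A (take i (l # w)) o\<^sub>L h)"
            using nv False by (cases i) (auto simp: never_def blinfun_compose_assoc)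
        qed
      qed
      finally show ?thesis by simp
    qed
  qed
  have "(\<lambda>k. (1 - c) ^ k) \<longlonglongrightarrow> 0" using c c1 by (intro LIMSEQ_power_zero) auto
  then have "\<forall>\<^sub>F k in sequentially. (1 - c) ^ k < \<delta>/2" using assms(2) by (intro order_tendstoD(2)) auto
  then obtain k where k: "(1 - c) ^ k < \<delta>/2" by (auto simp: eventually_sequentially)
  show ?thesis
  proof (rule that[of "k * b"])
    fix n assume "n \<ge> k * b"
    from main[OF id_in_GL this] never_k[OF id_in_GL, of k] k
    show "word_prob p n (\<lambda>w. \<not> flat \<epsilon> (word_prod A w)) \<le> \<delta>" by simp
  qed
qed

end

section \<open>The sine of the angle between two orbits: moments and contraction\<close>

definition angle_sine :: "'a::euclidean_space \<Rightarrow> 'a \<Rightarrow> real" where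
  "angle_sine x y = area x y / (norm x * norm y)"

lemma angle_sine_nonneg: "angle_sine x y \<ge> 0"
  by (simp add: angle_sine_def area_nonneg)

text \<open>Flatness bounds the area in the numerator, nondegeneracy at x and y bounds the norms in
  the denominator. Together with \<open>flat_1\<close> it serves as a Lipschitz bound for the action
  on lines.\<close>

lemma angle_sine_image_le:
  assumes "flat \<epsilon> g" "\<eta> > 0" "g \<in> GL" "x \<noteq> 0" "y \<noteq> 0" "\<epsilon> \<ge> 0"
    and "\<eta> * norm g * norm x \<le> norm (blinfun_apply g x)" "\<eta> * norm g * norm y \<le> norm (blinfun_apply g y)"
  shows "angle_sine (blinfun_apply g x) (blinfun_apply g y) \<le> \<epsilon> / \<eta>\<^sup>2 * angle_sine x y"
proof -
  have g: "norm g > 0" by (rule GL_norm_pos[OF assms(3)])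
  have "angle_sine (blinfun_apply g x) (blinfun_apply g y)
      \<le> (\<epsilon> * (norm g)\<^sup>2 * area x y) / (norm (blinfun_apply g x) * norm (blinfun_apply g y))"
    unfolding angle_sine_def using assms(1) by (intro divide_right_mono) (auto simp: flat_def)
  also have "\<dots> \<le> (\<epsilon> * (norm g)\<^sup>2 * area x y) / ((\<eta> * norm g * norm x) * (\<eta> * norm g * norm y))"
    using assms g GL_nonzero[OF assms(3)]
    by (intro divide_left_mono mult_mono mult_pos_pos mult_nonneg_nonneg) (auto simp: area_nonneg)
  also have "\<dots> = \<epsilon> / \<eta>\<^sup>2 * angle_sine x y"
    using g assms(2,4,5) by (simp add: angle_sine_def power2_eq_square field_simps)
  finally show ?thesis .
qed

lemma flat_1: "flat 1 g"
  unfolding flat_def using area_image_le[of g] by simp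

context proximal_walk
begin

text \<open>By \<open>orbit_nondegenerate\<close> the angle exceeds \<open>R\<close> times its initial value at some time with
  probability at most \<open>1 / 4\<close>. Stopping at the first such time, where it overshoots by at most the factor
  \<open>K ^ 4\<close>, gives a self-improving bound for the moments.\<close>

lemma angle_moment_bounded:
  obtains \<alpha> U where "\<alpha> > 0" "U \<ge> 1" "\<And>n x y. x \<noteq> 0 \<Longrightarrow> y \<noteq> 0 \<Longrightarrow>
    word_mean p n (\<lambda>w. angle_sine (word_prod A w x) (word_prod A w y) powr \<alpha>) \<le> U * angle_sine x y powr \<alpha>"
proof -
  obtain \<eta>0 where \<eta>0: "\<eta>0 > 0" "\<And>n x. x \<noteq> 0 \<Longrightarrow> word_prob p n (\<lambda>w. \<exists>k\<le>n.
    norm (word_prod A (take k w) x) < \<eta>0 * norm (word_prod A (take k w)) * norm x) \<le> 1/8"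
    by (rule orbit_nondegenerate[of "1/8"]) auto
  define \<eta> where "\<eta> = min 1 \<eta>0"
  have \<eta>: "\<eta> > 0" "\<eta> \<le> 1" "\<eta> \<le> \<eta>0" using \<eta>0(1) by (auto simp: \<eta>_def)
  define R where "R = 1 / \<eta>\<^sup>2"
  have R: "R \<ge> 1" using \<eta> power_le_one[of \<eta> 2] by (simp add: R_def)
  obtain K where K: "K \<ge> 1" "\<And>l x. l \<in> set_pmf p \<Longrightarrow> norm (A l x) \<le> K * norm x"
    "\<And>l x. l \<in> set_pmf p \<Longrightarrow> norm x \<le> K * norm (A l x)"
    by (rule letters_bounds) blast
  \<comment> \<open>Makes \<open>(R * K^4) powr \<alpha> <= 2\<close>, the price of overshooting the
    threshold once; the added 1 keeps the denominator positive.\<close>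
  define \<alpha> where "\<alpha> = ln 2 / (1 + ln (R * K^4))"
  have RK: "R * K^4 \<ge> 1" using R K(1) mult_mono[of 1 R 1 "K^4"] by (simp add: one_le_power)
  have lnRK: "ln (R * K^4) \<ge> 0" using RK by simp
  have \<alpha>: "\<alpha> > 0" using lnRK by (simp add: \<alpha>_def)
  have RK2: "(R * K^4) powr \<alpha> \<le> 2"
  proof -
    have "\<alpha> * ln (R * K^4) \<le> ln 2" using lnRK by (simp add: \<alpha>_def field_simps)
    then show ?thesis using RK by (simp add: powr_def) (metis exp_le_cancel_iff exp_ln zero_less_numeral)
  qed
  \<comment> \<open>Solves \<open>U = R powr \<alpha> + 2 * U * (1/4)\<close>: the moment below the
    threshold plus twice U on an event of probability at most 1/4.\<close>
  define U where "U = 2 * R powr \<alpha>"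
  have R\<alpha>: "R powr \<alpha> \<ge> 1" using R \<alpha> by (simp add: ge_one_powr_ge_zero)
  have U: "U \<ge> 1" using R\<alpha> by (simp add: U_def)
  let ?s = "\<lambda>x y w. angle_sine (word_prod A w x) (word_prod A w y)"
  have step: "angle_sine (A l x) (A l y) \<le> K^4 * angle_sine x y"
    if l: "l \<in> set_pmf p" and xy: "x \<noteq> 0" "y \<noteq> 0" for l x y
  proof -
    have nl: "norm (A l) > 0" by (rule GL_norm_pos[OF letters_GL[OF l]])
    have nK: "norm (A l) \<le> K" using K(1,2) l by (intro norm_blinfun_bound) auto
    have "(1 / (K * norm (A l))) * norm (A l) * norm z \<le> norm (A l z)" for z
      using K(1) K(3)[OF l, of z] nl by (simp add: field_simps)
    then have "angle_sine (A l x) (A l y) \<le> 1 / (1 / (K * norm (A l)))\<^sup>2 * angle_sine x y"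
      using K(1) nl letters_GL[OF l] xy by (intro angle_sine_image_le flat_1) auto
    also have "\<dots> = (K * norm (A l))\<^sup>2 * angle_sine x y" by (simp add: power_divide)
    also have "\<dots> \<le> (K * K)\<^sup>2 * angle_sine x y"
      using nK K(1) by (intro mult_right_mono power_mono mult_left_mono) (auto simp: angle_sine_nonneg)
    finally show ?thesis by (simp add: power2_eq_square power4_eq_xxxx mult_ac)
  qed
  have excess: "word_prob p n (\<lambda>w. \<exists>k\<le>n. ?s x y (take k w) > R * angle_sine x y) \<le> 1/4"
    if xy: "x \<noteq> 0" "y \<noteq> 0" for n x y
  proof -
    have "word_prob p n (\<lambda>w. \<exists>k\<le>n. ?s x y (take k w) > R * angle_sine x y)
      \<le> word_prob p n (\<lambda>w. (\<exists>k\<le>n. norm (word_prod A (take k w) x) < \<eta>0 * norm (word_prod A (take k w)) * norm x)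
         \<or> (\<exists>k\<le>n. norm (word_prod A (take k w) y) < \<eta>0 * norm (word_prod A (take k w)) * norm y))"
    proof (rule word_prob_mono, rule ccontr)
      fix w assume w: "w \<in> words p n" and "\<exists>k\<le>n. ?s x y (take k w) > R * angle_sine x y"
        and nd: "\<not> ((\<exists>k\<le>n. norm (word_prod A (take k w) x) < \<eta>0 * norm (word_prod A (take k w)) * norm x)
         \<or> (\<exists>k\<le>n. norm (word_prod A (take k w) y) < \<eta>0 * norm (word_prod A (take k w)) * norm y))"
      then obtain k where k: "k \<le> n" "?s x y (take k w) > R * angle_sine x y" by blast
      let ?g = "word_prod A (take k w)"
      have g: "?g \<in> GL" using w set_take_subset[of k w] by (intro word_prod_GL) (auto simp: words_def)
      have "\<eta> * norm ?g * norm z \<le> \<eta>0 * norm ?g * norm z" for z :: 'a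
        using \<eta>(3) by (intro mult_right_mono) auto
      moreover have "\<eta>0 * norm ?g * norm x \<le> norm (?g x)" "\<eta>0 * norm ?g * norm y \<le> norm (?g y)"
        using nd k(1) by (auto simp: not_less)
      ultimately have "angle_sine (?g x) (?g y) \<le> 1 / \<eta>\<^sup>2 * angle_sine x y"
        using \<eta>(1) g xy by (intro angle_sine_image_le flat_1) (auto intro: order_trans)
      with k(2) show False by (simp add: R_def)
    qed
    also have "\<dots> \<le> 1/8 + 1/8" by (intro order_trans[OF word_prob_disj] add_mono \<eta>0(2) xy)
    finally show ?thesis by simp
  qed
  have bound: "word_mean p n0 (\<lambda>w. ?s x y w powr \<alpha>) \<le> U * angle_sine x y powr \<alpha>"
    if "x \<noteq> 0" "y \<noteq> 0" for n0 x y
    using that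
  proof (induction n0 arbitrary: x y rule: less_induct)
    case (less n0 x0 y0)
    define D where "D = angle_sine x0 y0"
    have D: "D \<ge> 0" by (simp add: D_def angle_sine_nonneg)
    \<comment> \<open>The threshold \<open>R * D\<close> stays fixed while the pair moves. When a
      letter first exceeds it, fewer than n0 letters remain, so the outer induction hypothesis
      bounds the rest by U times the overshot value.\<close>
    have "word_mean p n (\<lambda>w. ?s x y w powr \<alpha>) \<le> (R * D) powr \<alpha>
        + 2 * U * D powr \<alpha> * word_prob p n (\<lambda>w. \<exists>k\<le>n. ?s x y (take k w) > R * D)"
      if "n \<le> n0" "x \<noteq> 0" "y \<noteq> 0" "angle_sine x y \<le> R * D" for n x y
      using that
    proof (induction n arbitrary: x y)
      case (0 x y)
      have "angle_sine x y powr \<alpha> \<le> (R * D) powr \<alpha>"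
        using 0 \<alpha> by (intro powr_mono2) (auto simp: angle_sine_nonneg)
      also have "\<dots> \<le> (R * D) powr \<alpha> + 2 * U * D powr \<alpha> * word_prob p 0 (\<lambda>w. \<exists>k\<le>0. ?s x y (take k w) > R * D)"
        using U word_prob_nonneg[of 0 "\<lambda>w. \<exists>k\<le>0. ?s x y (take k w) > R * D"] by simp
      finally show ?case by simp
    next
      case (Suc n x y)
      let ?P = "\<lambda>l. word_prob p n (\<lambda>w. \<exists>k\<le>Suc n. ?s x y (take k (l # w)) > R * D)"
      have "word_mean p n (\<lambda>w. ?s x y (l # w) powr \<alpha>) \<le> (R * D) powr \<alpha> + 2 * U * D powr \<alpha> * ?P l"
        if l: "l \<in> set_pmf p" for l
      proof -
        have nz: "A l x \<noteq> 0" "A l y \<noteq> 0" using GL_nonzero[OF letters_GL[OF l]] Suc.prems by auto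
        show ?thesis
        proof (cases "angle_sine (A l x) (A l y) \<le> R * D")
          case True
          have "word_prob p n (\<lambda>w. \<exists>k\<le>n. ?s (A l x) (A l y) (take k w) > R * D) \<le> ?P l"
            by (rule word_prob_mono) (metis Suc_le_mono blinfun_apply_blinfun_compose take_Suc_Cons word_prod.simps(2))
          then have "(R * D) powr \<alpha> + 2 * U * D powr \<alpha> * word_prob p n (\<lambda>w. \<exists>k\<le>n. ?s (A l x) (A l y) (take k w) > R * D)
              \<le> (R * D) powr \<alpha> + 2 * U * D powr \<alpha> * ?P l"
            using U by (intro add_left_mono mult_left_mono) auto
          with Suc.IH[OF _ nz True] Suc.prems(1) show ?thesis by simp
        next
          case False
          have P1: "?P l = 1" by (rule word_prob_True) (use False in \<open>auto intro!: exI[of _ 1]\<close>)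
          have "word_mean p n (\<lambda>w. ?s x y (l # w) powr \<alpha>) \<le> U * angle_sine (A l x) (A l y) powr \<alpha>"
            using less.IH[of n "A l x" "A l y"] nz Suc.prems(1) by simp
          also have "\<dots> \<le> U * (K^4 * (R * D)) powr \<alpha>"
          proof -
            have "angle_sine (A l x) (A l y) \<le> K^4 * angle_sine x y" by (rule step[OF l Suc.prems(2,3)])
            also have "\<dots> \<le> K^4 * (R * D)" using Suc.prems(4) by (intro mult_left_mono) auto
            finally show ?thesis using U \<alpha> by (intro mult_left_mono powr_mono2) (auto simp: angle_sine_nonneg)
          qed
          also have "(K^4 * (R * D)) powr \<alpha> = (R * K^4) powr \<alpha> * D powr \<alpha>"
            using R K(1) D by (simp add: powr_mult mult_ac)
          also have "U * \<dots> \<le> U * (2 * D powr \<alpha>)"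
            using RK2 U by (intro mult_left_mono mult_right_mono) auto
          finally have "word_mean p n (\<lambda>w. ?s x y (l # w) powr \<alpha>) \<le> 2 * U * D powr \<alpha>"
            by (simp add: mult_ac)
          moreover have "0 \<le> (R * D) powr \<alpha>" by simp
          ultimately show ?thesis unfolding P1 by linarith
        qed
      qed
      then have "word_mean p (Suc n) (\<lambda>w. ?s x y w powr \<alpha>)
          \<le> (\<Sum>l\<in>set_pmf p. pmf p l * ((R * D) powr \<alpha> + 2 * U * D powr \<alpha> * ?P l))"
        unfolding word_mean.simps by (intro letter_sum_mono)
      also have "\<dots> = (R * D) powr \<alpha> + 2 * U * D powr \<alpha> * (\<Sum>l\<in>set_pmf p. pmf p l * ?P l)"
        by (rule letter_sum_affine)
      finally show ?case by (simp only: word_mean.simps)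
    qed
    from this[of n0 x0 y0] have "word_mean p n0 (\<lambda>w. ?s x0 y0 w powr \<alpha>) \<le> (R * D) powr \<alpha>
        + 2 * U * D powr \<alpha> * word_prob p n0 (\<lambda>w. \<exists>k\<le>n0. ?s x0 y0 (take k w) > R * D)"
      using less.prems R D mult_right_mono[of 1 R D] by (simp add: D_def)
    also have "\<dots> \<le> (R * D) powr \<alpha> + 2 * U * D powr \<alpha> * (1/4)"
      using excess[OF less.prems, of n0] U by (intro add_left_mono mult_left_mono) (auto simp: D_def)
    also have "(R * D) powr \<alpha> = R powr \<alpha> * D powr \<alpha>" using R D by (simp add: powr_mult)
    finally show ?case by (simp add: U_def D_def algebra_simps)
  qed
  show ?thesis by (rule that[OF \<alpha> U bound])
qed

end

context proximal_walk
begin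

text \<open>Halving the exponent leaves room for a Cauchy-Schwarz argument. Off an event of small
  probability flatness shrinks the sine by \<theta>; on that event the bounded moment of order
  \<alpha> = 2 \<beta> controls the one of order \<beta>.\<close>

lemma angle_contraction:
  obtains \<beta> n0 where "\<beta> > 0" "n0 > 0" "\<And>x y. x \<noteq> 0 \<Longrightarrow> y \<noteq> 0 \<Longrightarrow>
    word_mean p n0 (\<lambda>w. angle_sine (word_prod A w x) (word_prod A w y) powr \<beta>) \<le> 1/2 * angle_sine x y powr \<beta>"
proof -
  obtain \<alpha> U where \<alpha>: "\<alpha> > 0" "U \<ge> 1" and mom: "\<And>n x y. x \<noteq> 0 \<Longrightarrow> y \<noteq> 0 \<Longrightarrow>
    word_mean p n (\<lambda>w. angle_sine (word_prod A w x) (word_prod A w y) powr \<alpha>) \<le> U * angle_sine x y powr \<alpha>"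
    by (rule angle_moment_bounded) auto
  define \<beta> where "\<beta> = \<alpha> / 2"
  have \<beta>: "\<beta> > 0" "\<alpha> = \<beta> + \<beta>" using \<alpha> by (auto simp: \<beta>_def)
  \<comment> \<open>Let b be the initial sine to the power \<beta>. On the bad event
    \<open>a <= t / (2 * b) * a^2 + b / (2 * t)\<close> is used: \<open>t * U = 1/4\<close> makes
    the moment term b/8, and \<delta> = t/12 with three bad events makes the probability term b/8.
    The choice of \<theta> makes the good part b/4.\<close>
  define t where "t = 1 / (4 * U)"
  have t: "t > 0" "t * U = 1/4" using \<alpha> by (auto simp: t_def)
  define \<theta> :: real where "\<theta> = (1/4) powr (1/\<beta>)"
  have \<theta>: "\<theta> > 0" "\<theta> powr \<beta> = 1/4" using \<beta> by (auto simp: \<theta>_def powr_powr)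
  define \<delta> where "\<delta> = t / 12"
  have \<delta>: "\<delta> > 0" using t by (simp add: \<delta>_def)
  obtain \<eta> where \<eta>: "\<eta> > 0" "\<And>n x. x \<noteq> 0 \<Longrightarrow> word_prob p n (\<lambda>w. \<exists>k\<le>n.
    norm (word_prod A (take k w) x) < \<eta> * norm (word_prod A (take k w)) * norm x) \<le> \<delta>"
    by (rule orbit_nondegenerate[OF \<delta>]) auto
  have "\<theta> * \<eta>\<^sup>2 > 0" using \<theta> \<eta> by simp
  then obtain n1 where n1: "\<And>n. n \<ge> n1 \<Longrightarrow> word_prob p n (\<lambda>w. \<not> flat (\<theta> * \<eta>\<^sup>2) (word_prod A w)) \<le> \<delta>"
    using \<delta> by (rule eventually_flat) auto
  define n where "n = Suc n1"
  let ?s = "\<lambda>x y w. angle_sine (word_prod A w x) (word_prod A w y)"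
  have "word_mean p n (\<lambda>w. ?s x y w powr \<beta>) \<le> 1/2 * angle_sine x y powr \<beta>" if xy: "x \<noteq> 0" "y \<noteq> 0" for x y
  proof -
    define D where "D = angle_sine x y"
    have D: "D \<ge> 0" by (simp add: D_def angle_sine_nonneg)
    have bad: "word_prob p n (\<lambda>w. ?s x y w > \<theta> * D) \<le> 3 * \<delta>"
    proof -
      let ?X = "\<lambda>z w. \<exists>k\<le>n. norm (word_prod A (take k w) z) < \<eta> * norm (word_prod A (take k w)) * norm z"
      have "word_prob p n (\<lambda>w. ?s x y w > \<theta> * D)
          \<le> word_prob p n (\<lambda>w. \<not> flat (\<theta> * \<eta>\<^sup>2) (word_prod A w) \<or> (?X x w \<or> ?X y w))"
      proof (rule word_prob_mono, rule ccontr)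
        fix w assume w: "w \<in> words p n" and s: "?s x y w > \<theta> * D"
          and g: "\<not> (\<not> flat (\<theta> * \<eta>\<^sup>2) (word_prod A w) \<or> (?X x w \<or> ?X y w))"
        have tk: "take n w = w" using w by (simp add: words_def)
        have "\<not> norm (word_prod A (take n w) z) < \<eta> * norm (word_prod A (take n w)) * norm z"
          if "z = x \<or> z = y" for z using g that by blast
        then have "\<eta> * norm (word_prod A w) * norm z \<le> norm (word_prod A w z)" if "z = x \<or> z = y" for z
          using that unfolding tk not_less by blast
        then have "?s x y w \<le> (\<theta> * \<eta>\<^sup>2) / \<eta>\<^sup>2 * D"
          unfolding D_def using g \<eta>(1) xy \<theta>(1) w
          by (intro angle_sine_image_le word_prod_GL) (auto simp: words_def)
        then show False using s \<eta>(1) by simp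
      qed
      also have "\<dots> \<le> \<delta> + (\<delta> + \<delta>)"
        using n1[of n] by (intro order_trans[OF word_prob_disj] add_mono \<eta>(2) xy) (auto simp: n_def)
      finally show ?thesis by simp
    qed
    show ?thesis
    proof (cases "D = 0")
      case True
      have "?s x y w powr \<beta> = 0" for w
      proof -
        have "area (word_prod A w x) (word_prod A w y) \<le> (norm (word_prod A w))\<^sup>2 * area x y" by (rule area_image_le)
        moreover have "area x y = 0" using True xy by (simp add: D_def angle_sine_def)
        ultimately have "area (word_prod A w x) (word_prod A w y) = 0" using area_nonneg by (metis antisym mult_zero_right)
        then show ?thesis by (simp add: angle_sine_def)
      qed
      then show ?thesis by simp
    next
      case False
      then have D0: "D > 0" using D by simp
      define b where "b = D powr \<beta>"
      have b: "b > 0" using D0 by (simp add: b_def)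
      have "?s x y w powr \<beta> \<le> 1/4 * b + t / (2 * b) * (?s x y w powr \<alpha>) + b / (2 * t) * of_bool (?s x y w > \<theta> * D)" for w
      proof (cases "?s x y w > \<theta> * D")
        case True
        define a where "a = ?s x y w powr \<beta>"
        have "0 \<le> (t * a - b)\<^sup>2" by simp
        then have "2 * (a * (t * b)) \<le> t\<^sup>2 * a\<^sup>2 + b\<^sup>2" by (simp add: power2_eq_square algebra_simps)
        then have "a \<le> t / (2 * b) * a\<^sup>2 + b / (2 * t)"
          using t b by (simp add: field_simps power2_eq_square)
        moreover have "a\<^sup>2 = ?s x y w powr \<alpha>" by (simp only: a_def \<beta>(2) powr_add power2_eq_square)
        ultimately show ?thesis using True b by (simp add: a_def)
      next
        case False
        then have "?s x y w powr \<beta> \<le> (\<theta> * D) powr \<beta>"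
          using \<beta> by (intro powr_mono2) (auto simp: angle_sine_nonneg)
        also have "\<dots> = 1/4 * b" using \<theta> D by (simp add: powr_mult b_def)
        also have "\<dots> \<le> 1/4 * b + t / (2 * b) * (?s x y w powr \<alpha>)" using t b by simp
        finally show ?thesis using False by simp
      qed
      then have "word_mean p n (\<lambda>w. ?s x y w powr \<beta>) \<le> word_mean p n (\<lambda>w.
          1/4 * b + t / (2 * b) * (?s x y w powr \<alpha>) + b / (2 * t) * of_bool (?s x y w > \<theta> * D))"
        by (intro word_mean_mono)
      also have "\<dots> = 1/4 * b + t / (2 * b) * word_mean p n (\<lambda>w. ?s x y w powr \<alpha>)
          + b / (2 * t) * word_prob p n (\<lambda>w. ?s x y w > \<theta> * D)"
        by (simp only: word_mean_add word_mean_cmult word_mean_const)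
      also have "\<dots> \<le> 1/4 * b + t / (2 * b) * (U * (b * b)) + b / (2 * t) * (3 * \<delta>)"
      proof -
        have "word_mean p n (\<lambda>w. ?s x y w powr \<alpha>) \<le> U * (b * b)"
          using mom[OF xy, of n] by (simp only: D_def b_def \<beta>(2) powr_add)
        then show ?thesis using bad t b by (intro add_mono mult_left_mono) auto
      qed
      also have "t / (2 * b) * (U * (b * b)) = (t * U) * b / 2" using b by (simp add: field_simps)
      also have "b / (2 * t) * (3 * \<delta>) = 1/8 * b" using t by (simp add: \<delta>_def field_simps)
      finally show ?thesis using t by (simp add: b_def D_def)
    qed
  qed
  then show ?thesis using that[OF \<beta>(1), of n] by (simp add: n_def)
qed

lemma angle_contraction_iterate:
  assumes "\<And>x y. x \<noteq> 0 \<Longrightarrow> y \<noteq> 0 \<Longrightarrow>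
    word_mean p n0 (\<lambda>w. angle_sine (word_prod A w x) (word_prod A w y) powr \<beta>) \<le> 1/2 * angle_sine x y powr \<beta>"
    and "x \<noteq> 0" "y \<noteq> 0"
  shows "word_mean p (j * n0) (\<lambda>w. angle_sine (word_prod A w x) (word_prod A w y) powr \<beta>)
    \<le> (1/2) ^ j * angle_sine x y powr \<beta>"
proof (induction j)
  case (Suc j)
  have "word_mean p (Suc j * n0) (\<lambda>w. angle_sine (word_prod A w x) (word_prod A w y) powr \<beta>)
     = word_mean p (j * n0) (\<lambda>u. word_mean p n0 (\<lambda>w. angle_sine (word_prod A w (word_prod A u x)) (word_prod A w (word_prod A u y)) powr \<beta>))"
    using word_mean_append[of "j * n0" n0] by (simp add: word_prod_append add.commute)
  also have "\<dots> \<le> word_mean p (j * n0) (\<lambda>u. 1/2 * angle_sine (word_prod A u x) (word_prod A u y) powr \<beta>)"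
    using assms(2,3) by (intro word_mean_mono assms(1) GL_nonzero word_prod_GL) (auto simp: words_def)
  also have "\<dots> \<le> 1/2 * ((1/2) ^ j * angle_sine x y powr \<beta>)"
    unfolding word_mean_cmult using Suc by simp
  finally show ?case by simp
qed simp

end

section \<open>Words read off an infinite sequence\<close>

abbreviation letter_sequences :: "'l pmf \<Rightarrow> (nat \<Rightarrow> 'l) measure" where
  "letter_sequences p \<equiv> PiM (UNIV :: nat set) (\<lambda>_. measure_pmf p)"

lemma prob_space_letter_sequences: "prob_space (letter_sequences p)"
  by (intro prob_space_PiM prob_space_measure_pmf)

lemma product_prob_space_letters: "product_prob_space (\<lambda>_::nat. measure_pmf p)"
  by (simp add: product_prob_spaceI prob_space_measure_pmf)

lemma space_letter_sequences: "space (letter_sequences p) = UNIV"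
  by (simp add: space_PiM PiE_UNIV_domain)

lemma AE_letters: "AE \<omega> in letter_sequences p. \<forall>i. \<omega> i \<in> set_pmf p"
proof -
  have "AE \<omega> in letter_sequences p. \<omega> i \<in> set_pmf p" for i
    by (rule AE_PiM_component) (auto simp: prob_space_measure_pmf AE_measure_pmf)
  then show ?thesis by (simp add: AE_all_countable)
qed

context finite_letters
begin

text \<open>Restricting to \<open>words p n\<close> loses only a null set and makes the event a
  finite union of cylinders, measurable for every P.\<close>

definition word_event :: "nat \<Rightarrow> ('l list \<Rightarrow> bool) \<Rightarrow> (nat \<Rightarrow> 'l) set" where
  "word_event n P = {\<omega>. map \<omega> [0..<n] \<in> words p n \<and> P (map \<omega> [0..<n])}"

lemma word_cylinder:
  assumes "w \<in> words p n"
  shows "{\<omega>. map \<omega> [0..<n] = w} \<in> sets (letter_sequences p)"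
    and "emeasure (letter_sequences p) {\<omega>. map \<omega> [0..<n] = w} = ennreal (word_weight p w)"
proof -
  have len: "length w = n" using assms by (simp add: words_def)
  have eq: "{\<omega>. map \<omega> [0..<n] = w} = {\<omega> \<in> space (letter_sequences p). \<forall>i\<in>{..<n}. \<omega> i \<in> {w ! i}}"
    using len by (auto simp: space_letter_sequences list_eq_iff_nth_eq)
  interpret product_prob_space "\<lambda>_::nat. measure_pmf p" UNIV by (rule product_prob_space_letters)
  have "{\<omega> \<in> space (letter_sequences p). \<omega> i \<in> X} \<in> sets (letter_sequences p)" for i X
    using measurable_sets[OF measurable_component_singleton[of i UNIV "\<lambda>_. measure_pmf p"], of X]
    by (simp add: vimage_def Int_def conj_commute)
  then show "{\<omega>. map \<omega> [0..<n] = w} \<in> sets (letter_sequences p)"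
    unfolding eq by (intro sets.sets_Collect_finite_All) auto
  have "emeasure (letter_sequences p) {\<omega>. map \<omega> [0..<n] = w} = (\<Prod>i<n. emeasure (measure_pmf p) {w ! i})"
    unfolding eq by (rule emeasure_PiM_Collect) auto
  also have "\<dots> = (\<Prod>i<n. ennreal (pmf p (w ! i)))" by (simp add: emeasure_pmf_single)
  also have "\<dots> = ennreal (\<Prod>i<n. pmf p (w ! i))" by (simp add: prod_ennreal)
  also have "(\<Prod>i<n. pmf p (w ! i)) = word_weight p w"
    unfolding word_weight_def prod.list_conv_set_nth using len by (simp add: atLeast0LessThan)
  finally show "emeasure (letter_sequences p) {\<omega>. map \<omega> [0..<n] = w} = ennreal (word_weight p w)" .
qed

lemma word_event_eq: "word_event n P = (\<Union>w\<in>{w \<in> words p n. P w}. {\<omega>. map \<omega> [0..<n] = w})"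
  by (auto simp: word_event_def)

lemma word_event_sets [measurable]: "word_event n P \<in> sets (letter_sequences p)"
  unfolding word_event_eq using finite_words by (intro sets.finite_UN word_cylinder(1)) auto

lemma measure_word_event: "measure (letter_sequences p) (word_event n P) = word_prob p n P"
proof -
  have "emeasure (letter_sequences p) (word_event n P)
      = (\<Sum>w\<in>{w \<in> words p n. P w}. emeasure (letter_sequences p) {\<omega>. map \<omega> [0..<n] = w})"
    unfolding word_event_eq
  proof (rule sum_emeasure[symmetric])
    show "(\<lambda>w. {\<omega>. map \<omega> [0..<n] = w}) ` {w \<in> words p n. P w} \<subseteq> sets (letter_sequences p)"
      using word_cylinder(1) by blast
    show "disjoint_family_on (\<lambda>w. {\<omega>. map \<omega> [0..<n] = w}) {w \<in> words p n. P w}"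
      by (auto simp: disjoint_family_on_def)
    show "finite {w \<in> words p n. P w}" using finite_words by simp
  qed
  also have "\<dots> = ennreal (\<Sum>w\<in>{w \<in> words p n. P w}. word_weight p w)"
  proof -
    have "(\<Sum>w\<in>{w \<in> words p n. P w}. emeasure (letter_sequences p) {\<omega>. map \<omega> [0..<n] = w})
        = (\<Sum>w\<in>{w \<in> words p n. P w}. ennreal (word_weight p w))"
      by (rule sum.cong) (simp_all add: word_cylinder(2))
    then show ?thesis using word_weight_nonneg by simp
  qed
  also have "(\<Sum>w\<in>{w \<in> words p n. P w}. word_weight p w) = word_prob p n P"
    unfolding word_mean_eq_sum using finite_words[of n]
    by (simp add: sum.inter_filter if_distrib of_bool_def cong: if_cong)
  finally show ?thesis using word_prob_nonneg by (simp add: measure_def)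
qed

lemma AE_words: "AE \<omega> in letter_sequences p. map \<omega> [0..<n] \<in> words p n"
  using AE_letters by eventually_elim (auto simp: words_def)

text \<open>Markov's inequality at the level \<open>(3/4) ^ j\<close> leaves probabilities of order
  \<open>(2/3) ^ j\<close>, which are summable, and Borel-Cantelli applies.\<close>

lemma AE_eventually_geometric:
  assumes f: "\<And>j w. 0 \<le> f j w" and mean: "\<And>j. word_mean p (N j) (f j) \<le> (1/2) ^ j * c"
  shows "AE \<omega> in letter_sequences p. \<forall>\<^sub>F j in sequentially. f j (map \<omega> [0..<N j]) \<le> (3/4) ^ j"
proof -
  let ?E = "\<lambda>j. word_event (N j) (\<lambda>w. f j w > (3/4) ^ j)"
  interpret M: prob_space "letter_sequences p" by (rule prob_space_letter_sequences)
  have "measure (letter_sequences p) (?E j) \<le> (2/3) ^ j * c" for j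
  proof -
    have "(3/4) ^ j * word_prob p (N j) (\<lambda>w. f j w > (3/4) ^ j) \<le> word_mean p (N j) (f j)"
      unfolding word_mean_cmult[symmetric] using f by (intro word_mean_mono) auto
    also have "\<dots> \<le> (1/2) ^ j * c" by (rule mean)
    finally have "word_prob p (N j) (\<lambda>w. f j w > (3/4) ^ j) \<le> (1/2) ^ j * c / (3/4) ^ j"
      by (simp add: pos_le_divide_eq mult.commute)
    also have "\<dots> = (2/3) ^ j * c"
    proof -
      have "(1/2::real) ^ j = (2/3) ^ j * (3/4) ^ j" unfolding power_mult_distrib[symmetric] by simp
      then show ?thesis by simp
    qed
    finally show ?thesis by (simp add: measure_word_event)
  qed
  then have "summable (\<lambda>j. measure (letter_sequences p) (?E j))"
    by (intro summable_comparison_test'[OF summable_mult2[OF summable_geometric[of "2/3::real"]], of 0 _ c]) auto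
  then have "AE \<omega> in letter_sequences p. \<forall>\<^sub>F j in sequentially. \<omega> \<in> space (letter_sequences p) - ?E j"
    by (intro borel_cantelli_AE1) (auto simp: M.emeasure_eq_measure)
  moreover have "AE \<omega> in letter_sequences p. \<forall>j. map \<omega> [0..<N j] \<in> words p (N j)"
    using AE_words by (simp add: AE_all_countable)
  ultimately show ?thesis
  proof eventually_elim
    case (elim \<omega>)
    from elim(1) show ?case
      by (rule eventually_mono) (use elim(2) in \<open>auto simp: word_event_def not_less\<close>)
  qed
qed

end

section \<open>Simplicity of the top exponent\<close>

text \<open>Summation of a geometric series. The exact partial sum, with the factor
  \<open>1 - q ^ k\<close>, is what makes the induction on k close.\<close>

lemma geometric_increments:
  fixes t :: "nat \<Rightarrow> real"
  assumes q: "0 < q" "q < 1" and C: "C \<ge> 0" and inc: "\<And>j. j \<ge> J \<Longrightarrow> \<bar>t (Suc j) - t j\<bar> \<le> C * q ^ j"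
  obtains \<tau> where "\<forall>j\<ge>J. \<bar>\<tau> - t j\<bar> \<le> C / (1 - q) * q ^ j"
proof -
  have fin: "\<bar>t (j + k) - t j\<bar> \<le> C / (1 - q) * q ^ j * (1 - q ^ k)" if "j \<ge> J" for j k
  proof (induction k)
    case (Suc k)
    have "\<bar>t (j + Suc k) - t j\<bar> \<le> \<bar>t (Suc (j + k)) - t (j + k)\<bar> + \<bar>t (j + k) - t j\<bar>" by simp
    also have "\<dots> \<le> C * q ^ (j + k) + C / (1 - q) * q ^ j * (1 - q ^ k)"
      using inc[of "j + k"] Suc \<open>j \<ge> J\<close> by simp
    also have "C * q ^ (j + k) = C / (1 - q) * q ^ j * (q ^ k * (1 - q))"
      using q by (simp add: power_add)
    also have "\<dots> + C / (1 - q) * q ^ j * (1 - q ^ k) = C / (1 - q) * q ^ j * (1 - q ^ Suc k)"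
    proof -
      have "q ^ k * (1 - q) + (1 - q ^ k) = 1 - q ^ Suc k" by (simp add: algebra_simps)
      then show ?thesis by (simp only: distrib_left[symmetric])
    qed
    finally show ?case .
  qed simp
  have fin': "\<bar>t (j + k) - t j\<bar> \<le> C / (1 - q) * q ^ j" if "j \<ge> J" for j k
  proof -
    have "C / (1 - q) * q ^ j * (1 - q ^ k) \<le> C / (1 - q) * q ^ j * 1"
      using q C by (intro mult_left_mono) auto
    with fin[OF that, of k] show ?thesis by simp
  qed
  have "(\<lambda>j. 2 * (C / (1 - q)) * q ^ j) \<longlonglongrightarrow> 2 * (C / (1 - q)) * 0"
    using q by (intro tendsto_intros LIMSEQ_power_zero) auto
  then have small: "\<forall>\<^sub>F j in sequentially. 2 * (C / (1 - q)) * q ^ j < e" if "e > 0" for e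
    using that by (intro order_tendstoD(2)[of _ 0]) auto
  have "Cauchy t"
  proof (rule metric_CauchyI)
    fix e :: real assume "e > 0"
    from eventually_conj[OF small[OF this] eventually_ge_at_top[of J]]
    obtain N where N: "2 * (C / (1 - q)) * q ^ N < e" "N \<ge> J" by (auto simp: eventually_sequentially)
    have "dist (t m) (t n) < e" if "m \<ge> N" "n \<ge> N" for m n
    proof -
      have "\<bar>t m - t N\<bar> \<le> C / (1 - q) * q ^ N" "\<bar>t n - t N\<bar> \<le> C / (1 - q) * q ^ N"
        using fin'[OF N(2), of "m - N"] fin'[OF N(2), of "n - N"] that by auto
      then show ?thesis using N(1) by (simp add: dist_real_def)
    qed
    then show "\<exists>M. \<forall>m\<ge>M. \<forall>n\<ge>M. dist (t m) (t n) < e" by blast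
  qed
  then obtain \<tau> where \<tau>: "t \<longlonglongrightarrow> \<tau>" using Cauchy_convergent convergent_def by blast
  have "\<bar>\<tau> - t j\<bar> \<le> C / (1 - q) * q ^ j" if "j \<ge> J" for j
  proof (rule LIMSEQ_le_const2)
    have "(\<lambda>k. t (k + j)) \<longlonglongrightarrow> \<tau>" using \<tau> by (rule LIMSEQ_ignore_initial_segment)
    then show "(\<lambda>k. \<bar>t (k + j) - t j\<bar>) \<longlonglongrightarrow> \<bar>\<tau> - t j\<bar>" by (intro tendsto_intros)
    show "\<exists>N. \<forall>k\<ge>N. \<bar>t (k + j) - t j\<bar> \<le> C / (1 - q) * q ^ j"
      using fin'[OF that] by (auto simp: add.commute)
  qed
  then show ?thesis using that by blast
qed

lemma growth_rate_bounds:
  fixes v :: "nat \<Rightarrow> 'a::real_normed_vector"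
  assumes "(\<lambda>j. ln (norm (v j)) / real j) \<longlonglongrightarrow> \<Lambda>" "\<And>j. v j \<noteq> 0" "\<kappa> > 0"
  shows "\<forall>\<^sub>F j in sequentially. exp (real j * (\<Lambda> - \<kappa>)) \<le> norm (v j) \<and> norm (v j) \<le> exp (real j * (\<Lambda> + \<kappa>))"
proof -
  have "\<forall>\<^sub>F j in sequentially. ln (norm (v j)) / real j > \<Lambda> - \<kappa>"
    "\<forall>\<^sub>F j in sequentially. ln (norm (v j)) / real j < \<Lambda> + \<kappa>"
    using assms(1,3) by (auto intro: order_tendstoD)
  with eventually_gt_at_top[of 0] show ?thesis
  proof eventually_elim
    case (elim j)
    have "real j * (\<Lambda> - \<kappa>) \<le> ln (norm (v j))" "ln (norm (v j)) \<le> real j * (\<Lambda> + \<kappa>)"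
      using elim by (simp_all add: field_simps)
    then show ?case using assms(2)[of j] by (metis exp_le_cancel_iff exp_ln zero_less_norm_iff)
  qed
qed

text \<open>The slope of one orbit along the other converges, and the combination of the two orbits
  with the limiting slope grows strictly more slowly.\<close>

lemma no_exponential_tangency:
  fixes X Y :: "nat \<Rightarrow> 'a::euclidean_space" and G :: "nat \<Rightarrow> 'a \<Rightarrow>\<^sub>L 'a"
  assumes X: "\<And>j. X (Suc j) = blinfun_apply (G j) (X j)" and Y: "\<And>j. Y (Suc j) = blinfun_apply (G j) (Y j)"
    and M: "\<And>j. norm (G j) \<le> M"
    and nz: "\<And>j. X j \<noteq> 0" "\<And>t j. Y j - t *\<^sub>R X j \<noteq> 0"
    and rX: "(\<lambda>j. ln (norm (X j)) / real j) \<longlonglongrightarrow> \<Lambda>"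
    and rY: "\<And>t. (\<lambda>j. ln (norm (Y j - t *\<^sub>R X j)) / real j) \<longlonglongrightarrow> \<Lambda>"
    and \<kappa>: "\<kappa> > 0" and sine: "\<forall>\<^sub>F j in sequentially. angle_sine (X j) (Y j) \<le> exp (- 8 * \<kappa> * real j)"
  shows False
proof -
  have nzY: "Y j \<noteq> 0" for j using nz(2)[of j 0] by simp
  \<comment> \<open>The coefficient of the projection of \<open>Y j\<close> on \<open>X j\<close>,
    so that \<open>norm (r j)\<close> is the height of the parallelogram, that is, the sine times
    \<open>norm (Y j)\<close>.\<close>
  define t where "t j = (Y j \<bullet> X j) / (norm (X j))\<^sup>2" for j
  define r where "r j = Y j - t j *\<^sub>R X j" for j
  have "M \<ge> 0" using M[of 0] norm_ge_zero order_trans by blast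
  have rY0: "(\<lambda>j. ln (norm (Y j)) / real j) \<longlonglongrightarrow> \<Lambda>" using rY[of 0] by simp
  from growth_rate_bounds[OF rX nz(1) \<kappa>] growth_rate_bounds[OF rY0 nzY \<kappa>] sine
  have "\<forall>\<^sub>F j in sequentially. exp (real j * (\<Lambda> - \<kappa>)) \<le> norm (X j) \<and> norm (X j) \<le> exp (real j * (\<Lambda> + \<kappa>))
      \<and> norm (r j) \<le> exp (real j * (\<Lambda> - 7 * \<kappa>))"
  proof eventually_elim
    case (elim j)
    have "norm (X j) * norm (r j) = area (X j) (Y j)" using area_height[OF nz(1)] by (simp add: r_def t_def)
    also have "\<dots> = angle_sine (X j) (Y j) * (norm (X j) * norm (Y j))"
      using nz(1)[of j] nzY[of j] by (simp add: angle_sine_def)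
    finally have "norm (r j) = angle_sine (X j) (Y j) * norm (Y j)" using nz(1)[of j] by simp
    also have "\<dots> \<le> exp (- 8 * \<kappa> * real j) * exp (real j * (\<Lambda> + \<kappa>))"
      using elim by (intro mult_mono) auto
    also have "\<dots> = exp (real j * (\<Lambda> - 7 * \<kappa>))" by (simp add: exp_add[symmetric] algebra_simps)
    finally show ?case using elim by simp
  qed
  then obtain J where J: "\<And>j. j \<ge> J \<Longrightarrow> exp (real j * (\<Lambda> - \<kappa>)) \<le> norm (X j)"
    "\<And>j. j \<ge> J \<Longrightarrow> norm (X j) \<le> exp (real j * (\<Lambda> + \<kappa>))"
    "\<And>j. j \<ge> J \<Longrightarrow> norm (r j) \<le> exp (real j * (\<Lambda> - 7 * \<kappa>))"
    by (auto simp: eventually_sequentially)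
  define C where "C = (M + exp (\<Lambda> - 7 * \<kappa>)) / exp (\<Lambda> - \<kappa>)"
  \<comment> \<open>The slope moves by about \<open>norm (r j) / norm (X j)\<close>, at most
    \<open>exp (j (\<Lambda> - 7 \<kappa>)) / exp (j (\<Lambda> - \<kappa>))\<close> up to a
    constant.\<close>
  define q where "q = exp (- 6 * \<kappa>)"
  have C: "C \<ge> 0" using \<open>M \<ge> 0\<close> by (simp add: C_def)
  have inc: "\<bar>t (Suc j) - t j\<bar> \<le> C * q ^ j" if j: "j \<ge> J" for j
  proof -
    \<comment> \<open>Both orbits are driven by the same \<open>G j\<close>, so
      \<open>Y (Suc j)\<close> is decomposed twice: as the image of the decomposition at time j, and
      directly.\<close>
    have "(t (Suc j) - t j) *\<^sub>R X (Suc j) = blinfun_apply (G j) (r j) - r (Suc j)"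
      by (simp add: r_def X Y blinfun.diff_right blinfun.scaleR_right algebra_simps)
    then have "\<bar>t (Suc j) - t j\<bar> * norm (X (Suc j)) = norm (blinfun_apply (G j) (r j) - r (Suc j))"
      by (metis norm_scaleR)
    also have "\<dots> \<le> norm (blinfun_apply (G j) (r j)) + norm (r (Suc j))" by (rule norm_triangle_ineq4)
    also have "norm (blinfun_apply (G j) (r j)) \<le> M * norm (r j)"
      using norm_blinfun[of "G j" "r j"] M[of j] by (meson mult_right_mono norm_ge_zero order_trans)
    also have "M * norm (r j) \<le> M * exp (real j * (\<Lambda> - 7 * \<kappa>))"
      using J(3)[OF j] \<open>M \<ge> 0\<close> by (rule mult_left_mono)
    also have "norm (r (Suc j)) \<le> exp (\<Lambda> - 7 * \<kappa>) * exp (real j * (\<Lambda> - 7 * \<kappa>))"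
      using J(3)[of "Suc j"] j by (simp add: exp_add[symmetric] algebra_simps)
    finally have *: "\<bar>t (Suc j) - t j\<bar> * norm (X (Suc j)) \<le> (M + exp (\<Lambda> - 7 * \<kappa>)) * exp (real j * (\<Lambda> - 7 * \<kappa>))"
      by (simp add: algebra_simps)
    have "\<bar>t (Suc j) - t j\<bar> * (exp (\<Lambda> - \<kappa>) * exp (real j * (\<Lambda> - \<kappa>))) \<le> \<bar>t (Suc j) - t j\<bar> * norm (X (Suc j))"
      using J(1)[of "Suc j"] j by (intro mult_left_mono) (simp_all add: exp_add[symmetric] algebra_simps)
    also note *
    also have "exp (real j * (\<Lambda> - 7 * \<kappa>)) = q ^ j * exp (real j * (\<Lambda> - \<kappa>))"
      by (simp add: q_def exp_of_nat_mult[symmetric] exp_add[symmetric] algebra_simps)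
    finally have "(\<bar>t (Suc j) - t j\<bar> * exp (\<Lambda> - \<kappa>)) * exp (real j * (\<Lambda> - \<kappa>))
        \<le> ((M + exp (\<Lambda> - 7 * \<kappa>)) * q ^ j) * exp (real j * (\<Lambda> - \<kappa>))" by (simp add: mult_ac)
    then have "\<bar>t (Suc j) - t j\<bar> * exp (\<Lambda> - \<kappa>) \<le> (M + exp (\<Lambda> - 7 * \<kappa>)) * q ^ j"
      by (rule mult_right_le_imp_le) simp
    then show ?thesis by (simp add: C_def field_simps)
  qed
  obtain \<tau> where \<tau>: "\<forall>j\<ge>J. \<bar>\<tau> - t j\<bar> \<le> C / (1 - q) * q ^ j"
    by (rule geometric_increments[of q C J t]) (use C inc \<kappa> in \<open>auto simp: q_def\<close>)
  define C2 where "C2 = 1 + C / (1 - q)"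
  \<comment> \<open>The slope error of order \<open>q ^ j\<close>, times the norm of
    \<open>X j\<close>, yields the rate \<Lambda> - 5 \<kappa>, below the rate \<Lambda> that
    \<open>rY\<close> asserts at the slope \<tau>. The factor 8 in the hypothesis leaves this
    margin.\<close>
  have upper: "norm (Y j - \<tau> *\<^sub>R X j) \<le> C2 * exp (real j * (\<Lambda> - 5 * \<kappa>))" if j: "j \<ge> J" for j
  proof -
    have "Y j - \<tau> *\<^sub>R X j = r j - (\<tau> - t j) *\<^sub>R X j" by (simp add: r_def algebra_simps)
    then have "norm (Y j - \<tau> *\<^sub>R X j) \<le> norm (r j) + \<bar>\<tau> - t j\<bar> * norm (X j)"
      by (metis norm_scaleR norm_triangle_ineq4)
    also have "\<dots> \<le> exp (real j * (\<Lambda> - 7 * \<kappa>)) + (C / (1 - q) * q ^ j) * exp (real j * (\<Lambda> + \<kappa>))"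
      using \<tau> J j by (intro add_mono mult_mono) auto
    also have "(C / (1 - q) * q ^ j) * exp (real j * (\<Lambda> + \<kappa>)) = C / (1 - q) * exp (real j * (\<Lambda> - 5 * \<kappa>))"
      by (simp add: q_def exp_of_nat_mult[symmetric] exp_add[symmetric] algebra_simps)
    also have "exp (real j * (\<Lambda> - 7 * \<kappa>)) \<le> exp (real j * (\<Lambda> - 5 * \<kappa>))" using \<kappa> by (simp add: mult_left_mono)
    finally show ?thesis by (simp add: C2_def algebra_simps)
  qed
  from growth_rate_bounds[OF rY[of \<tau>] nz(2) \<kappa>] eventually_ge_at_top[of J]
  have "\<forall>\<^sub>F j in sequentially. exp (4 * \<kappa> * real j) \<le> C2"
  proof eventually_elim
    case (elim j)
    have "exp (4 * \<kappa> * real j) * exp (real j * (\<Lambda> - 5 * \<kappa>)) = exp (real j * (\<Lambda> - \<kappa>))"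
      by (simp add: exp_add[symmetric] algebra_simps)
    also have "\<dots> \<le> C2 * exp (real j * (\<Lambda> - 5 * \<kappa>))" using elim upper[of j] by simp
    finally show ?case by (rule mult_right_le_imp_le) simp
  qed
  moreover have "filterlim (\<lambda>j. exp (4 * \<kappa> * real j)) at_top sequentially"
    using \<kappa> by (intro filterlim_compose[OF exp_at_top]
      filterlim_tendsto_pos_mult_at_top[OF tendsto_const _ filterlim_real_sequentially]) auto
  then have "\<forall>\<^sub>F j in sequentially. exp (4 * \<kappa> * real j) > C2" by (simp add: filterlim_at_top_dense)
  ultimately have "\<forall>\<^sub>F j::nat in sequentially. False" by eventually_elim simp
  then show False by simp
qed

lemma (in gl_walk) norm_word_prod_le:
  assumes "\<And>l. l \<in> set_pmf p \<Longrightarrow> norm (A l) \<le> K" "K \<ge> 1" "set w \<subseteq> set_pmf p"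
  shows "norm (word_prod A w) \<le> K ^ length w"
  using assms(3)
proof (induction w)
  case (Cons l w)
  have "norm (word_prod A (l # w)) \<le> norm (word_prod A w) * norm (A l)" by (simp add: norm_blinfun_compose)
  also have "\<dots> \<le> K ^ length w * K" using Cons assms(1,2) by (intro mult_mono) auto
  finally show ?case by (simp add: mult.commute)
qed (simp add: norm_blinfun_id_le)

lemma (in proximal_walk) top_multiplicity_one:
  assumes spec: "lyapunov_spectrum p A s lam d"
  shows "d 0 = 1"
proof (rule ccontr)
  assume "d 0 \<noteq> 1"
  then have d0: "d 0 \<ge> 2" using spec unfolding lyapunov_spectrum_def by (metis One_nat_def Suc_lessI bot_nat_0.extremum less_2_cases_iff not_less)
  obtain \<beta> n0 where \<beta>: "\<beta> > 0" "n0 > 0" and contr: "\<And>x y. x \<noteq> 0 \<Longrightarrow> y \<noteq> 0 \<Longrightarrow>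
    word_mean p n0 (\<lambda>w. angle_sine (word_prod A w x) (word_prod A w y) powr \<beta>) \<le> 1/2 * angle_sine x y powr \<beta>"
    by (rule angle_contraction) auto
  \<comment> \<open>Chosen so that \<open>(3/4) ^ j\<close>, the almost sure bound for the sine to
    the power \<beta>, becomes \<open>exp (- 8 * \<kappa> * j)\<close> for the sine itself.\<close>
  define \<kappa> where "\<kappa> = - ln (3/4) / (8 * \<beta>)"
  have \<kappa>: "\<kappa> > 0" using \<beta> by (simp add: \<kappa>_def divide_neg_pos)
  let ?s = "\<lambda>b b' w. angle_sine (word_prod A w b) (word_prod A w b')"
  have AEpair: "AE \<omega> in letter_sequences p. \<forall>\<^sub>F j in sequentially.
      ?s b b' (map \<omega> [0..<j * n0]) powr \<beta> \<le> (3/4) ^ j" if "b \<noteq> 0" "b' \<noteq> 0" for b b'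
    using that by (intro AE_eventually_geometric[where c = "angle_sine b b' powr \<beta>"]
        angle_contraction_iterate contr) auto
  \<comment> \<open>The filtration depends on \<omega>, so the null sets must be fixed before a pair
    is chosen. Only the finitely many pairs of basis vectors are treated, and a suitable pair is
    later picked among them.\<close>
  have "AE \<omega> in letter_sequences p. \<forall>x\<in>Basis \<times> Basis. \<forall>\<^sub>F j in sequentially.
      ?s (fst x) (snd x) (map \<omega> [0..<j * n0]) powr \<beta> \<le> (3/4) ^ j"
    by (rule AE_finite_allI) (auto intro!: AEpair)
  moreover have "AE \<omega> in letter_sequences p.
        \<exists>F :: nat \<Rightarrow> 'a set.
          (\<forall>i\<le>Suc s. subspace (F i)) \<and> F 0 = UNIV \<and> F (Suc s) = {0} \<and>
          (\<forall>i\<le>s. F (Suc i) \<subseteq> F i \<and> dim (F i) = dim (F (Suc i)) + d i \<and>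
             (\<forall>v \<in> F i - F (Suc i).
                (\<lambda>n. ln (norm (random_product A \<omega> n v)) / real n) \<longlonglongrightarrow> lam i))"
    using spec by (simp add: lyapunov_spectrum_def)
  moreover note AE_letters[of p]
  ultimately have "AE \<omega> in letter_sequences p. False"
  proof eventually_elim
    case (elim \<omega>)
    obtain F :: "nat \<Rightarrow> 'a set" where F: "\<forall>i\<le>Suc s. subspace (F i)" "F 0 = UNIV"
      "\<forall>i\<le>s. F (Suc i) \<subseteq> F i \<and> dim (F i) = dim (F (Suc i)) + d i \<and>
             (\<forall>v \<in> F i - F (Suc i).
                (\<lambda>n. ln (norm (random_product A \<omega> n v)) / real n) \<longlonglongrightarrow> lam i)"
      using elim(2) by blast
    have subF: "subspace (F 1)" using F(1) by simp
    have dimF: "DIM('a) = dim (F 1) + d 0" using F(2) spec[THEN lyapunov_spectrum_def[THEN iffD1]] F(3)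
      by (metis One_nat_def dim_UNIV le0)
    have rate: "(\<lambda>n. ln (norm (random_product A \<omega> n v)) / real n) \<longlonglongrightarrow> lam 0" if "v \<notin> F 1" for v
      using F(2,3) that by auto
    have span_big: "\<exists>b\<in>Basis. b \<notin> W" if W: "subspace W" "dim W < DIM('a)" for W :: "'a set"
    proof (rule ccontr)
      assume "\<not> ?thesis"
      then have "span Basis \<subseteq> W" using W(1) by (intro span_minimal) auto
      then have "W = UNIV" by auto
      then show False using W(2) by simp
    qed
    obtain b where b: "b \<in> Basis" "b \<notin> F 1" using span_big[OF subF] dimF d0 by auto
    \<comment> \<open>\<open>d 0 >= 2\<close> leaves room for a b' independent of b modulo
      \<open>F 1\<close>, so that every combination \<open>b' - t b\<close> grows at the top
      rate.\<close>
    have "dim (span (insert b (F 1))) < DIM('a)" using dimF d0 by (simp add: dim_insert)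
    then obtain b' where b': "b' \<in> Basis" "b' \<notin> span (insert b (F 1))" using span_big[OF subspace_span] by blast
    have indep: "b' - t *\<^sub>R b \<notin> F 1" for t
    proof
      assume "b' - t *\<^sub>R b \<in> F 1"
      then have "b' - t *\<^sub>R b + t *\<^sub>R b \<in> span (insert b (F 1))"
        by (intro span_add span_scale span_base) auto
      with b' show False by simp
    qed
    define g where "g j = word_prod A (map \<omega> [0..<j * n0])" for j
    define G where "G j = word_prod A (map \<omega> [j * n0..<Suc j * n0])" for j
    have gG: "g (Suc j) = G j o\<^sub>L g j" for j
    proof -
      have "[0..<Suc j * n0] = [0..<j * n0] @ [j * n0..<Suc j * n0]"
        using upt_add_eq_append[of 0 "j * n0" n0] by (simp add: add.commute)
      then show ?thesis by (simp only: g_def G_def map_append word_prod_append)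
    qed
    obtain K where K: "K \<ge> 1" "\<And>l x. l \<in> set_pmf p \<Longrightarrow> norm (A l x) \<le> K * norm x"
      "\<And>l x. l \<in> set_pmf p \<Longrightarrow> norm x \<le> K * norm (A l x)"
      by (rule letters_bounds) blast
    have GM: "norm (G j) \<le> K ^ n0" for j
    proof -
      have "norm (G j) \<le> K ^ length (map \<omega> [j * n0..<Suc j * n0])" unfolding G_def
        using K elim(3) by (intro norm_word_prod_le) (auto intro!: norm_blinfun_bound)
      then show ?thesis by simp
    qed
    have gGL: "g j \<in> GL" for j unfolding g_def using elim(3) by (intro word_prod_GL) auto
    have rate': "(\<lambda>j. ln (norm (blinfun_apply (g j) v)) / real j) \<longlonglongrightarrow> lam 0 * real n0" if "v \<notin> F 1" for v
    proof -
      have "strict_mono (\<lambda>j. j * n0)" using \<beta>(2) by (simp add: strict_mono_def)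
      from LIMSEQ_subseq_LIMSEQ[OF rate[OF that] this]
      have "(\<lambda>j. ln (norm (blinfun_apply (g j) v)) / real (j * n0) * real n0) \<longlonglongrightarrow> lam 0 * real n0"
        by (intro tendsto_mult tendsto_const) (simp add: o_def g_def random_product_eq_word_prod)
      then show ?thesis using \<beta>(2) by simp
    qed
    have zero: "0 \<in> F 1" using subF by (rule subspace_0)
    show False
    proof (rule no_exponential_tangency[of "\<lambda>j. blinfun_apply (g j) b" G "\<lambda>j. blinfun_apply (g j) b'" "K ^ n0" "lam 0 * real n0" \<kappa>])
      show "blinfun_apply (g (Suc j)) b = blinfun_apply (G j) (blinfun_apply (g j) b)" for j by (simp add: gG)
      show "blinfun_apply (g (Suc j)) b' = blinfun_apply (G j) (blinfun_apply (g j) b')" for j by (simp add: gG)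
      show "norm (G j) \<le> K ^ n0" for j by (rule GM)
      show "blinfun_apply (g j) b \<noteq> 0" for j using GL_nonzero[OF gGL] b(1) nonzero_Basis by blast
      have lin: "blinfun_apply (g j) b' - t *\<^sub>R blinfun_apply (g j) b = blinfun_apply (g j) (b' - t *\<^sub>R b)" for t j
        by (simp add: blinfun.diff_right blinfun.scaleR_right)
      show "blinfun_apply (g j) b' - t *\<^sub>R blinfun_apply (g j) b \<noteq> 0" for t j
        unfolding lin using indep[of t] zero by (intro GL_nonzero[OF gGL]) auto
      show "(\<lambda>j. ln (norm (blinfun_apply (g j) b)) / real j) \<longlonglongrightarrow> lam 0 * real n0" by (rule rate'[OF b(2)])
      show "(\<lambda>j. ln (norm (blinfun_apply (g j) b' - t *\<^sub>R blinfun_apply (g j) b)) / real j) \<longlonglongrightarrow> lam 0 * real n0" for t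
        unfolding lin by (rule rate'[OF indep])
      show "\<kappa> > 0" by (rule \<kappa>)
      have "\<forall>\<^sub>F j in sequentially. angle_sine (blinfun_apply (g j) b) (blinfun_apply (g j) b') powr \<beta> \<le> (3/4) ^ j"
        using elim(1) b(1) b'(1) by (auto simp: g_def)
      then show "\<forall>\<^sub>F j in sequentially. angle_sine (blinfun_apply (g j) b) (blinfun_apply (g j) b') \<le> exp (- 8 * \<kappa> * real j)"
      proof eventually_elim
        case (elim j)
        let ?a = "angle_sine (blinfun_apply (g j) b) (blinfun_apply (g j) b')"
        have "?a = (?a powr \<beta>) powr (1/\<beta>)" using \<beta>(1) by (simp add: powr_powr angle_sine_nonneg)
        also have "\<dots> \<le> ((3/4) ^ j) powr (1/\<beta>)" using elim \<beta>(1) by (intro powr_mono2) auto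
        also have "\<dots> = exp (real j * ln (3/4) / \<beta>)" by (simp add: powr_def ln_realpow)
        also have "real j * ln (3/4) / \<beta> = - 8 * \<kappa> * real j" using \<beta>(1) by (simp add: \<kappa>_def)
        finally show ?case .
      qed
    qed
  qed
  then show False using prob_space.AE_False[OF prob_space_letter_sequences] by blast
qed

section \<open>The projective space as a measurable metric space\<close>

lemma rep_projective_nonzero: "rep_projective x \<noteq> 0"
  using Quotient_rep_reflp[OF Quotient_projective, of x] by (simp add: proj_rel_def)

lemma abs_rep_projective: "abs_projective (rep_projective x) = x"
  by (rule Quotient_abs_rep[OF Quotient_projective])

lemma proj_rel_refl: "x \<noteq> 0 \<Longrightarrow> proj_rel x x"
  unfolding proj_rel_def by (metis scaleR_one)

lemma angle_sine_scaleR: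
  "s \<noteq> 0 \<Longrightarrow> t \<noteq> 0 \<Longrightarrow> angle_sine (s *\<^sub>R x) (t *\<^sub>R y) = angle_sine x y"
  by (simp add: angle_sine_def area_scaleR)

lemma dist_abs_projective:
  assumes "x \<noteq> 0" "y \<noteq> 0"
  shows "dist (abs_projective x) (abs_projective y) = angle_sine x y"
proof -
  have "dist (abs_projective x) (abs_projective y) = area (sgn x) (sgn y)"
    using assms by (simp add: dist_projective.abs_eq proj_rel_refl area_def norm_sgn)
  also have "\<dots> = angle_sine x y"
    using assms by (simp add: sgn_div_norm area_scaleR angle_sine_def divide_inverse mult_ac)
  finally show ?thesis .
qed

lemma dist_projective_rep: "dist x y = angle_sine (rep_projective x) (rep_projective y)"
  using dist_abs_projective[OF rep_projective_nonzero[of x] rep_projective_nonzero[of y]]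
  by (simp add: abs_rep_projective)

lemma gl_act_abs: "g \<in> GL \<Longrightarrow> x \<noteq> 0 \<Longrightarrow> gl_act g (abs_projective x) = abs_projective (blinfun_apply g x)"
  by (simp add: gl_act.abs_eq proj_rel_refl)

lemma gl_act_rep: "g \<in> GL \<Longrightarrow> gl_act g x = abs_projective (blinfun_apply g (rep_projective x))"
  using gl_act_abs[of g "rep_projective x"] by (simp add: abs_rep_projective rep_projective_nonzero)

lemma gl_act_compose: "g \<in> GL \<Longrightarrow> h \<in> GL \<Longrightarrow> gl_act (g o\<^sub>L h) x = gl_act g (gl_act h x)"
  by (simp add: gl_act_rep[of "g o\<^sub>L h"] gl_act_rep[of h] compose_in_GL gl_act_abs GL_nonzero rep_projective_nonzero)

lemma gl_act_id: "gl_act id_blinfun x = x"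
  by (simp add: gl_act_rep id_in_GL abs_rep_projective)

lemma dist_gl_act:
  "g \<in> GL \<Longrightarrow> dist (gl_act g x) (gl_act g y)
    = angle_sine (blinfun_apply g (rep_projective x)) (blinfun_apply g (rep_projective y))"
  by (simp add: gl_act_rep dist_abs_projective GL_nonzero rep_projective_nonzero)

lemma rep_abs_projective:
  assumes "v \<noteq> 0"
  obtains t where "t \<noteq> 0" "rep_projective (abs_projective v) = t *\<^sub>R v"
proof -
  have "proj_rel v (rep_projective (abs_projective v))"
    using Quotient_rel[OF Quotient_projective, of v "rep_projective (abs_projective v)"] assms
    by (simp add: proj_rel_refl abs_rep_projective rep_projective_nonzero)
  then show ?thesis using that rep_projective_nonzero[of "abs_projective v"]
    by (metis proj_rel_def scale_zero_left)
qed

lemma continuous_gl_act: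
  assumes g: "g \<in> GL"
  shows "continuous_on UNIV (gl_act g)"
proof -
  obtain c where c: "c > 0" "\<And>x. c * norm x \<le> norm (blinfun_apply g x)" using GL_lower_bound[OF g] by metis
  define \<eta> where "\<eta> = c / norm g"
  have ng: "norm g > 0" by (rule GL_norm_pos[OF g])
  have "dist (gl_act g x) (gl_act g y) \<le> 1 / \<eta>\<^sup>2 * dist x y" for x y
    unfolding dist_gl_act[OF g] dist_projective_rep[of x y] using c ng g
    by (intro angle_sine_image_le flat_1) (auto simp: \<eta>_def rep_projective_nonzero)
  then have "(1 / \<eta>\<^sup>2)-lipschitz_on UNIV (gl_act g)" by (intro lipschitz_onI) auto
  then show ?thesis by (rule lipschitz_on_continuous_on)
qed

lemma measurable_gl_act [measurable]: "g \<in> GL \<Longrightarrow> gl_act g \<in> borel \<rightarrow>\<^sub>M borel"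
  by (intro borel_measurable_continuous_onI continuous_gl_act)

text \<open>Even functions of the unit vector descend to lines. The chosen representatives need not
  vary continuously, so signs are switched to make the product s with the limit vector nonnegative.
  Then \<open>2 - 2 s <= 2 (1 - s^2)\<close> bounds the distance of unit vectors by that of
  lines.\<close>

lemma continuous_on_projective:
  fixes h :: "'a::euclidean_space \<Rightarrow> real"
  assumes h: "continuous_on UNIV h" "\<And>u. h (- u) = h u"
  shows "continuous_on UNIV (\<lambda>x. h (sgn (rep_projective x)))"
proof (rule continuous_on_sequentiallyI)
  fix X :: "nat \<Rightarrow> 'a projective" and x assume lim: "X \<longlonglongrightarrow> x"
  define u where "u = sgn (rep_projective x)"
  define v where "v n = sgn (rep_projective (X n))" for n
  define v' where "v' n = (if v n \<bullet> u \<ge> 0 then v n else - v n)" for n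
  have nu: "norm u = 1" "norm (v n) = 1" for n by (auto simp: u_def v_def norm_sgn rep_projective_nonzero)
  have "norm (v' n - u) \<le> sqrt 2 * dist (X n) x" for n
  proof -
    have n1: "norm (v' n) = 1" and pos: "v' n \<bullet> u \<ge> 0" using nu by (auto simp: v'_def)
    have "dist (X n) x = angle_sine (v n) u"
      unfolding dist_projective_rep v_def u_def sgn_div_norm
      by (rule angle_sine_scaleR[symmetric]) (auto simp: rep_projective_nonzero)
    also have "\<dots> = angle_sine (v' n) u"
      using angle_sine_scaleR[of "-1" 1 "v n" u] by (simp add: v'_def)
    finally have d: "(dist (X n) x)\<^sup>2 = 1 - (v' n \<bullet> u)\<^sup>2"
      using n1 nu by (simp add: angle_sine_def area_power2)
    have "v' n \<bullet> u \<le> 1" by (metis mult_1 n1 norm_cauchy_schwarz nu(1))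
    then have "(v' n \<bullet> u)\<^sup>2 \<le> v' n \<bullet> u" using pos by (simp add: power2_eq_square mult_left_le)
    moreover have "(norm (v' n - u))\<^sup>2 = 2 - 2 * (v' n \<bullet> u)"
    proof -
      have "v' n \<bullet> v' n = 1" "u \<bullet> u = 1" using n1 nu(1) unfolding norm_eq_1 by auto
      then show ?thesis by (simp add: power2_norm_eq_inner inner_diff_left inner_diff_right inner_commute)
    qed
    ultimately have "(norm (v' n - u))\<^sup>2 \<le> (sqrt 2 * dist (X n) x)\<^sup>2" using d by (simp add: power_mult_distrib)
    then show ?thesis by (rule power2_le_imp_le) simp
  qed
  moreover have "(\<lambda>n. sqrt 2 * dist (X n) x) \<longlonglongrightarrow> 0"
    by (rule tendsto_mult_right_zero[OF tendsto_dist_iff[THEN iffD1, OF lim]])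
  ultimately have "(\<lambda>n. v' n - u) \<longlonglongrightarrow> 0"
    by (intro Lim_null_comparison[where f = "\<lambda>n. v' n - u" and g = "\<lambda>n. sqrt 2 * dist (X n) x"]) auto
  then have "v' \<longlonglongrightarrow> u" by (simp add: LIM_zero_iff)
  then have "(\<lambda>n. h (v' n)) \<longlonglongrightarrow> h u"
    using continuous_on_tendsto_compose[OF h(1)] by simp
  moreover have "h (v' n) = h (v n)" for n using h(2) by (simp add: v'_def)
  ultimately show "(\<lambda>n. h (sgn (rep_projective (X n)))) \<longlonglongrightarrow> h (sgn (rep_projective x))"
    by (simp add: u_def v_def)
qed

lemma closed_projective_norm_ge:
  "closed {x. c * norm (rep_projective x) \<le> norm (blinfun_apply g (rep_projective x))}"
proof -
  have "continuous_on UNIV (\<lambda>x. norm (blinfun_apply g (sgn (rep_projective x))))"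
    by (rule continuous_on_projective) (auto intro!: continuous_intros simp: blinfun.minus_right)
  then have "closed {x. c \<le> norm (blinfun_apply g (sgn (rep_projective x)))}"
    by (intro closed_Collect_le continuous_on_const)
  moreover have "c \<le> norm (blinfun_apply g (sgn (rep_projective x)))
      \<longleftrightarrow> c * norm (rep_projective x) \<le> norm (blinfun_apply g (rep_projective x))" for x
    using rep_projective_nonzero[of x]
    by (simp add: sgn_div_norm blinfun.scaleR_right field_simps)
  ultimately show ?thesis by simp
qed

lemma closed_projective_subspace:
  assumes "subspace F"
  shows "closed {x. rep_projective x \<in> F}"
proof -
  have "continuous_on UNIV (\<lambda>x. infdist (sgn (rep_projective x)) F)"
  proof (rule continuous_on_projective)
    show "continuous_on UNIV (\<lambda>u. infdist u F)" by (intro continuous_intros)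
    have neg: "(\<lambda>u. - u) ` F = F"
    proof
      show "(\<lambda>u. - u) ` F \<subseteq> F" using subspace_neg[OF assms] by auto
      show "F \<subseteq> (\<lambda>u. - u) ` F"
      proof
        fix u assume "u \<in> F"
        then have "- u \<in> F" by (rule subspace_neg[OF assms])
        then show "u \<in> (\<lambda>u. - u) ` F" by (rule rev_image_eqI) simp
      qed
    qed
    have d: "dist (- u) (- v) = dist u v" for u v :: 'a by (simp add: dist_norm norm_minus_commute)
    have "infdist (- u) ((\<lambda>u. - u) ` F) = infdist u F" for u
      unfolding infdist_def image_image d by simp
    then show "infdist (- u) F = infdist u F" for u unfolding neg .
  qed
  then have "closed {x. infdist (sgn (rep_projective x)) F = 0}"
    by (intro closed_Collect_eq continuous_on_const)
  moreover have "infdist (sgn (rep_projective x)) F = 0 \<longleftrightarrow> rep_projective x \<in> F" for x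
  proof -
    have "F \<noteq> {}" using subspace_0[OF assms] by auto
    then have "infdist (sgn (rep_projective x)) F = 0 \<longleftrightarrow> sgn (rep_projective x) \<in> F"
      using closed_subspace[OF assms] by (simp add: in_closed_iff_infdist_zero)
    also have "\<dots> \<longleftrightarrow> rep_projective x \<in> F"
    proof
      assume "sgn (rep_projective x) \<in> F"
      then have "norm (rep_projective x) *\<^sub>R sgn (rep_projective x) \<in> F" by (rule subspace_scale[OF assms])
      then show "rep_projective x \<in> F" by (simp add: sgn_div_norm rep_projective_nonzero)
    qed (simp add: sgn_div_norm subspace_scale[OF assms])
    finally show ?thesis .
  qed
  ultimately show ?thesis by simp
qed

section \<open>Stationary measures\<close>

locale stationary_walk = proximal_walk p A
  for p :: "'l pmf" and A :: "'l \<Rightarrow> 'a::euclidean_space \<Rightarrow>\<^sub>L 'a" +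
  fixes \<nu> :: "'a projective measure"
  assumes furstenberg: "furstenberg_measure p A \<nu>"
begin

sublocale N: prob_space \<nu>
  using furstenberg by (simp add: furstenberg_measure_def)

lemma sets_nu [measurable_cong]: "sets \<nu> = sets borel"
  using furstenberg by (simp add: furstenberg_measure_def)

lemma space_nu: "space \<nu> = UNIV"
  using sets_eq_imp_space_eq[OF sets_nu] by simp

lemma stationary:
  assumes E: "E \<in> sets borel"
  shows "measure \<nu> E = (\<Sum>l\<in>set_pmf p. pmf p l * measure \<nu> {x. gl_act (A l) x \<in> E})"
proof -
  have "measure (distr \<nu> borel (gl_act (A l))) E = measure \<nu> {x. gl_act (A l) x \<in> E}" if "l \<in> set_pmf p" for l
  proof -
    have "gl_act (A l) \<in> \<nu> \<rightarrow>\<^sub>M borel"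
      using measurable_gl_act[OF letters_GL[OF that]] by (simp add: measurable_cong_sets[OF sets_nu refl])
    from measure_distr[OF this E] show ?thesis by (simp add: space_nu vimage_def)
  qed
  then show ?thesis using furstenberg E unfolding furstenberg_measure_def by simp
qed

lemma gl_act_vimage_sets:
  "g \<in> GL \<Longrightarrow> E \<in> sets borel \<Longrightarrow> {x. gl_act g x \<in> E} \<in> sets borel"
  using measurable_sets[OF measurable_gl_act, of g E] by (simp add: vimage_def)

text \<open>One-step stationarity is applied to the event already pulled back by w, whose letters
  act after l; summation over l then removes the first letter.\<close>

lemma stationary_words:
  assumes E: "E \<in> sets borel"
  shows "measure \<nu> E = word_mean p n (\<lambda>w. measure \<nu> {x. gl_act (word_prod A w) x \<in> E})"
proof (induction n)
  case 0
  then show ?case by (simp add: gl_act_id)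
next
  case (Suc n)
  have "word_mean p (Suc n) (\<lambda>w. measure \<nu> {x. gl_act (word_prod A w) x \<in> E})
     = (\<Sum>l\<in>set_pmf p. pmf p l * word_mean p n (\<lambda>w. measure \<nu> {x. gl_act (A l) x \<in> {y. gl_act (word_prod A w) y \<in> E}}))"
  proof -
    have "word_mean p n (\<lambda>w. measure \<nu> {x. gl_act (word_prod A (l # w)) x \<in> E})
        = word_mean p n (\<lambda>w. measure \<nu> {x. gl_act (A l) x \<in> {y. gl_act (word_prod A w) y \<in> E}})"
      if "l \<in> set_pmf p" for l
      using that by (intro word_mean_cong) (auto simp: words_def gl_act_compose word_prod_GL letters_GL)
    then show ?thesis by simp
  qed
  also have "\<dots> = word_mean p n (\<lambda>w. \<Sum>l\<in>set_pmf p. pmf p l * measure \<nu> {x. gl_act (A l) x \<in> {y. gl_act (word_prod A w) y \<in> E}})"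
    by (simp only: word_mean_sum word_mean_cmult)
  also have "\<dots> = word_mean p n (\<lambda>w. measure \<nu> {y. gl_act (word_prod A w) y \<in> E})"
    by (intro word_mean_cong stationary[symmetric] gl_act_vimage_sets E word_prod_GL) (auto simp: words_def)
  finally show ?case using Suc by simp
qed

lemma subspace_sets: "subspace F \<Longrightarrow> {x. rep_projective x \<in> F} \<in> sets borel"
  by (intro borel_closed closed_projective_subspace)

text \<open>Among subspaces of full measure let W have least dimension. An average of numbers at
  most 1 that equals 1 forces the preimage of W under each letter to have full measure too.
  Intersecting it with W and using minimality shows that W is invariant, against
  irreducibility.\<close>

lemma proper_subspace_not_full:
  assumes "subspace F" "F \<noteq> UNIV"
  shows "measure \<nu> {x. rep_projective x \<in> F} < 1"
proof (rule ccontr)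
  let ?P = "\<lambda>F. subspace F \<and> measure \<nu> {x. rep_projective x \<in> F} = 1"
  assume "\<not> measure \<nu> {x. rep_projective x \<in> F} < 1"
  then have "?P F" using N.prob_le_1[of "{x. rep_projective x \<in> F}"] assms by auto
  then obtain W where W: "?P W" "\<And>V. ?P V \<Longrightarrow> dim W \<le> dim V"
    using ex_has_least_nat[of ?P F dim] by blast
  have "dim W \<le> dim F" using W(2) \<open>?P F\<close> by blast
  then have WU: "W \<noteq> UNIV" using assms by (metis dim_UNIV dim_eq_full dim_subset_UNIV le_antisym span_eq_iff)
  have W0: "W \<noteq> {0}" using W(1) by (auto simp: rep_projective_nonzero)
  have "blinfun_apply (A l) ` W \<subseteq> W" if l: "l \<in> set_pmf p" for l
  proof -
    define V where "V = {v. blinfun_apply (A l) v \<in> W}"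
    have subV: "subspace V" using W(1) unfolding V_def subspace_def by (simp add: blinfun.bilinear_simps)
    let ?E = "\<lambda>l. {x. gl_act (A l) x \<in> {x. rep_projective x \<in> W}}"
    have "1 = (\<Sum>l\<in>set_pmf p. pmf p l * measure \<nu> (?E l))"
      using stationary[OF subspace_sets, of W] W(1) by simp
    moreover have "(\<Sum>l\<in>set_pmf p. pmf p l * (1 - measure \<nu> (?E l))) = (\<Sum>l\<in>set_pmf p. pmf p l) - (\<Sum>l\<in>set_pmf p. pmf p l * measure \<nu> (?E l))"
      by (simp add: sum_subtractf algebra_simps)
    ultimately have "(\<Sum>l\<in>set_pmf p. pmf p l * (1 - measure \<nu> (?E l))) = 0" using sum_letters by simp
    then have "pmf p l * (1 - measure \<nu> (?E l)) = 0"
      using l finite_letters N.prob_le_1 by (subst (asm) sum_nonneg_eq_0_iff) (auto intro!: mult_nonneg_nonneg)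
    then have E1: "measure \<nu> (?E l) = 1" using l by (simp add: set_pmf_iff)
    have "rep_projective (gl_act (A l) x) \<in> W \<longleftrightarrow> rep_projective x \<in> V" for x
    proof -
      have nz: "blinfun_apply (A l) (rep_projective x) \<noteq> 0"
        by (rule GL_nonzero[OF letters_GL[OF l] rep_projective_nonzero])
      obtain t where t: "t \<noteq> 0" "rep_projective (gl_act (A l) x) = t *\<^sub>R blinfun_apply (A l) (rep_projective x)"
        using rep_abs_projective[OF nz] gl_act_rep[OF letters_GL[OF l], of x] by metis
      have "t *\<^sub>R v \<in> W \<longleftrightarrow> v \<in> W" for v
      proof
        assume "t *\<^sub>R v \<in> W"
        then have "inverse t *\<^sub>R t *\<^sub>R v \<in> W" using subspace_scale[OF conjunct1[OF W(1)]] by blast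
        then show "v \<in> W" using t(1) by simp
      qed (use W(1) in \<open>auto intro: subspace_scale\<close>)
      then show ?thesis unfolding t(2) V_def by simp
    qed
    then have V1: "measure \<nu> {x. rep_projective x \<in> V} = 1" using E1 by simp
    have "AE x in \<nu>. rep_projective x \<in> V" "AE x in \<nu>. rep_projective x \<in> W"
      using N.AE_prob_1[OF V1] N.AE_prob_1[OF conjunct2[OF W(1)]] by simp_all
    then have "AE x in \<nu>. rep_projective x \<in> W \<inter> V" by eventually_elim auto
    moreover have sWV: "subspace (W \<inter> V)" using W(1) subV by (intro subspace_inter) auto
    ultimately have "measure \<nu> {x. rep_projective x \<in> W \<inter> V} = 1"
      using N.prob_Collect_eq_1[of "\<lambda>x. rep_projective x \<in> W \<inter> V"] subspace_sets[OF sWV]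
      by (simp add: space_nu sets_nu)
    then have "dim W \<le> dim (W \<inter> V)" using W(2) sWV by blast
    then have "W \<inter> V = W" using W(1) sWV by (intro subspace_dim_equal) auto
    then show ?thesis by (auto simp: V_def)
  qed
  then show False using no_invariant_subspace[of W] W(1) W0 WU by blast
qed

end

section \<open>Entropy, covers and adapted bases\<close>

context finite_letters
begin

text \<open>Chebyshev's inequality for Z, the centred sum of \<open>- ln (pmf p l)\<close> over
  independent letters, whose second moment is n times the variance v of one letter. A lower bound
  for the weights of typical words bounds their number.\<close>

lemma word_entropy_concentration:
  assumes "\<epsilon> > 0" "\<delta> > 0"
  obtains n0 where
    "\<And>n. n \<ge> n0 \<Longrightarrow> word_prob p n (\<lambda>w. word_weight p w < exp (- (real n * (shannon_entropy p + \<epsilon>)))) \<le> \<delta>"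
proof -
  define H where "H = shannon_entropy p"
  define a where "a l = - ln (pmf p l) - H" for l
  define v where "v = (\<Sum>l\<in>set_pmf p. pmf p l * (a l)\<^sup>2)"
  define Z where "Z n w = - ln (word_weight p w) - real n * H" for n w
  have a0: "(\<Sum>l\<in>set_pmf p. pmf p l * a l) = 0"
  proof -
    have "(\<Sum>l\<in>set_pmf p. pmf p l * a l) = H - (\<Sum>l\<in>set_pmf p. pmf p l * H)"
      by (simp add: a_def H_def shannon_entropy_def right_diff_distrib sum_subtractf sum_negf)
    also have "(\<Sum>l\<in>set_pmf p. pmf p l * H) = H"
      using sum_letters by (simp only: sum_distrib_right[symmetric] mult_1)
    finally show ?thesis by simp
  qed
  have ZS: "Z (Suc n) (l # w) = a l + Z n w" if "l \<in> set_pmf p" "w \<in> words p n" for n l w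
  proof -
    have "pmf p l > 0" "word_weight p w > 0" using that word_weight_pos by (auto simp: pmf_positive_iff)
    then have "ln (word_weight p (l # w)) = ln (pmf p l) + ln (word_weight p w)"
      by (simp add: word_weight_def ln_mult)
    then show ?thesis by (simp add: Z_def a_def algebra_simps)
  qed
  have Z1: "word_mean p n (Z n) = 0" for n
  proof (induction n)
    case (Suc n)
    have "word_mean p (Suc n) (Z (Suc n)) = (\<Sum>l\<in>set_pmf p. pmf p l * word_mean p n (\<lambda>w. a l + Z n w))"
      by (auto intro!: sum.cong word_mean_cong ZS)
    also have "\<dots> = 0" using Suc a0 by (simp add: word_mean_add)
    finally show ?case .
  qed (simp add: Z_def word_weight_def)
  have Z2: "word_mean p n (\<lambda>w. (Z n w)\<^sup>2) = real n * v" for n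
  proof (induction n)
    case (Suc n)
    have "word_mean p (Suc n) (\<lambda>w. (Z (Suc n) w)\<^sup>2)
        = (\<Sum>l\<in>set_pmf p. pmf p l * word_mean p n (\<lambda>w. (a l)\<^sup>2 + (2 * a l * Z n w + (Z n w)\<^sup>2)))"
      by (auto intro!: sum.cong word_mean_cong simp: ZS power2_eq_square algebra_simps)
    also have "\<dots> = (\<Sum>l\<in>set_pmf p. pmf p l * ((a l)\<^sup>2 + real n * v))"
      using Suc Z1[of n] by (simp add: word_mean_add word_mean_cmult)
    also have "\<dots> = (\<Sum>l\<in>set_pmf p. pmf p l * (real n * v + 1 * (a l)\<^sup>2))" by (simp add: add.commute)
    also have "\<dots> = real (Suc n) * v" unfolding letter_sum_affine by (simp add: v_def algebra_simps)
    finally show ?case .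
  qed (simp add: Z_def word_weight_def)
  have v0: "v \<ge> 0" unfolding v_def by (intro sum_nonneg) auto
  have bound: "word_prob p n (\<lambda>w. word_weight p w < exp (- (real n * (H + \<epsilon>)))) \<le> v / (real n * \<epsilon>\<^sup>2)" if n: "n > 0" for n
  proof -
    have "(real n * \<epsilon>)\<^sup>2 * word_prob p n (\<lambda>w. word_weight p w < exp (- (real n * (H + \<epsilon>)))) \<le> word_mean p n (\<lambda>w. (Z n w)\<^sup>2)"
      unfolding word_mean_cmult[symmetric]
    proof (rule word_mean_mono)
      fix w assume w: "w \<in> words p n"
      have "(real n * \<epsilon>)\<^sup>2 \<le> (Z n w)\<^sup>2" if "word_weight p w < exp (- (real n * (H + \<epsilon>)))"
      proof -
        have "ln (word_weight p w) < - (real n * (H + \<epsilon>))"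
          using that word_weight_pos[OF w] by (metis exp_gt_zero exp_less_cancel_iff exp_ln)
        then have "real n * \<epsilon> \<le> Z n w" by (simp add: Z_def algebra_simps)
        then show ?thesis using assms(1) by (intro power_mono) auto
      qed
      then show "(real n * \<epsilon>)\<^sup>2 * of_bool (word_weight p w < exp (- (real n * (H + \<epsilon>)))) \<le> (Z n w)\<^sup>2" by simp
    qed
    then have "(real n * \<epsilon>\<^sup>2 * word_prob p n (\<lambda>w. word_weight p w < exp (- (real n * (H + \<epsilon>))))) * real n \<le> v * real n"
      unfolding Z2 by (simp add: power_mult_distrib power2_eq_square mult_ac)
    then have "real n * \<epsilon>\<^sup>2 * word_prob p n (\<lambda>w. word_weight p w < exp (- (real n * (H + \<epsilon>)))) \<le> v"
      by (rule mult_right_le_imp_le) (use n in simp)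
    then show ?thesis using n assms(1) by (simp add: pos_le_divide_eq mult_ac)
  qed
  obtain n0 :: nat where n0: "real n0 > v / (\<delta> * \<epsilon>\<^sup>2)" using reals_Archimedean2 by blast
  show ?thesis
  proof (rule that[of "Suc n0"])
    fix n assume n: "n \<ge> Suc n0"
    then have "v / (\<delta> * \<epsilon>\<^sup>2) < real n" using n0 by linarith
    then have "v / (real n * \<epsilon>\<^sup>2) \<le> \<delta>" using n assms by (simp add: field_simps)
    with bound[of n] n show "word_prob p n (\<lambda>w. word_weight p w < exp (- (real n * (shannon_entropy p + \<epsilon>)))) \<le> \<delta>"
      by (simp add: H_def)
  qed
qed

end

text \<open>Upper semicontinuity of the measure of closed balls: slightly larger closed balls
  decrease to the given one. It makes the sets of the Egorov argument measurable.\<close>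

lemma open_measure_cball_less:
  fixes \<theta> :: "'b::metric_space measure"
  assumes "finite_measure \<theta>" "sets \<theta> = sets borel"
  shows "open {x. measure \<theta> (cball x r) < a}"
proof (rule openI)
  fix x assume "x \<in> {x. measure \<theta> (cball x r) < a}"
  then have x: "measure \<theta> (cball x r) < a" by simp
  interpret finite_measure \<theta> by fact
  have "(\<lambda>m. measure \<theta> (cball x (r + 1 / real (Suc m)))) \<longlonglongrightarrow> measure \<theta> (\<Inter>m. cball x (r + 1 / real (Suc m)))"
  proof (rule finite_Lim_measure_decseq)
    show "range (\<lambda>m. cball x (r + 1 / real (Suc m))) \<subseteq> sets \<theta>"
      unfolding assms(2) by (intro image_subsetI borel_closed closed_cball)
    show "decseq (\<lambda>m. cball x (r + 1 / real (Suc m)))"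
      by (intro decseq_SucI subset_cball) (auto simp: field_simps)
  qed
  also have "(\<Inter>m. cball x (r + 1 / real (Suc m))) = cball x r"
  proof
    show "(\<Inter>m. cball x (r + 1 / real (Suc m))) \<subseteq> cball x r"
    proof
      fix y assume y: "y \<in> (\<Inter>m. cball x (r + 1 / real (Suc m)))"
      have "dist x y \<le> r"
      proof (rule field_le_epsilon)
        fix e :: real assume "e > 0"
        then obtain m where "inverse (real (Suc m)) < e" using reals_Archimedean by blast
        moreover have "dist x y \<le> r + 1 / real (Suc m)" using y by (auto simp: mem_cball)
        ultimately show "dist x y \<le> r + e" by (simp add: inverse_eq_divide)
      qed
      then show "y \<in> cball x r" by simp
    qed
    show "cball x r \<subseteq> (\<Inter>m. cball x (r + 1 / real (Suc m)))" by (intro INT_greatest subset_cball) simp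
  qed
  finally have "\<forall>\<^sub>F m in sequentially. measure \<theta> (cball x (r + 1 / real (Suc m))) < a"
    using x by (rule order_tendstoD(2))
  then obtain m where m: "measure \<theta> (cball x (r + 1 / real (Suc m))) < a"
    by (auto simp: eventually_sequentially)
  show "\<exists>e>0. ball x e \<subseteq> {x. measure \<theta> (cball x r) < a}"
  proof (intro exI[of _ "1 / real (Suc m)"] conjI subsetI)
    fix y assume y: "y \<in> ball x (1 / real (Suc m))"
    have "cball y r \<subseteq> cball x (r + 1 / real (Suc m))"
    proof
      fix z assume "z \<in> cball y r"
      with y show "z \<in> cball x (r + 1 / real (Suc m))" using dist_triangle[of x z y] by auto
    qed
    then have "measure \<theta> (cball y r) \<le> measure \<theta> (cball x (r + 1 / real (Suc m)))"
      by (rule finite_measure_mono) (simp add: assms(2) borel_closed)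
    with m show "y \<in> {x. measure \<theta> (cball x r) < a}" by simp
  qed auto
qed

text \<open>By an Egorov argument, off a set of small measure the balls of radius \<open>R n\<close> have measure
  less than \<open>R n powr (\<alpha> - \<epsilon>)\<close> from some index on, so that covers must have many members.\<close>

lemma exact_dimensional_cover_bound:
  fixes \<theta> :: "'b::metric_space measure" and R :: "nat \<Rightarrow> real"
  assumes prob: "prob_space \<theta>" and sets: "sets \<theta> = sets borel" and dim: "exact_dimensional \<theta> \<alpha>"
    and R: "\<And>n. R n > 0" "R \<longlonglongrightarrow> 0" and c: "c > 0" and \<epsilon>: "\<epsilon> > 0"
    and cover: "\<forall>\<^sub>F n in sequentially. \<forall>G\<in>sets borel. measure \<theta> G \<ge> 1 - c \<longrightarrow>
      (\<exists>Z. finite Z \<and> Z \<subseteq> G \<and> real (card Z) \<le> N n \<and> measure \<theta> (\<Union>x\<in>Z. cball x (R n)) \<ge> c)"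
  shows "\<forall>\<^sub>F n in sequentially. c \<le> N n * R n powr (\<alpha> - \<epsilon>)"
proof -
  interpret prob_space \<theta> by fact
  define G where "G k = {x. \<forall>n\<ge>k. measure \<theta> (cball x (R n)) < R n powr (\<alpha> - \<epsilon>)}" for k
  have spc: "space \<theta> = UNIV" using sets_eq_imp_space_eq[OF sets] by simp
  have Gs: "G k \<in> sets borel" for k
  proof -
    have "G k = (\<Inter>n\<in>{k..}. {x. measure \<theta> (cball x (R n)) < R n powr (\<alpha> - \<epsilon>)})" by (auto simp: G_def)
    moreover have "\<dots> \<in> sets borel"
    proof (rule sets.countable_INT'')
      show "UNIV \<in> sets borel" by (rule borel_open[OF open_UNIV])
      show "countable {k..}" by (rule countableI_type)
      show "{x. measure \<theta> (cball x (R n)) < R n powr (\<alpha> - \<epsilon>)} \<in> sets borel" for n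
        by (rule borel_open[OF open_measure_cball_less[OF finite_measure_axioms sets]])
    qed
    ultimately show ?thesis by (simp only:)
  qed
  have "AE x in \<theta>. x \<in> (\<Union>k. G k)"
    using dim unfolding exact_dimensional_def
  proof eventually_elim
    case (elim x)
    have "\<forall>\<^sub>F r in at_right 0. ln (measure \<theta> (cball x r)) / ln r > \<alpha> - \<epsilon>"
      using order_tendstoD(1)[OF conjunct2[OF elim], of "\<alpha> - \<epsilon>"] \<epsilon> by simp
    moreover have "\<forall>\<^sub>F r in at_right (0::real). r < 1"
      using order_tendstoD(2)[OF tendsto_ident_at[of "0::real" "{0<..}"], of 1] by simp
    ultimately have "\<forall>\<^sub>F r in at_right 0. measure \<theta> (cball x r) < r powr (\<alpha> - \<epsilon>)"
      using eventually_at_right_less[of "0::real"]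
    proof eventually_elim
      case (elim r)
      have pos: "measure \<theta> (cball x r) > 0" using \<open>(\<forall>r>0. measure \<theta> (cball x r) > 0) \<and> _\<close> elim by blast
      have "ln r < 0" using elim by simp
      then have "ln (measure \<theta> (cball x r)) < (\<alpha> - \<epsilon>) * ln r"
        using elim(1) by (simp add: less_divide_eq)
      then have "measure \<theta> (cball x r) < exp ((\<alpha> - \<epsilon>) * ln r)" using pos by (metis exp_less_cancel_iff exp_ln)
      then show ?case using elim by (simp add: powr_def)
    qed
    moreover have "filterlim R (at_right 0) sequentially"
      unfolding filterlim_at
    proof
      show "\<forall>\<^sub>F n in sequentially. R n \<in> {0<..} \<and> R n \<noteq> 0"
        by (rule always_eventually) (use R(1) less_imp_neq[OF R(1)] in auto)
    qed (rule R(2))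
    ultimately have "\<forall>\<^sub>F n in sequentially. measure \<theta> (cball x (R n)) < R n powr (\<alpha> - \<epsilon>)"
      by (rule eventually_compose_filterlim)
    then show ?case by (auto simp: G_def eventually_sequentially)
  qed
  then have "prob (\<Union>k. G k) = 1" using Gs by (subst prob_eq_1) (auto simp: sets)
  moreover have "(\<lambda>k. prob (G k)) \<longlonglongrightarrow> prob (\<Union>k. G k)"
  proof (rule finite_Lim_measure_incseq)
    show "range G \<subseteq> events" using Gs sets by auto
    show "incseq G" by (intro incseq_SucI) (auto simp: G_def)
  qed
  \<comment> \<open>The index k depends on c, which is why covers with centres in every set of
    measure at least \<open>1 - c\<close> are assumed.\<close>
  ultimately have "\<forall>\<^sub>F k in sequentially. prob (G k) > 1 - c" using c by (intro order_tendstoD(1)) auto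
  then obtain k where k: "prob (G k) > 1 - c" by (auto simp: eventually_sequentially)
  from cover eventually_ge_at_top[of k] show ?thesis
  proof eventually_elim
    case (elim n)
    then obtain Z where Z: "finite Z" "Z \<subseteq> G k" "real (card Z) \<le> N n" "prob (\<Union>x\<in>Z. cball x (R n)) \<ge> c"
      using Gs[of k] k by (meson less_imp_le)
    have "c \<le> prob (\<Union>x\<in>Z. cball x (R n))" by (rule Z)
    also have "\<dots> \<le> (\<Sum>x\<in>Z. prob (cball x (R n)))"
      by (intro finite_measure_subadditive_finite Z) (auto simp: sets)
    also have "\<dots> \<le> (\<Sum>x\<in>Z. R n powr (\<alpha> - \<epsilon>))"
      using Z(2) elim by (intro sum_mono) (auto simp: G_def less_imp_le)
    also have "\<dots> = real (card Z) * R n powr (\<alpha> - \<epsilon>)" by simp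
    also have "\<dots> \<le> N n * R n powr (\<alpha> - \<epsilon>)" using Z(3) by (intro mult_right_mono) auto
    finally show ?case .
  qed
qed

text \<open>With about \<open>exp (n a)\<close> balls of radius about \<open>exp (- n b)\<close>,
  the preceding bound reads: c is at most a constant times
  \<open>exp (n (a - (\<alpha> - \<epsilon>) b))\<close>. A negative exponent would drive this to
  0.\<close>

lemma exact_dimensional_le:
  fixes \<theta> :: "'b::metric_space measure"
  assumes prob: "prob_space \<theta>" and sets: "sets \<theta> = sets borel" and dim: "exact_dimensional \<theta> \<alpha>"
    and b: "b > 0" and C: "C > 0" "C' > 0" and c: "c > 0" and \<epsilon>: "\<epsilon> > 0"
    and cover: "\<forall>\<^sub>F n in sequentially. \<forall>G\<in>sets borel. measure \<theta> G \<ge> 1 - c \<longrightarrow>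
      (\<exists>Z. finite Z \<and> Z \<subseteq> G \<and> real (card Z) \<le> C * exp (real n * a) \<and>
        measure \<theta> (\<Union>x\<in>Z. cball x (C' * exp (- (real n * b)))) \<ge> c)"
  shows "(\<alpha> - \<epsilon>) * b \<le> a"
proof (rule ccontr)
  assume "\<not> (\<alpha> - \<epsilon>) * b \<le> a"
  then have neg: "a - (\<alpha> - \<epsilon>) * b < 0" by simp
  have lim0: "(\<lambda>n. exp (real n * x)) \<longlonglongrightarrow> 0" if "x < 0" for x
  proof -
    have "(\<lambda>n. exp x ^ n) \<longlonglongrightarrow> 0" using that by (intro LIMSEQ_power_zero) auto
    then show ?thesis by (simp add: exp_of_nat_mult)
  qed
  have "(\<lambda>n. C' * exp (- (real n * b))) \<longlonglongrightarrow> 0"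
    using tendsto_mult_right_zero[OF lim0[of "- b"], of C'] b by simp
  then have "\<forall>\<^sub>F n in sequentially. c \<le> C * exp (real n * a) * (C' * exp (- (real n * b))) powr (\<alpha> - \<epsilon>)"
    using C(2) by (intro exact_dimensional_cover_bound[OF prob sets dim _ _ c \<epsilon> cover]) auto
  moreover have "C * exp (real n * a) * (C' * exp (- (real n * b))) powr (\<alpha> - \<epsilon>)
      = C * C' powr (\<alpha> - \<epsilon>) * exp (real n * (a - (\<alpha> - \<epsilon>) * b))" for n
  proof -
    have "exp (- (real n * b)) powr (\<alpha> - \<epsilon>) = exp (- (real n * b) * (\<alpha> - \<epsilon>))" by (simp add: powr_def)
    then show ?thesis using C(2) by (simp add: powr_mult exp_add[symmetric] algebra_simps)
  qed
  ultimately have "\<forall>\<^sub>F n in sequentially. c \<le> C * C' powr (\<alpha> - \<epsilon>) * exp (real n * (a - (\<alpha> - \<epsilon>) * b))" by simp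
  moreover have "(\<lambda>n. C * C' powr (\<alpha> - \<epsilon>) * exp (real n * (a - (\<alpha> - \<epsilon>) * b))) \<longlonglongrightarrow> 0"
    by (rule tendsto_mult_right_zero[OF lim0[OF neg]])
  then have "\<forall>\<^sub>F n in sequentially. C * C' powr (\<alpha> - \<epsilon>) * exp (real n * (a - (\<alpha> - \<epsilon>) * b)) < c"
    using c by (rule order_tendstoD(2))
  ultimately have "\<forall>\<^sub>F n::nat in sequentially. False" by eventually_elim simp
  then show False by simp
qed

text \<open>Built from the bottom of the flag: a basis of \<open>F (i + 1)\<close> is extended to
  one of \<open>F i\<close>, which keeps the spanning property for the smaller members.\<close>

lemma adapted_basis:
  fixes F :: "nat \<Rightarrow> 'a::euclidean_space set"
  assumes F: "\<And>i. i \<le> Suc s \<Longrightarrow> subspace (F i)" "F (Suc s) = {0}" "\<And>i. i \<le> s \<Longrightarrow> F (Suc i) \<subseteq> F i"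
  obtains B where "independent B" "B \<subseteq> F 0" "\<forall>i\<le>Suc s. span (B \<inter> F i) = F i"
proof -
  have "\<exists>B. independent B \<and> B \<subseteq> F (Suc s - k) \<and> (\<forall>i. Suc s - k \<le> i \<and> i \<le> Suc s \<longrightarrow> span (B \<inter> F i) = F i)"
    if "k \<le> Suc s" for k
    using that
  proof (induction k)
    case 0
    have "span ({} \<inter> F i) = F i" if "Suc s - 0 \<le> i \<and> i \<le> Suc s" for i
    proof -
      have "i = Suc s" using that by simp
      then show ?thesis using F(2) by simp
    qed
    then show ?case using independent_empty by blast
  next
    case (Suc k)
    then obtain B where B: "independent B" "B \<subseteq> F (Suc s - k)"
      "\<And>i. Suc s - k \<le> i \<and> i \<le> Suc s \<Longrightarrow> span (B \<inter> F i) = F i" by auto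
    define j where "j = Suc s - Suc k"
    have j: "Suc s - k = Suc j" "j \<le> s" using Suc.prems by (auto simp: j_def)
    have "B \<subseteq> F j" using B(2) F(3)[OF j(2)] j(1) by auto
    then obtain B' where B': "B \<subseteq> B'" "B' \<subseteq> F j" "independent B'" "F j \<subseteq> span B'"
      using maximal_independent_subset_extend[OF _ B(1), of "F j"] by blast
    have "span (B' \<inter> F i) = F i" if i: "j \<le> i" "i \<le> Suc s" for i
    proof
      show "span (B' \<inter> F i) \<subseteq> F i" using F(1)[OF i(2)] by (intro span_minimal) auto
      show "F i \<subseteq> span (B' \<inter> F i)"
      proof (cases "i = j")
        case True
        then show ?thesis using B'(2,4) by (simp add: Int_absorb2)
      next
        case False
        then have "F i = span (B \<inter> F i)" using B(3)[of i] i j by simp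
        also have "\<dots> \<subseteq> span (B' \<inter> F i)" using B'(1) by (intro span_mono) auto
        finally show ?thesis .
      qed
    qed
    then show ?case using B'(2,3) unfolding j_def by blast
  qed
  from this[of "Suc s"] obtain B where "independent B" "B \<subseteq> F 0" "\<forall>i\<le>Suc s. span (B \<inter> F i) = F i" by auto
  then show ?thesis by (rule that)
qed

lemma representation_bounded:
  fixes B :: "'a::euclidean_space set"
  assumes B: "independent B" "span B = UNIV"
  obtains Q where "Q > 0" "\<forall>b x. \<bar>representation B x b\<bar> \<le> Q * norm x"
proof -
  have fin: "finite B" using independent_bound[OF B(1)] by simp
  have lin: "linear (\<lambda>x. representation B x b)" for b
    using B by (intro linearI) (auto simp: representation_add representation_scale)
  then have "\<exists>Q>0. \<forall>x. norm (representation B x b) \<le> Q * norm x" for b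
    using linear_bounded_pos[OF lin] by metis
  then obtain Q where Q: "\<And>b. Q b > 0" "\<And>b x. norm (representation B x b) \<le> Q b * norm x" by metis
  show ?thesis
  proof (rule that)
    show "1 + (\<Sum>b\<in>B. Q b) > 0" using Q(1) by (intro add_pos_nonneg sum_nonneg) (auto simp: less_imp_le)
    show "\<forall>b x. \<bar>representation B x b\<bar> \<le> (1 + (\<Sum>b\<in>B. Q b)) * norm x"
    proof (intro allI)
      fix b x
      show "\<bar>representation B x b\<bar> \<le> (1 + (\<Sum>b\<in>B. Q b)) * norm x"
      proof (cases "b \<in> B")
        case True
        have "Q b \<le> (\<Sum>b\<in>B. Q b)" using True fin Q(1) by (intro member_le_sum) (auto simp: less_imp_le)
        then have "Q b * norm x \<le> (1 + (\<Sum>b\<in>B. Q b)) * norm x" by (intro mult_right_mono) auto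
        with Q(2)[of x b] show ?thesis by simp
      next
        case False
        then have "representation B x b = 0" using representation_ne_zero by blast
        then show ?thesis using Q(1) by (simp add: add_nonneg_nonneg sum_nonneg less_imp_le)
      qed
    qed
  qed
qed

text \<open>Finitely many exceptional n are absorbed in the factor Q, so that growth bounds hold at
  every n with one constant.\<close>

lemma eventually_le_imp_bounded:
  fixes f g :: "nat \<Rightarrow> real"
  assumes "\<forall>\<^sub>F n in sequentially. f n \<le> g n" "\<And>n. g n > 0"
  obtains Q where "Q > 0" "\<forall>n. f n \<le> Q * g n"
proof -
  obtain N where N: "\<And>n. n \<ge> N \<Longrightarrow> f n \<le> g n" using assms(1) by (auto simp: eventually_sequentially)
  define Q where "Q = 1 + (\<Sum>n<N. \<bar>f n\<bar> / g n)"
  have nn: "0 \<le> \<bar>f n\<bar> / g n" for n using assms(2)[of n] by simp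
  have "f n \<le> Q * g n" for n
  proof (cases "n < N")
    case True
    have "\<bar>f n\<bar> / g n \<le> Q" unfolding Q_def using member_le_sum[of n "{..<N}" "\<lambda>n. \<bar>f n\<bar> / g n"] True nn by simp
    then have "\<bar>f n\<bar> \<le> Q * g n" using assms(2)[of n] by (simp add: pos_divide_le_eq)
    then show ?thesis by simp
  next
    case False
    have "1 * g n \<le> Q * g n" unfolding Q_def using nn assms(2)[of n] by (intro mult_right_mono) (auto intro: sum_nonneg)
    then show ?thesis using N[of n] False by simp
  qed
  moreover have "Q > 0" unfolding Q_def using nn by (intro add_pos_nonneg sum_nonneg) auto
  ultimately show ?thesis using that by blast
qed

section \<open>Covering the stationary measure\<close>

lemma angle_sine_le_dist: "x \<noteq> 0 \<Longrightarrow> y \<noteq> 0 \<Longrightarrow> angle_sine x y \<le> norm (x - y) / norm x"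
  using area_le_dist[of x y] by (simp add: angle_sine_def field_simps)

text \<open>Both vectors lie in one affine chart, with leading part f. The metric on lines is
  Lipschitz in the coordinates as long as the vectors stay away from 0.\<close>

lemma angle_sine_coordinates:
  fixes e :: "'i \<Rightarrow> 'a::euclidean_space"
  assumes "finite I" "\<And>i. i \<in> I \<Longrightarrow> norm (e i) \<le> 1"
    and u: "u = f + (\<Sum>i\<in>I. \<tau> i *\<^sub>R e i)" "1/2 \<le> norm u"
    and u': "u' = f + (\<Sum>i\<in>I. \<tau>' i *\<^sub>R e i)" "1/2 \<le> norm u'"
  shows "angle_sine u u' \<le> 2 * (\<Sum>i\<in>I. \<bar>\<tau> i - \<tau>' i\<bar>)"
proof -
  have nz: "u \<noteq> 0" "u' \<noteq> 0" using u(2) u'(2) by auto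
  have "u - u' = (\<Sum>i\<in>I. (\<tau> i - \<tau>' i) *\<^sub>R e i)"
    unfolding u(1) u'(1) by (simp add: scaleR_diff_left sum_subtractf)
  also have "norm \<dots> \<le> (\<Sum>i\<in>I. \<bar>\<tau> i - \<tau>' i\<bar>)"
    using assms(2) by (intro sum_norm_le) (simp add: mult_left_le)
  finally have d: "norm (u - u') \<le> (\<Sum>i\<in>I. \<bar>\<tau> i - \<tau>' i\<bar>)" .
  have "angle_sine u u' \<le> norm (u - u') / norm u" by (rule angle_sine_le_dist[OF nz])
  also have "\<dots> \<le> norm (u - u') / (1/2)" using u(2) by (intro divide_left_mono) auto
  finally show ?thesis using d by simp
qed

lemma floor_eq_imp_close:
  fixes a b \<rho> :: real
  assumes "\<rho> > 0" "\<lfloor>a / \<rho>\<rfloor> = \<lfloor>b / \<rho>\<rfloor>"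
  shows "\<bar>a - b\<bar> \<le> \<rho>"
proof -
  have "\<bar>a / \<rho> - b / \<rho>\<bar> \<le> 1" using assms(2) by linarith
  then have "\<bar>a - b\<bar> / \<rho> \<le> 1" using assms(1) by (simp add: diff_divide_distrib[symmetric] abs_divide)
  then show ?thesis using assms(1) by simp
qed

text \<open>Each factor has \<open>2 * ceiling h + 1 <= 2 * h + 3\<close> elements, at most
  \<open>5 * h\<close> because \<open>1 <= h\<close>.\<close>

lemma card_floor_keys:
  assumes "finite I" "\<And>i. i \<in> I \<Longrightarrow> 1 \<le> h i"
  shows "finite (PiE I (\<lambda>i. {- \<lceil>h i\<rceil>..\<lceil>h i :: real\<rceil>}))"
    and "real (card (PiE I (\<lambda>i. {- \<lceil>h i\<rceil>..\<lceil>h i :: real\<rceil>}))) \<le> (\<Prod>i\<in>I. 5 * h i)"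
proof -
  show "finite (PiE I (\<lambda>i. {- \<lceil>h i\<rceil>..\<lceil>h i\<rceil>}))" using assms(1) by (intro finite_PiE) auto
  have "real (card {- \<lceil>h i\<rceil>..\<lceil>h i\<rceil>}) \<le> 5 * h i" if i: "i \<in> I" for i
  proof -
    have "\<lceil>h i\<rceil> \<ge> 1" using assms(2)[OF i] by linarith
    then have "real (card {- \<lceil>h i\<rceil>..\<lceil>h i\<rceil>}) = 2 * of_int \<lceil>h i\<rceil> + 1" by simp
    also have "\<dots> \<le> 5 * h i" using assms(2)[OF i] by linarith
    finally show ?thesis .
  qed
  then show "real (card (PiE I (\<lambda>i. {- \<lceil>h i\<rceil>..\<lceil>h i :: real\<rceil>}))) \<le> (\<Prod>i\<in>I. 5 * h i)"
    using assms(1) by (subst card_PiE) (auto intro!: prod_mono)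
qed

lemma floor_key_range:
  fixes a T \<rho> :: real
  assumes "\<bar>a\<bar> \<le> T" "\<rho> > 0"
  shows "\<lfloor>a / \<rho>\<rfloor> \<in> {- \<lceil>T / \<rho>\<rceil>..\<lceil>T / \<rho>\<rceil>}"
proof -
  have "\<bar>a / \<rho>\<bar> \<le> T / \<rho>" using assms by (simp add: abs_divide divide_right_mono)
  then show ?thesis unfolding atLeastAtMost_iff by linarith
qed

text \<open>The image of the points expanded at the top rate is a thin ellipsoid; slicing its axes of
  blocks \<open>1..m\<close> at scale \<open>\<rho>\<close> separates points up to distance of order \<open>\<rho>\<close>.\<close>

lemma ellipsoid_keys:
  fixes g :: "'a::euclidean_space \<Rightarrow>\<^sub>L 'a" and blk :: "'a \<Rightarrow> nat" and lam :: "nat \<Rightarrow> real" and t :: real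
  assumes g: "g \<in> GL" and B: "independent B" "span B = UNIV"
    and blk: "\<And>b. b \<in> B \<Longrightarrow> blk b \<le> s" "card {b \<in> B. blk b = 0} = 1"
    and lam: "\<And>i j. i \<le> j \<Longrightarrow> j \<le> s \<Longrightarrow> lam j \<le> lam i" and m: "m < s"
    and Q: "Q \<ge> 1" and t: "t \<ge> 0"
    and gb: "\<And>b. b \<in> B \<Longrightarrow> norm (blinfun_apply g b) \<le> Q * exp (t * (lam (blk b) + \<epsilon>))"
    and rep: "\<And>b x. \<bar>representation B x b\<bar> \<le> Q * norm x"
    and small: "4 * real DIM('a) * Q^3 * exp (t * (lam 1 - lam 0 + 2 * \<epsilon>)) \<le> 1"
    and X: "X = {x. exp (t * (lam 0 - \<epsilon>)) / Q * norm (rep_projective x) \<le> norm (blinfun_apply g (rep_projective x))}"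
    and \<rho>: "\<rho> = exp (t * (lam (Suc m) - lam 0 + 2 * \<epsilon>))"
  shows "\<exists>(\<kappa> :: 'a projective \<Rightarrow> 'a \<Rightarrow> int) T. \<kappa> ` X \<subseteq> T \<and> finite T \<and>
    real (card T) \<le> (10 * Q^3) ^ DIM('a) * exp (t * (\<Sum>b\<in>{b \<in> B. blk b \<in> {1..m}}. lam (blk b) - lam (Suc m))) \<and>
    (\<forall>x\<in>X. \<forall>y\<in>X. \<kappa> x = \<kappa> y \<longrightarrow> dist (gl_act g x) (gl_act g y) \<le> 8 * real DIM('a) * Q^3 * \<rho>)"
proof -
  let ?N = "real DIM('a)"
  have finB: "finite B" using independent_bound[OF B(1)] by simp
  have cardB: "card B \<le> DIM('a)" using independent_bound[OF B(1)] by simp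
  have Q3: "Q^3 \<ge> 1" using Q by (simp add: one_le_power)
  obtain b0 where b0: "{b \<in> B. blk b = 0} = {b0}" using blk(2) by (metis card_1_singletonE)
  have b0B: "b0 \<in> B" "blk b0 = 0" using b0 by auto
  define B' where "B' = B - {b0}"
  have B': "finite B'" "\<And>b. b \<in> B' \<Longrightarrow> b \<in> B \<and> 1 \<le> blk b"
  proof -
    show "finite B'" using finB by (simp add: B'_def)
    show "b \<in> B \<and> 1 \<le> blk b" if b: "b \<in> B'" for b
    proof -
      have "b \<notin> {b \<in> B. blk b = 0}" using b unfolding b0 B'_def by blast
      then show ?thesis using b by (auto simp: B'_def)
    qed
  qed
  have cardB': "real (card B') \<le> ?N" using cardB card_Diff1_le[of B b0] unfolding B'_def by linarith
  have gb0: "norm (blinfun_apply g b) > 0" if "b \<in> B" for b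
    using GL_nonzero[OF g, of b] dependent_zero[of B] B(1) that by auto
  \<comment> \<open>One factor Q bounds the coordinate of v, another the image of b, and the third
    comes from the \<open>1 / Q\<close> in the lower bound defining X. The 2 reflects that the
    leading term carries at least half of that bound.\<close>
  define T where "T b = 2 * Q^3 * exp (t * (lam (blk b) - lam 0 + 2 * \<epsilon>))" for b
  define c where "c x b = representation B (rep_projective x) b" for x b
  define \<tau> where "\<tau> x b = c x b * norm (blinfun_apply g b) / (c x b0 * norm (blinfun_apply g b0))" for x b
  define u where "u x = sgn (blinfun_apply g b0) + (\<Sum>b\<in>B'. \<tau> x b *\<^sub>R sgn (blinfun_apply g b))" for x
  have \<rho>0: "\<rho> > 0" by (simp add: \<rho>)
  have lam1: "lam (blk b) \<le> lam 1" if "b \<in> B'" for b using B'(2)[OF that] blk(1) lam by blast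
  have main: "c x b0 \<noteq> 0" "\<forall>b\<in>B'. \<bar>\<tau> x b\<bar> \<le> T b" "1/2 \<le> norm (u x)"
    "blinfun_apply g (rep_projective x) = (c x b0 * norm (blinfun_apply g b0)) *\<^sub>R u x" if x: "x \<in> X" for x
  proof -
    define v where "v = rep_projective x"
    have nv: "norm v > 0" by (simp add: v_def rep_projective_nonzero)
    have vX: "exp (t * (lam 0 - \<epsilon>)) / Q * norm v \<le> norm (blinfun_apply g v)" using x by (simp add: X v_def)
    have "v = (\<Sum>b\<in>B. c x b *\<^sub>R b)"
      using sum_representation_eq[OF B(1) _ finB subset_refl, of v] B(2) by (simp add: c_def v_def)
    then have "blinfun_apply g v = (\<Sum>b\<in>B. c x b *\<^sub>R blinfun_apply g b)"
      by (metis (no_types, lifting) blinfun.scaleR_right blinfun.sum_right sum.cong)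
    then have gv: "blinfun_apply g v = c x b0 *\<^sub>R blinfun_apply g b0 + (\<Sum>b\<in>B'. c x b *\<^sub>R blinfun_apply g b)"
      using finB b0B(1) by (simp add: B'_def sum.remove)
    have coef_le: "\<bar>c x b\<bar> * norm (blinfun_apply g b) \<le> Q^2 * norm v * exp (t * (lam (blk b) + \<epsilon>))" if "b \<in> B" for b
    proof -
      have "\<bar>c x b\<bar> * norm (blinfun_apply g b) \<le> (Q * norm v) * (Q * exp (t * (lam (blk b) + \<epsilon>)))"
        using rep[of "rep_projective x" b] gb[OF that] Q by (intro mult_mono) (auto simp: c_def v_def)
      then show ?thesis by (simp add: power2_eq_square mult_ac)
    qed
    define E where "E = exp (t * (lam 0 - \<epsilon>)) / Q * norm v"
    have E: "E > 0" using nv Q by (simp add: E_def)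
    have coef_eq: "Q^2 * norm v * exp (t * (lam (blk b) + \<epsilon>)) = E / 2 * T b" for b
    proof -
      have "exp (t * (lam (blk b) + \<epsilon>)) = exp (t * (lam 0 - \<epsilon>)) * exp (t * (lam (blk b) - lam 0 + 2 * \<epsilon>))"
        by (simp add: exp_add[symmetric] algebra_simps)
      then show ?thesis using Q by (simp add: E_def T_def power2_eq_square power3_eq_cube)
    qed
    \<comment> \<open>On X the image of v has norm at least E. With this bound the part outside b0
      has norm at most \<open>E / 4\<close>, so the term along b0 dominates.\<close>
    have sumT: "(\<Sum>b\<in>B'. T b) \<le> 1/2"
    proof -
      have "(\<Sum>b\<in>B'. T b) \<le> (\<Sum>b\<in>B'. 2 * Q^3 * exp (t * (lam 1 - lam 0 + 2 * \<epsilon>)))"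
        unfolding T_def using lam1 t Q by (intro sum_mono mult_left_mono) (auto intro!: mult_left_mono)
      also have "\<dots> = real (card B') * (2 * Q^3 * exp (t * (lam 1 - lam 0 + 2 * \<epsilon>)))" by simp
      also have "\<dots> \<le> ?N * (2 * Q^3 * exp (t * (lam 1 - lam 0 + 2 * \<epsilon>)))"
        using cardB' Q by (intro mult_right_mono) auto
      finally show ?thesis using small by simp
    qed
    have "norm (\<Sum>b\<in>B'. c x b *\<^sub>R blinfun_apply g b) \<le> (\<Sum>b\<in>B'. E / 2 * T b)"
    proof (rule sum_norm_le)
      fix b assume "b \<in> B'"
      then show "norm (c x b *\<^sub>R blinfun_apply g b) \<le> E / 2 * T b"
        using coef_le[of b] coef_eq[of b] B'(2) by simp
    qed
    also have "\<dots> = E / 2 * (\<Sum>b\<in>B'. T b)" by (simp add: sum_distrib_left)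
    also have "\<dots> \<le> E / 2 * (1/2)" using sumT E by (intro mult_left_mono) auto
    finally have rest: "norm (\<Sum>b\<in>B'. c x b *\<^sub>R blinfun_apply g b) \<le> E / 4" by simp
    have "E \<le> norm (blinfun_apply g v)" using vX by (simp add: E_def)
    also have "\<dots> \<le> norm (c x b0 *\<^sub>R blinfun_apply g b0) + norm (\<Sum>b\<in>B'. c x b *\<^sub>R blinfun_apply g b)"
      unfolding gv by (rule norm_triangle_ineq)
    finally have lead: "E / 2 \<le> \<bar>c x b0\<bar> * norm (blinfun_apply g b0)" using rest E by simp
    then show c0: "c x b0 \<noteq> 0" using E by auto
    have pos: "0 < \<bar>c x b0\<bar> * norm (blinfun_apply g b0)" using lead E by linarith
    show \<tau>T: "\<forall>b\<in>B'. \<bar>\<tau> x b\<bar> \<le> T b"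
    proof
      fix b assume b: "b \<in> B'"
      have T0: "T b \<ge> 0" using Q by (simp add: T_def)
      have "\<bar>c x b\<bar> * norm (blinfun_apply g b) \<le> E / 2 * T b" using coef_le[of b] coef_eq[of b] B'(2)[OF b] by simp
      also have "\<dots> \<le> (\<bar>c x b0\<bar> * norm (blinfun_apply g b0)) * T b" using lead T0 by (rule mult_right_mono)
      finally show "\<bar>\<tau> x b\<bar> \<le> T b" using pos by (simp add: \<tau>_def abs_mult abs_divide pos_divide_le_eq mult.commute)
    qed
    have "norm (\<Sum>b\<in>B'. \<tau> x b *\<^sub>R sgn (blinfun_apply g b)) \<le> (\<Sum>b\<in>B'. T b)"
      using \<tau>T gb0 B'(2) by (intro sum_norm_le) (auto simp: norm_sgn)
    moreover have "norm (sgn (blinfun_apply g b0)) = 1" using gb0[OF b0B(1)] by (simp add: norm_sgn)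
    moreover have "norm (sgn (blinfun_apply g b0)) - norm (\<Sum>b\<in>B'. \<tau> x b *\<^sub>R sgn (blinfun_apply g b)) \<le> norm (u x)"
      unfolding u_def by (metis add.commute norm_diff_ineq)
    ultimately show "1/2 \<le> norm (u x)" using sumT by linarith
    have "(c x b0 * norm (blinfun_apply g b0)) *\<^sub>R \<tau> x b *\<^sub>R sgn (blinfun_apply g b) = c x b *\<^sub>R blinfun_apply g b"
      if "b \<in> B'" for b
      using c0 gb0[OF b0B(1)] gb0[of b] B'(2)[OF that] by (simp add: \<tau>_def sgn_div_norm)
    moreover have "(c x b0 * norm (blinfun_apply g b0)) *\<^sub>R sgn (blinfun_apply g b0) = c x b0 *\<^sub>R blinfun_apply g b0"
      using gb0[OF b0B(1)] by (simp add: sgn_div_norm)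
    ultimately show "blinfun_apply g (rep_projective x) = (c x b0 * norm (blinfun_apply g b0)) *\<^sub>R u x"
      unfolding v_def[symmetric] gv u_def scaleR_add_right scaleR_sum_right by (simp cong: sum.cong)
  qed
  define I where "I = {b \<in> B. blk b \<in> {1..m}}"
  have I: "finite I" "I \<subseteq> B'" using finB b0B by (auto simp: I_def B'_def)
  \<comment> \<open>Only blocks 1..m are sliced. The coefficient along b0 is normalised to 1, and
    the coordinates in later blocks are already at most \<open>2 * Q^3 * \<rho>\<close>.\<close>
  define \<kappa> where "\<kappa> x = (\<lambda>b\<in>I. \<lfloor>\<tau> x b / \<rho>\<rfloor>)" for x
  define h where "h b = T b / \<rho>" for b
  have h: "h b = 2 * Q^3 * exp (t * (lam (blk b) - lam (Suc m)))" for b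
  proof -
    have "exp (t * (lam (blk b) - lam 0 + 2 * \<epsilon>)) = exp (t * (lam (blk b) - lam (Suc m))) * \<rho>"
      by (simp add: \<rho> exp_add[symmetric] algebra_simps)
    then show ?thesis using \<rho>0 by (simp add: h_def T_def)
  qed
  have h1: "1 \<le> h b" if "b \<in> I" for b
  proof -
    have "lam (Suc m) \<le> lam (blk b)" using that m by (intro lam) (auto simp: I_def)
    then have "1 \<le> exp (t * (lam (blk b) - lam (Suc m)))" using t by simp
    moreover have "1 \<le> 2 * Q^3" using Q3 by linarith
    ultimately have "1 * 1 \<le> (2 * Q^3) * exp (t * (lam (blk b) - lam (Suc m)))"
      using Q by (intro mult_mono) auto
    then show ?thesis by (simp add: h)
  qed
  let ?T = "PiE I (\<lambda>b. {- \<lceil>h b\<rceil>..\<lceil>h b\<rceil>})"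
  have "\<kappa> ` X \<subseteq> ?T"
  proof (intro image_subsetI PiE_I)
    fix x b assume "x \<in> X" "b \<in> I"
    then show "\<kappa> x b \<in> {- \<lceil>h b\<rceil>..\<lceil>h b\<rceil>}"
      unfolding \<kappa>_def h_def using floor_key_range[of "\<tau> x b" "T b" \<rho>] main(2) I(2) \<rho>0 by auto
  qed (auto simp: \<kappa>_def)
  moreover have "finite ?T" by (rule card_floor_keys[OF I(1) h1])
  moreover have "real (card ?T) \<le> (10 * Q^3) ^ DIM('a) * exp (t * (\<Sum>b\<in>I. lam (blk b) - lam (Suc m)))"
  proof -
    have "real (card ?T) \<le> (\<Prod>b\<in>I. 5 * h b)" by (rule card_floor_keys[OF I(1) h1])
    also have "\<dots> = (10 * Q^3) ^ card I * exp (t * (\<Sum>b\<in>I. lam (blk b) - lam (Suc m)))"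
      using I(1) by (simp add: h prod.distrib exp_sum sum_distrib_left mult.assoc[symmetric])
    also have "(10 * Q^3) ^ card I \<le> (10 * Q^3) ^ DIM('a)"
    proof (rule power_increasing)
      have "card I \<le> card B" using I finB by (intro card_mono) (auto simp: B'_def)
      then show "card I \<le> DIM('a)" using cardB by simp
    qed (use Q3 in auto)
    finally show ?thesis by (simp add: mult_right_mono)
  qed
  moreover have "dist (gl_act g x) (gl_act g y) \<le> 8 * ?N * Q^3 * \<rho>"
    if x: "x \<in> X" and y: "y \<in> X" and eq: "\<kappa> x = \<kappa> y" for x y
  proof -
    have "\<bar>\<tau> x b - \<tau> y b\<bar> \<le> 4 * Q^3 * \<rho>" if b: "b \<in> B'" for b
    proof (cases "b \<in> I")
      case True
      then have "\<lfloor>\<tau> x b / \<rho>\<rfloor> = \<lfloor>\<tau> y b / \<rho>\<rfloor>" using fun_cong[OF eq, of b] by (simp add: \<kappa>_def)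
      then have "\<bar>\<tau> x b - \<tau> y b\<bar> \<le> 1 * \<rho>" using floor_eq_imp_close[OF \<rho>0] by simp
      also have "\<dots> \<le> (4 * Q^3) * \<rho>" using Q3 \<rho>0 by (intro mult_right_mono) auto
      finally show ?thesis .
    next
      case False
      then have "Suc m \<le> blk b" using B'(2)[OF b] by (auto simp: I_def)
      then have "lam (blk b) \<le> lam (Suc m)" using B'(2)[OF b] blk(1) by (intro lam) auto
      then have "T b \<le> 2 * Q^3 * \<rho>"
        unfolding T_def \<rho> using Q t by (intro mult_left_mono) (auto intro!: mult_left_mono)
      then show ?thesis using main(2)[OF x] main(2)[OF y] b by fastforce
    qed
    then have "(\<Sum>b\<in>B'. \<bar>\<tau> x b - \<tau> y b\<bar>) \<le> (\<Sum>b\<in>B'. 4 * Q^3 * \<rho>)" by (rule sum_mono)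
    also have "\<dots> = real (card B') * (4 * Q^3 * \<rho>)" by simp
    also have "\<dots> \<le> ?N * (4 * Q^3 * \<rho>)" using cardB' Q \<rho>0 by (intro mult_right_mono) auto
    finally have sum: "(\<Sum>b\<in>B'. \<bar>\<tau> x b - \<tau> y b\<bar>) \<le> ?N * (4 * Q^3 * \<rho>)" .
    have "dist (gl_act g x) (gl_act g y) = angle_sine (u x) (u y)"
      unfolding dist_gl_act[OF g] main(4)[OF x] main(4)[OF y]
      using main(1)[OF x] main(1)[OF y] gb0[OF b0B(1)] by (intro angle_sine_scaleR) auto
    also have "\<dots> \<le> 2 * (\<Sum>b\<in>B'. \<bar>\<tau> x b - \<tau> y b\<bar>)"
      using B'(1) main(3)[OF x] main(3)[OF y]
      by (intro angle_sine_coordinates[where f = "sgn (blinfun_apply g b0)" and e = "\<lambda>b. sgn (blinfun_apply g b)"])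
        (auto simp: u_def norm_sgn)
    finally show ?thesis using sum by simp
  qed
  ultimately show ?thesis unfolding I_def by blast
qed

text \<open>The coordinate of largest modulus is normalised to 1, so the other
  \<open>DIM('a) - 1\<close> coordinates lie in [-1, 1] and are cut into cells of size \<rho>. A key
  records which coordinate was normalised and the cell.\<close>

lemma projective_keys:
  fixes \<rho> :: real
  assumes \<rho>: "0 < \<rho>" "\<rho> \<le> 1"
  shows "\<exists>(\<kappa> :: 'a::euclidean_space projective \<Rightarrow> 'a \<times> ('a \<Rightarrow> int)) T. range \<kappa> \<subseteq> T \<and> finite T \<and>
    real (card T) \<le> real DIM('a) * (5 / \<rho>) ^ (DIM('a) - 1) \<and>
    (\<forall>x y. \<kappa> x = \<kappa> y \<longrightarrow> dist x y \<le> 2 * real DIM('a) * \<rho>)"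
proof -
  have "\<exists>b\<in>Basis. \<forall>b'\<in>Basis. \<bar>v \<bullet> b'\<bar> \<le> \<bar>v \<bullet> b\<bar>" for v :: 'a
  proof -
    obtain b where "b \<in> Basis" "\<bar>v \<bullet> b\<bar> = Max ((\<lambda>b. \<bar>v \<bullet> b\<bar>) ` Basis)"
      using Max_in[of "(\<lambda>b. \<bar>v \<bullet> b\<bar>) ` Basis"] by (auto simp: image_iff)
    then show ?thesis by (auto intro!: bexI[of _ b])
  qed
  then obtain m where m: "\<And>v::'a. m v \<in> Basis" "\<And>v b'. b' \<in> Basis \<Longrightarrow> \<bar>v \<bullet> b'\<bar> \<le> \<bar>v \<bullet> m v\<bar>" by metis
  define c where "c x = m (rep_projective x)" for x :: "'a projective"
  define \<tau> where "\<tau> x b = (rep_projective x \<bullet> b) / (rep_projective x \<bullet> c x)" for x :: "'a projective" and b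
  define u where "u x = c x + (\<Sum>b\<in>Basis - {c x}. \<tau> x b *\<^sub>R b)" for x
  have cB: "c x \<in> Basis" for x by (simp add: c_def m)
  have nz: "rep_projective x \<bullet> c x \<noteq> 0" for x
  proof
    assume "rep_projective x \<bullet> c x = 0"
    then have "\<forall>b\<in>Basis. rep_projective x \<bullet> b = 0" using m(2)[of _ "rep_projective x"] by (auto simp: c_def)
    then have "rep_projective x = 0" by (simp add: euclidean_all_zero_iff)
    then show False by (simp add: rep_projective_nonzero)
  qed
  have \<tau>1: "\<bar>\<tau> x b\<bar> \<le> 1" if "b \<in> Basis" for x b
    using m(2)[OF that, of "rep_projective x"] nz[of x] by (simp add: \<tau>_def c_def abs_divide)
  have rep: "rep_projective x = (rep_projective x \<bullet> c x) *\<^sub>R u x" for x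
  proof -
    have "rep_projective x = (\<Sum>b\<in>Basis. (rep_projective x \<bullet> b) *\<^sub>R b)" by (simp add: euclidean_representation)
    also have "\<dots> = (rep_projective x \<bullet> c x) *\<^sub>R c x + (\<Sum>b\<in>Basis - {c x}. (rep_projective x \<bullet> b) *\<^sub>R b)"
      by (rule sum.remove[OF finite_Basis cB])
    finally show ?thesis using nz[of x] by (simp add: u_def scaleR_add_right scaleR_sum_right \<tau>_def)
  qed
  have nu: "1 \<le> norm (u x)" for x
  proof -
    have "\<bar>rep_projective x \<bullet> c x\<bar> * 1 \<le> norm (rep_projective x)" using Basis_le_norm[OF cB] by simp
    also have "\<dots> = \<bar>rep_projective x \<bullet> c x\<bar> * norm (u x)" using rep[of x] by (metis norm_scaleR)
    finally show ?thesis using nz[of x] by simp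
  qed
  define \<kappa> where "\<kappa> x = (c x, \<lambda>b\<in>Basis - {c x}. \<lfloor>\<tau> x b / \<rho>\<rfloor>)" for x
  let ?K = "\<lambda>b0 :: 'a. PiE (Basis - {b0}) (\<lambda>b. {- \<lceil>1 / \<rho>\<rceil>..\<lceil>1 / \<rho>\<rceil>})"
  define T where "T = Sigma Basis ?K"
  have \<rho>1: "1 \<le> 1 / \<rho>" using \<rho> by simp
  have finK: "finite (?K b0)" for b0 :: 'a
    by (rule card_floor_keys(1)[where h = "\<lambda>_. 1 / \<rho>"]) (use \<rho>1 in auto)
  have cardK: "real (card (?K b0)) \<le> (5 / \<rho>) ^ (DIM('a) - 1)" if "b0 \<in> Basis" for b0 :: 'a
    using card_floor_keys(2)[of "Basis - {b0}" "\<lambda>_. 1 / \<rho>"] \<rho>1 that by simp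
  have "range \<kappa> \<subseteq> T"
  proof (intro image_subsetI)
    fix x
    have "(\<lambda>b\<in>Basis - {c x}. \<lfloor>\<tau> x b / \<rho>\<rfloor>) \<in> ?K (c x)"
      using floor_key_range[OF \<tau>1 \<rho>(1)] by (intro restrict_PiE_iff[THEN iffD2]) auto
    then show "\<kappa> x \<in> T" unfolding T_def \<kappa>_def using cB by blast
  qed
  moreover have "finite T" unfolding T_def using finK by (intro finite_SigmaI) auto
  moreover have "real (card T) \<le> real DIM('a) * (5 / \<rho>) ^ (DIM('a) - 1)"
  proof -
    have "card T = (\<Sum>b\<in>Basis. card (?K b))" unfolding T_def using finK by (intro card_SigmaI) auto
    also have "real \<dots> \<le> (\<Sum>b\<in>(Basis::'a set). (5 / \<rho>) ^ (DIM('a) - 1))"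
      unfolding of_nat_sum using cardK by (intro sum_mono) auto
    finally show ?thesis by simp
  qed
  moreover have "dist x y \<le> 2 * real DIM('a) * \<rho>" if eq: "\<kappa> x = \<kappa> y" for x y
  proof -
    have cxy: "c y = c x" using eq by (simp add: \<kappa>_def)
    have "\<bar>\<tau> x b - \<tau> y b\<bar> \<le> \<rho>" if "b \<in> Basis - {c x}" for b
    proof (rule floor_eq_imp_close[OF \<rho>(1)])
      have "(\<lambda>b\<in>Basis - {c x}. \<lfloor>\<tau> x b / \<rho>\<rfloor>) = (\<lambda>b\<in>Basis - {c x}. \<lfloor>\<tau> y b / \<rho>\<rfloor>)"
        using eq cxy by (simp add: \<kappa>_def)
      from fun_cong[OF this, of b] show "\<lfloor>\<tau> x b / \<rho>\<rfloor> = \<lfloor>\<tau> y b / \<rho>\<rfloor>" using that by simp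
    qed
    then have "(\<Sum>b\<in>Basis - {c x}. \<bar>\<tau> x b - \<tau> y b\<bar>) \<le> (\<Sum>b\<in>Basis - {c x}. \<rho>)" by (rule sum_mono)
    also have "\<dots> \<le> real DIM('a) * \<rho>"
      using \<rho>(1) card_Diff1_le[of Basis "c x"] by (simp add: mult_right_mono)
    finally have sum: "(\<Sum>b\<in>Basis - {c x}. \<bar>\<tau> x b - \<tau> y b\<bar>) \<le> real DIM('a) * \<rho>" .
    have "dist x y = angle_sine (u x) (u y)"
      unfolding dist_projective_rep using rep[of x] rep[of y] nz[of x] nz[of y] by (metis angle_sine_scaleR)
    also have "\<dots> \<le> 2 * (\<Sum>b\<in>Basis - {c x}. \<bar>\<tau> x b - \<tau> y b\<bar>)"
      using nu[of x] nu[of y] cxy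
      by (intro angle_sine_coordinates[where f = "c x" and e = "\<lambda>b. b"]) (auto simp: u_def)
    finally show ?thesis using sum by simp
  qed
  ultimately show ?thesis by blast
qed

context stationary_walk
begin

text \<open>For each word in W and each key, one point of \<open>X w\<close> with image in G is
  chosen if there is one. Balls about the chosen images catch every image of \<open>X w\<close> that
  lies in G, so \<open>X w\<close> lies in the preimages of their union U and of the complement of
  G. After averaging, stationarity turns these into the measures of U and of the complement; the
  latter takes at most c of the mass \<open>2 * c\<close>.\<close>

lemma stationary_cover:
  fixes \<kappa> :: "'l list \<Rightarrow> 'a projective \<Rightarrow> 'k"
  assumes W: "W \<subseteq> words p n" "real (card W) \<le> C"
    and X: "\<And>w. w \<in> W \<Longrightarrow> X w \<in> sets borel"
    and T: "\<And>w. w \<in> W \<Longrightarrow> \<kappa> w ` X w \<subseteq> T w \<and> finite (T w) \<and> real (card (T w)) \<le> M"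
    and M: "M \<ge> 0"
    and close: "\<And>w x y. w \<in> W \<Longrightarrow> x \<in> X w \<Longrightarrow> y \<in> X w \<Longrightarrow> \<kappa> w x = \<kappa> w y \<Longrightarrow>
      dist (gl_act (word_prod A w) x) (gl_act (word_prod A w) y) \<le> R"
    and mass: "2 * c \<le> (\<Sum>w\<in>W. word_weight p w * measure \<nu> (X w))"
    and G: "G \<in> sets borel" "measure \<nu> G \<ge> 1 - c"
  shows "\<exists>Z. finite Z \<and> Z \<subseteq> G \<and> real (card Z) \<le> C * M \<and> measure \<nu> (\<Union>x\<in>Z. cball x R) \<ge> c"
proof -
  have finW: "finite W" using W(1) finite_words finite_subset by blast
  define sel where "sel w k x \<longleftrightarrow> x \<in> X w \<and> \<kappa> w x = k \<and> gl_act (word_prod A w) x \<in> G" for w k x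
  define P where "P = {(w, k). w \<in> W \<and> k \<in> T w \<and> (\<exists>x. sel w k x)}"
  define z where "z = (\<lambda>(w, k). gl_act (word_prod A w) (SOME x. sel w k x))"
  define Z where "Z = z ` P"
  have selz: "sel w k (SOME x. sel w k x)" if "(w, k) \<in> P" for w k
    using that unfolding P_def by (auto intro: someI_ex)
  have PS: "P \<subseteq> Sigma W T" by (auto simp: P_def)
  have finS: "finite (Sigma W T)" using finW T by (intro finite_SigmaI) auto
  have finP: "finite P" using PS finS finite_subset by blast
  have "finite Z" using finP by (simp add: Z_def)
  moreover have "Z \<subseteq> G" using selz by (auto simp: Z_def z_def sel_def)
  moreover have "real (card Z) \<le> C * M"
  proof -
    have "card Z \<le> card P" unfolding Z_def by (rule card_image_le[OF finP])
    also have "\<dots> \<le> card (Sigma W T)" by (rule card_mono[OF finS PS])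
    also have "\<dots> = (\<Sum>w\<in>W. card (T w))" using finW T by (intro card_SigmaI) auto
    finally have "real (card Z) \<le> (\<Sum>w\<in>W. real (card (T w)))"
      unfolding of_nat_sum[symmetric] by (rule of_nat_mono)
    also have "\<dots> \<le> (\<Sum>w\<in>W. M)" using T by (intro sum_mono) auto
    also have "\<dots> \<le> C * M" using W(2) M by (simp add: mult_right_mono)
    finally show ?thesis .
  qed
  moreover have "measure \<nu> (\<Union>x\<in>Z. cball x R) \<ge> c"
  proof -
    define U where "U = (\<Union>x\<in>Z. cball x R)"
    have U: "U \<in> sets borel" unfolding U_def using \<open>finite Z\<close> by (intro borel_closed closed_UN) auto
    have Gc: "- G \<in> sets borel" using G(1) by (simp add: borel_comp)
    let ?V = "\<lambda>w E. {x. gl_act (word_prod A w) x \<in> E}"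
    have Vs: "?V w E \<in> sets \<nu>" if "w \<in> words p n" "E \<in> sets borel" for w E
      unfolding sets_nu using that by (intro gl_act_vimage_sets word_prod_GL) (auto simp: words_def)
    have "measure \<nu> (X w) \<le> measure \<nu> (?V w U) + measure \<nu> (?V w (- G))" if w: "w \<in> W" for w
    proof -
      have ww: "w \<in> words p n" using w W(1) by blast
      have "X w \<subseteq> ?V w U \<union> ?V w (- G)"
      proof
        fix x assume x: "x \<in> X w"
        show "x \<in> ?V w U \<union> ?V w (- G)"
        proof (cases "gl_act (word_prod A w) x \<in> G")
          case True
          then have "sel w (\<kappa> w x) x" using x by (simp add: sel_def)
          then have P: "(w, \<kappa> w x) \<in> P" using w x T[OF w] by (auto simp: P_def)
          from selz[OF P] close[OF w _ x] have "gl_act (word_prod A w) x \<in> cball (z (w, \<kappa> w x)) R"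
            by (auto simp: z_def sel_def)
          then show ?thesis using P by (auto simp: U_def Z_def)
        qed simp
      qed
      then have "measure \<nu> (X w) \<le> measure \<nu> (?V w U \<union> ?V w (- G))"
        using Vs[OF ww U] Vs[OF ww Gc] by (intro N.finite_measure_mono) auto
      also have "\<dots> \<le> measure \<nu> (?V w U) + measure \<nu> (?V w (- G))"
        using Vs[OF ww U] Vs[OF ww Gc] by (rule measure_Un_le)
      finally show ?thesis .
    qed
    then have "2 * c \<le> (\<Sum>w\<in>W. word_weight p w * (measure \<nu> (?V w U) + measure \<nu> (?V w (- G))))"
      by (intro order_trans[OF mass] sum_mono mult_left_mono word_weight_nonneg)
    also have "\<dots> \<le> (\<Sum>w\<in>words p n. word_weight p w * (measure \<nu> (?V w U) + measure \<nu> (?V w (- G))))"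
      using W(1) finite_words by (intro sum_mono2) (auto intro!: mult_nonneg_nonneg word_weight_nonneg)
    also have "\<dots> = word_mean p n (\<lambda>w. measure \<nu> (?V w U)) + word_mean p n (\<lambda>w. measure \<nu> (?V w (- G)))"
      by (simp add: word_mean_eq_sum distrib_left sum.distrib)
    also have "\<dots> = measure \<nu> U + measure \<nu> (- G)"
      using stationary_words[OF U, of n] stationary_words[OF Gc, of n] by simp
    also have "measure \<nu> (- G) = 1 - measure \<nu> G"
      using N.prob_compl[of G] G(1) by (simp add: space_nu sets_nu Compl_eq_Diff_UNIV)
    finally show ?thesis using G(2) by (simp add: U_def)
  qed
  ultimately show ?thesis by blast
qed

end

section \<open>The dimension bound\<close>

lemma lyapunov_exponents_antimono:
  assumes "\<And>i. i < s \<Longrightarrow> lam (Suc i) < (lam i :: real)" "i \<le> j" "j \<le> s"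
  shows "lam j \<le> lam i"
  using assms(2,3)
proof (induction j rule: dec_induct)
  case (step k)
  then have "lam (Suc k) < lam k" "lam k \<le> lam i" using assms(1)[of k] by auto
  then show ?case by linarith
qed simp

context stationary_walk
begin

definition fast :: "real \<Rightarrow> real \<Rightarrow> real \<Rightarrow> nat \<Rightarrow> 'l list \<Rightarrow> 'a projective set" where
  "fast l0 \<epsilon> Q n w = {x. exp (real n * (l0 - \<epsilon>)) / Q * norm (rep_projective x)
      \<le> norm (blinfun_apply (word_prod A w) (rep_projective x))}"

text \<open>What the Oseledets filtration says at time n, put as a condition on the finite word. The
  basis and its blocks may change with the word and with n; the constant Q may not.\<close>

definition good_word :: "nat \<Rightarrow> (nat \<Rightarrow> real) \<Rightarrow> (nat \<Rightarrow> nat) \<Rightarrow> real \<Rightarrow> real \<Rightarrow> nat \<Rightarrow> 'l list \<Rightarrow> bool" where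
  "good_word s lam d \<epsilon> Q n w \<longleftrightarrow> 1 / Q \<le> measure \<nu> (fast (lam 0) \<epsilon> Q n w) \<and>
    (\<exists>B blk. independent B \<and> span B = UNIV \<and>
      (\<forall>b\<in>B. blk b \<le> s \<and> norm (blinfun_apply (word_prod A w) b) \<le> Q * exp (real n * (lam (blk b) + \<epsilon>))) \<and>
      (\<forall>i\<le>s. card {b \<in> B. blk b = i} = d i) \<and> (\<forall>b x. \<bar>representation B x b\<bar> \<le> Q * norm x))"

lemma fast_sets: "fast l0 \<epsilon> Q n w \<in> sets borel"
  unfolding fast_def by (intro borel_closed closed_projective_norm_ge)

text \<open>A vector outside \<open>F 1\<close> grows at the rate \<open>lam 0\<close>, and
  \<open>F 1\<close>, being proper as \<open>d 0 > 0\<close>, does not carry all of \<nu>; so a set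
  of positive measure is stretched fast. A basis adapted to the filtration gives the upper bounds.
  All constants are replaced by one integer, to leave a countable union over k.\<close>

lemma AE_good_words:
  assumes spec: "lyapunov_spectrum p A s lam d" and \<epsilon>: "\<epsilon> > 0"
  shows "AE \<omega> in letter_sequences p. \<exists>k::nat. \<forall>n. good_word s lam d \<epsilon> (real (Suc k)) n (map \<omega> [0..<n])"
proof -
  have "AE \<omega> in letter_sequences p.
        \<exists>F :: nat \<Rightarrow> 'a set.
          (\<forall>i\<le>Suc s. subspace (F i)) \<and> F 0 = UNIV \<and> F (Suc s) = {0} \<and>
          (\<forall>i\<le>s. F (Suc i) \<subseteq> F i \<and> dim (F i) = dim (F (Suc i)) + d i \<and>
             (\<forall>v \<in> F i - F (Suc i).
                (\<lambda>n. ln (norm (random_product A \<omega> n v)) / real n) \<longlonglongrightarrow> lam i))"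
    using spec by (simp add: lyapunov_spectrum_def)
  moreover note AE_letters[of p]
  ultimately show ?thesis
  proof eventually_elim
    case (elim \<omega>)
    obtain F :: "nat \<Rightarrow> 'a set" where F: "\<forall>i\<le>Suc s. subspace (F i)" "F 0 = UNIV" "F (Suc s) = {0}"
      "\<forall>i\<le>s. F (Suc i) \<subseteq> F i \<and> dim (F i) = dim (F (Suc i)) + d i \<and>
             (\<forall>v \<in> F i - F (Suc i). (\<lambda>n. ln (norm (random_product A \<omega> n v)) / real n) \<longlonglongrightarrow> lam i)"
      using elim(1) by blast
    define g where "g n = word_prod A (map \<omega> [0..<n])" for n
    have gGL: "g n \<in> GL" for n unfolding g_def using elim(2) by (intro word_prod_GL) auto
    have rate: "(\<lambda>n. ln (norm (blinfun_apply (g n) v)) / real n) \<longlonglongrightarrow> lam i"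
      if "i \<le> s" "v \<in> F i - F (Suc i)" for i v
      using F(4) that by (auto simp: g_def random_product_eq_word_prod)
    obtain B where B: "independent B" "B \<subseteq> F 0" "\<forall>i\<le>Suc s. span (B \<inter> F i) = F i"
      by (rule adapted_basis[of s F]) (use F in auto)
    have spB: "span B = UNIV" using B(3)[rule_format, of 0] F(2) by simp
    have finB: "finite B" using independent_bound[OF B(1)] by simp
    define blk where "blk b = Max {i. i \<le> s \<and> b \<in> F i}" for b
    have blk: "blk b \<le> s \<and> b \<in> F (blk b) - F (Suc (blk b))" if b: "b \<in> B" for b
    proof -
      let ?S = "{i. i \<le> s \<and> b \<in> F i}"
      have S: "finite ?S" "?S \<noteq> {}" using F(2) by auto
      have 1: "blk b \<in> ?S" unfolding blk_def by (rule Max_in[OF S])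
      have "b \<notin> F (Suc (blk b))"
      proof
        assume *: "b \<in> F (Suc (blk b))"
        show False
        proof (cases "Suc (blk b) \<le> s")
          case True
          then have "Suc (blk b) \<le> blk b" unfolding blk_def[of b] using * S(1)
            by (intro Max_ge) (auto simp: blk_def[symmetric])
          then show False by simp
        next
          case False
          then have "blk b = s" using 1 by simp
          then have "b = 0" using * F(3) by simp
          then show False using b B(1) dependent_zero by blast
        qed
      qed
      then show ?thesis using 1 by simp
    qed
    have cardblk: "card {b \<in> B. blk b = i} = d i" if i: "i \<le> s" for i
    proof -
      have mono: "F k \<subseteq> F j" if "j \<le> k" "k \<le> Suc s" for j k
        using that
      proof (induction k rule: dec_induct)
        case (step k)
        then show ?case using F(4) by (meson Suc_leD Suc_le_mono order_trans)
      qed simp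
      have dimF: "dim (F j) = card (B \<inter> F j)" if "j \<le> Suc s" for j
      proof -
        have "independent (B \<inter> F j)" using B(1) by (rule independent_mono) auto
        then have "dim (span (B \<inter> F j)) = card (B \<inter> F j)" by (simp add: dim_eq_card_independent)
        then show ?thesis using B(3) that by simp
      qed
      have "{b \<in> B. blk b = i} = B \<inter> F i - B \<inter> F (Suc i)"
      proof
        show "{b \<in> B. blk b = i} \<subseteq> B \<inter> F i - B \<inter> F (Suc i)" using blk by auto
        show "B \<inter> F i - B \<inter> F (Suc i) \<subseteq> {b \<in> B. blk b = i}"
        proof
          fix b assume b: "b \<in> B \<inter> F i - B \<inter> F (Suc i)"
          have "\<not> blk b < i" using blk[of b] b mono[of "Suc (blk b)" i] i by auto
          moreover have "\<not> i < blk b" using blk[of b] b mono[of "Suc i" "blk b"] by auto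
          ultimately show "b \<in> {b \<in> B. blk b = i}" using b by auto
        qed
      qed
      moreover have "B \<inter> F (Suc i) \<subseteq> B \<inter> F i" using F(4) i by auto
      ultimately have "card {b \<in> B. blk b = i} = card (B \<inter> F i) - card (B \<inter> F (Suc i))"
        using finB by (simp add: card_Diff_subset)
      then show ?thesis using dimF[of i] dimF[of "Suc i"] F(4) i by auto
    qed
    have "\<exists>Q>0. \<forall>n. norm (blinfun_apply (g n) b) \<le> Q * exp (real n * (lam (blk b) + \<epsilon>))" if b: "b \<in> B" for b
    proof -
      have "b \<noteq> 0" using b B(1) dependent_zero by blast
      then have "\<forall>\<^sub>F n in sequentially. norm (blinfun_apply (g n) b) \<le> exp (real n * (lam (blk b) + \<epsilon>))"
        using growth_rate_bounds[OF rate[of "blk b" b] _ \<epsilon>] blk[OF b] GL_nonzero[OF gGL]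
        by (auto elim: eventually_mono)
      then show ?thesis by (rule eventually_le_imp_bounded) auto
    qed
    then obtain Q1 where Q1: "\<And>b. b \<in> B \<Longrightarrow> Q1 b > 0"
      "\<And>b n. b \<in> B \<Longrightarrow> norm (blinfun_apply (g n) b) \<le> Q1 b * exp (real n * (lam (blk b) + \<epsilon>))" by metis
    obtain Q2 where Q2: "Q2 > 0" "\<forall>b x. \<bar>representation B x b\<bar> \<le> Q2 * norm x"
      by (rule representation_bounded[OF B(1) spB])
    \<comment> \<open>Points that are fast at every time with constant \<open>Suc k\<close>. These
      sets increase, and their union contains all lines outside \<open>F 1\<close>.\<close>
    define X where "X k = (\<Inter>n. fast (lam 0) \<epsilon> (real (Suc k)) n (map \<omega> [0..<n]))" for k
    have Xs: "X k \<in> sets borel" for k unfolding X_def by (intro sets.countable_INT) (auto simp: fast_sets)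
    have "incseq X"
    proof (rule incseq_SucI)
      fix k
      have "exp a / real (Suc (Suc k)) \<le> exp a / real (Suc k)" for a :: real by (intro divide_left_mono) auto
      then have "exp a / real (Suc (Suc k)) * norm v \<le> exp a / real (Suc k) * norm v" for a and v :: 'a
        by (rule mult_right_mono) simp
      then show "X k \<subseteq> X (Suc k)" unfolding X_def fast_def by (auto intro: order_trans)
    qed
    then have limX: "(\<lambda>k. measure \<nu> (X k)) \<longlonglongrightarrow> measure \<nu> (\<Union>k. X k)"
      using Xs by (intro N.finite_Lim_measure_incseq) (auto simp: sets_nu)
    have "- {x. rep_projective x \<in> F 1} \<subseteq> (\<Union>k. X k)"
    proof
      fix x assume "x \<in> - {x. rep_projective x \<in> F 1}"
      then have x: "rep_projective x \<in> F 0 - F (Suc 0)" using F(2) by simp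
      define v where "v = rep_projective x"
      have v: "v \<noteq> 0" by (simp add: v_def rep_projective_nonzero)
      have gv: "norm (blinfun_apply (g n) v) > 0" for n using GL_nonzero[OF gGL v] by simp
      have "\<forall>\<^sub>F n in sequentially. exp (real n * (lam 0 - \<epsilon>)) \<le> norm (blinfun_apply (g n) v)"
        using growth_rate_bounds[OF rate[of 0 v] _ \<epsilon>] x gv by (auto simp: v_def elim: eventually_mono)
      then obtain Q where Q: "Q > 0" "\<forall>n. exp (real n * (lam 0 - \<epsilon>)) \<le> Q * norm (blinfun_apply (g n) v)"
        by (rule eventually_le_imp_bounded) (rule gv)
      obtain k :: nat where k: "real k > Q * norm v" using reals_Archimedean2 by blast
      have "exp (real n * (lam 0 - \<epsilon>)) / real (Suc k) * norm v \<le> norm (blinfun_apply (g n) v)" for n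
      proof -
        have "exp (real n * (lam 0 - \<epsilon>)) * norm v \<le> (Q * norm (blinfun_apply (g n) v)) * norm v"
          using Q(2) by (intro mult_right_mono) auto
        also have "\<dots> = (Q * norm v) * norm (blinfun_apply (g n) v)" by simp
        also have "\<dots> \<le> real (Suc k) * norm (blinfun_apply (g n) v)" using k by (intro mult_right_mono) auto
        finally show ?thesis by (simp add: pos_divide_le_eq mult.commute)
      qed
      then have "x \<in> X k" unfolding X_def fast_def g_def[symmetric] v_def by blast
      then show "x \<in> (\<Union>k. X k)" by blast
    qed
    then have "measure \<nu> (- {x. rep_projective x \<in> F 1}) \<le> measure \<nu> (\<Union>k. X k)"
      using Xs by (intro N.finite_measure_mono) (auto simp: sets_nu)
    moreover have "measure \<nu> (- {x. rep_projective x \<in> F 1}) > 0"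
    proof -
      have sub: "subspace (F 1)" using F(1) by simp
      have "dim (F 1) < dim (F 0)" using F(4)[rule_format, of 0] spec by (auto simp: lyapunov_spectrum_def)
      then have "F 1 \<noteq> UNIV" using F(2) by auto
      from proper_subspace_not_full[OF sub this] show ?thesis
        using N.prob_compl[of "{x. rep_projective x \<in> F 1}"] subspace_sets[OF sub]
        by (simp add: space_nu sets_nu Compl_eq_Diff_UNIV)
    qed
    ultimately have pos: "measure \<nu> (\<Union>k. X k) > 0" by linarith
    obtain k0 :: nat where k0: "real k0 > Q2 + (\<Sum>b\<in>B. Q1 b)" using reals_Archimedean2 by blast
    let ?L = "measure \<nu> (\<Union>k. X k)"
    have "\<forall>\<^sub>F k in sequentially. ?L / 2 < measure \<nu> (X k)" using limX pos by (intro order_tendstoD(1)) auto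
    moreover have "(\<lambda>k. 1 / real (Suc k)) \<longlonglongrightarrow> 0" using LIMSEQ_inverse_real_of_nat by (simp add: inverse_eq_divide)
    then have "\<forall>\<^sub>F k in sequentially. 1 / real (Suc k) < ?L / 2" using pos by (intro order_tendstoD(2)) auto
    moreover note eventually_ge_at_top[of k0]
    ultimately have "\<forall>\<^sub>F k in sequentially. \<forall>n. good_word s lam d \<epsilon> (real (Suc k)) n (map \<omega> [0..<n])"
    proof eventually_elim
      case (elim k)
      have kQ: "Q2 \<le> real (Suc k)" "\<And>b. b \<in> B \<Longrightarrow> Q1 b \<le> real (Suc k)"
      proof -
        have sum: "0 \<le> (\<Sum>b\<in>B. Q1 b)" using Q1(1) by (intro sum_nonneg) (auto simp: less_imp_le)
        show "Q2 \<le> real (Suc k)" using k0 elim(3) sum by linarith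
        fix b assume b: "b \<in> B"
        have "Q1 b \<le> (\<Sum>b\<in>B. Q1 b)" using b finB Q1(1) by (intro member_le_sum) (auto simp: less_imp_le)
        then show "Q1 b \<le> real (Suc k)" using k0 elim(3) Q2(1) by linarith
      qed
      show ?case
      proof
        fix n
        have "1 / real (Suc k) \<le> measure \<nu> (X k)" using elim by linarith
        also have "\<dots> \<le> measure \<nu> (fast (lam 0) \<epsilon> (real (Suc k)) n (map \<omega> [0..<n]))"
          by (intro N.finite_measure_mono) (auto simp: X_def sets_nu fast_sets)
        finally have "1 / real (Suc k) \<le> measure \<nu> (fast (lam 0) \<epsilon> (real (Suc k)) n (map \<omega> [0..<n]))" .
        moreover have "norm (blinfun_apply (g n) b) \<le> real (Suc k) * exp (real n * (lam (blk b) + \<epsilon>))" if "b \<in> B" for b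
          by (rule order_trans[OF Q1(2)[OF that, of n] mult_right_mono[OF kQ(2)[OF that] exp_ge_zero]])
        moreover have "\<bar>representation B x b\<bar> \<le> real (Suc k) * norm x" for b x
          using Q2(2) mult_right_mono[OF kQ(1), of "norm x"] by (meson norm_ge_zero order_trans)
        ultimately show "good_word s lam d \<epsilon> (real (Suc k)) n (map \<omega> [0..<n])"
          unfolding good_word_def g_def[symmetric] using B(1) spB blk cardblk by blast
      qed
    qed
    then show ?case by (auto simp: eventually_sequentially)
  qed
qed

text \<open>The events \<open>E k\<close> exhaust almost all sequences, so one of them has positive
  probability. For each n it is contained in the event that the initial word of length n is good,
  with the same Q.\<close>

lemma good_words_probability:
  assumes spec: "lyapunov_spectrum p A s lam d" and \<epsilon>: "\<epsilon> > 0"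
  obtains Q \<pi> where "Q \<ge> 1" "\<pi> > 0" "\<And>n. word_prob p n (good_word s lam d \<epsilon> Q n) \<ge> \<pi>"
proof -
  interpret M: prob_space "letter_sequences p" by (rule prob_space_letter_sequences)
  define E where "E k = (\<Inter>n. word_event n (good_word s lam d \<epsilon> (real (Suc k)) n))" for k
  have Es: "E k \<in> M.events" for k unfolding E_def by (intro sets.countable_INT) auto
  have "AE \<omega> in letter_sequences p. \<forall>n. map \<omega> [0..<n] \<in> words p n" using AE_words by (simp add: AE_all_countable)
  with AE_good_words[OF spec \<epsilon>] have AE: "AE \<omega> in letter_sequences p. \<exists>k. \<omega> \<in> E k"
    by eventually_elim (auto simp: E_def word_event_def)
  have "\<exists>k. M.prob (E k) > 0"
  proof (rule ccontr)
    assume "\<not> ?thesis"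
    then have "M.prob (E k) = 0" for k using measure_nonneg[of "letter_sequences p" "E k"] by (metis less_eq_real_def)
    then have "E k \<in> null_sets (letter_sequences p)" for k
      by (intro null_setsI Es) (simp add: M.emeasure_eq_measure)
    then have "AE \<omega> in letter_sequences p. \<omega> \<notin> E k" for k by (rule AE_not_in)
    then have "AE \<omega> in letter_sequences p. \<forall>k. \<omega> \<notin> E k" by (simp add: AE_all_countable)
    with AE have "AE \<omega> in letter_sequences p. False" by eventually_elim auto
    then show False using M.AE_False by blast
  qed
  then obtain k where k: "M.prob (E k) > 0" by blast
  show ?thesis
  proof (rule that)
    show "real (Suc k) \<ge> 1" by simp
    show "M.prob (E k) > 0" by (rule k)
    show "M.prob (E k) \<le> word_prob p n (good_word s lam d \<epsilon> (real (Suc k)) n)" for n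
      unfolding measure_word_event[symmetric] by (intro M.finite_measure_mono) (auto simp: E_def)
  qed
qed

lemma ambient_dimension_bound:
  assumes dim: "exact_dimensional \<nu> \<alpha>"
  shows "\<alpha> \<le> real DIM('a) - 1"
proof (rule field_le_epsilon)
  fix \<epsilon> :: real assume \<epsilon>: "\<epsilon> > 0"
  have N1: "real (DIM('a) - 1) = real DIM('a) - 1" using DIM_positive[where 'a='a] by (simp add: of_nat_diff)
  have "(\<alpha> - \<epsilon>) * 1 \<le> real DIM('a) - 1"
  proof (rule exact_dimensional_le[OF N.prob_space_axioms sets_nu dim, where c = "1/2"
        and C = "real DIM('a) * 5 ^ (DIM('a) - 1)" and C' = "2 * real DIM('a)"])
    show "\<forall>\<^sub>F n in sequentially. \<forall>G\<in>sets borel. 1 - 1/2 \<le> N.prob G \<longrightarrow>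
      (\<exists>Z. finite Z \<and> Z \<subseteq> G \<and> real (card Z) \<le> real DIM('a) * 5 ^ (DIM('a) - 1) * exp (real n * (real DIM('a) - 1)) \<and>
        1/2 \<le> N.prob (\<Union>x\<in>Z. cball x (2 * real DIM('a) * exp (- (real n * 1)))))"
    proof (intro always_eventually allI ballI impI)
      fix n G assume G: "G \<in> sets borel" "1 - 1/2 \<le> N.prob G"
      define \<rho> where "\<rho> = exp (- (real n * 1))"
      have \<rho>: "0 < \<rho>" "\<rho> \<le> 1" by (auto simp: \<rho>_def)
      obtain \<kappa> :: "'a projective \<Rightarrow> 'a \<times> ('a \<Rightarrow> int)" and T where \<kappa>: "range \<kappa> \<subseteq> T" "finite T"
        "real (card T) \<le> real DIM('a) * (5 / \<rho>) ^ (DIM('a) - 1)"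
        "\<forall>x y. \<kappa> x = \<kappa> y \<longrightarrow> dist x y \<le> 2 * real DIM('a) * \<rho>"
        using projective_keys[OF \<rho>, where 'a='a] by blast
      have "\<exists>Z. finite Z \<and> Z \<subseteq> G \<and> real (card Z) \<le> 1 * (real DIM('a) * (5 / \<rho>) ^ (DIM('a) - 1)) \<and>
          1/2 \<le> N.prob (\<Union>x\<in>Z. cball x (2 * real DIM('a) * \<rho>))"
      \<comment> \<open>Applied to the empty word alone, whose product is the identity: the cells of
        \<open>projective_keys\<close> cover the whole space.\<close>
      proof (rule stationary_cover[where W = "{[]}" and n = 0 and X = "\<lambda>_. UNIV" and \<kappa> = "\<lambda>_. \<kappa>" and T = "\<lambda>_. T"])
        show "2 * (1/2) \<le> (\<Sum>w\<in>{[]}. word_weight p w * N.prob UNIV)"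
          using N.prob_space by (simp add: word_weight_def space_nu)
      qed (use \<kappa> G \<rho> in \<open>auto simp: words_0 gl_act_id\<close>)
      moreover have "1 * (real DIM('a) * (5 / \<rho>) ^ (DIM('a) - 1)) = real DIM('a) * 5 ^ (DIM('a) - 1) * exp (real n * (real DIM('a) - 1))"
      proof -
        have "(1 / \<rho>) ^ (DIM('a) - 1) = exp (real n * (real DIM('a) - 1))"
          unfolding N1[symmetric] by (simp add: \<rho>_def exp_minus field_simps exp_of_nat_mult[symmetric])
        then show ?thesis by (simp add: power_divide divide_inverse mult.assoc power_inverse)
      qed
      ultimately show "\<exists>Z. finite Z \<and> Z \<subseteq> G \<and> real (card Z) \<le> real DIM('a) * 5 ^ (DIM('a) - 1) * exp (real n * (real DIM('a) - 1)) \<and>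
        1/2 \<le> N.prob (\<Union>x\<in>Z. cball x (2 * real DIM('a) * exp (- (real n * 1))))"
        unfolding \<rho>_def by metis
    qed
  qed (use \<epsilon> in auto)
  then show "\<alpha> \<le> real DIM('a) - 1 + \<epsilon>" by simp
qed

text \<open>At most \<open>exp (n (H + \<epsilon>))\<close> words, each with a constant times
  \<open>exp (n (\<gamma> D - L_m))\<close> cells, are set against balls of radius about
  \<open>exp (- n (\<gamma> - 2 \<epsilon>))\<close>, where \<open>L_m\<close> is
  \<open>lyapunov_sum lam d m\<close>.\<close>

lemma lyapunov_dimension_bound:
  assumes spec: "lyapunov_spectrum p A s lam d" and dim: "exact_dimensional \<nu> \<alpha>" and m: "m < s"
  shows "\<alpha> * (lam 0 - lam (Suc m))
    \<le> shannon_entropy p - lyapunov_sum lam d m + (lam 0 - lam (Suc m)) * (\<Sum>j=1..m. real (d j))"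
proof -
  define H where "H = shannon_entropy p"
  define D where "D = (\<Sum>j=1..m. real (d j))"
  define \<gamma> where "\<gamma> = lam 0 - lam (Suc m)"
  define a where "a = H - lyapunov_sum lam d m + \<gamma> * D"
  have dec: "lam (Suc i) < lam i" if "i < s" for i using spec that by (simp add: lyapunov_spectrum_def)
  have anti: "lam j \<le> lam i" if "i \<le> j" "j \<le> s" for i j
    by (rule lyapunov_exponents_antimono[of s lam, OF dec]) (use that in auto)
  have gap: "lam 1 < lam 0" using dec[of 0] m by simp
  have \<gamma>: "\<gamma> \<ge> lam 0 - lam 1" using anti[of 1 "Suc m"] m by (simp add: \<gamma>_def)
  have d0: "d 0 = 1" by (rule top_multiplicity_one[OF spec])
  \<comment> \<open>On the left, \<epsilon> is lost in the local dimension and 2 \<epsilon> in the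
    growth rates of the top and a lower block; on the right, \<epsilon> in the number of words. The
    upper limit on \<epsilon> makes each ellipsoid thin for large n.\<close>
  have bound: "(\<alpha> - \<epsilon>) * (\<gamma> - 2 * \<epsilon>) \<le> a + \<epsilon>" if \<epsilon>: "\<epsilon> > 0" "2 * \<epsilon> < lam 0 - lam 1" for \<epsilon>
  proof -
    obtain Q \<pi> where Q: "Q \<ge> 1" and \<pi>: "\<pi> > 0"
      and good: "\<And>n. word_prob p n (good_word s lam d \<epsilon> Q n) \<ge> \<pi>"
      by (rule good_words_probability[OF spec \<epsilon>(1)]) auto
    obtain n1 where n1: "\<And>n. n \<ge> n1 \<Longrightarrow> word_prob p n (\<lambda>w. word_weight p w < exp (- (real n * (H + \<epsilon>)))) \<le> \<pi> / 2"
      unfolding H_def by (rule word_entropy_concentration[OF \<epsilon>(1), of "\<pi>/2"]) (use \<pi> in auto)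
    \<comment> \<open>Good words of typical weight have probability at least
      \<open>\<pi> / 2\<close>, and each has a fast set of measure at least \<open>1 / Q\<close>.
      The product is \<open>2 * c\<close>, of which c may be lost outside G.\<close>
    define c where "c = \<pi> / (4 * Q)"
    have c: "c > 0" using \<pi> Q by (simp add: c_def)
    define C where "C = (10 * Q^3) ^ DIM('a)"
    define C' where "C' = 8 * real DIM('a) * Q^3"
    have "(\<lambda>n. exp (lam 1 - lam 0 + 2 * \<epsilon>) ^ n) \<longlonglongrightarrow> 0" using \<epsilon>(2) by (intro LIMSEQ_power_zero) auto
    from tendsto_mult_right_zero[OF this, of "4 * real DIM('a) * Q^3"]
    have "\<forall>\<^sub>F n in sequentially. 4 * real DIM('a) * Q^3 * exp (lam 1 - lam 0 + 2 * \<epsilon>) ^ n < 1"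
      by (rule order_tendstoD(2)) simp
    then have small: "\<forall>\<^sub>F n in sequentially. 4 * real DIM('a) * Q^3 * exp (real n * (lam 1 - lam 0 + 2 * \<epsilon>)) \<le> 1"
      by (rule eventually_mono) (simp add: exp_of_nat_mult)
    show ?thesis
    proof (rule exact_dimensional_le[OF N.prob_space_axioms sets_nu dim _ _ _ c \<epsilon>(1), where C = C and C' = C'])
      show "0 < \<gamma> - 2 * \<epsilon>" using \<gamma> \<epsilon>(2) by simp
      show "0 < C" "0 < C'" using Q by (auto simp: C_def C'_def)
      show "\<forall>\<^sub>F n in sequentially. \<forall>G\<in>sets borel. 1 - c \<le> N.prob G \<longrightarrow>
        (\<exists>Z. finite Z \<and> Z \<subseteq> G \<and> real (card Z) \<le> C * exp (real n * (a + \<epsilon>)) \<and>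
          c \<le> N.prob (\<Union>x\<in>Z. cball x (C' * exp (- (real n * (\<gamma> - 2 * \<epsilon>))))))"
        using small eventually_ge_at_top[of n1]
      proof eventually_elim
        case (elim n)
        define \<rho> where "\<rho> = exp (real n * (lam (Suc m) - lam 0 + 2 * \<epsilon>))"
        define W where "W = {w \<in> words p n. good_word s lam d \<epsilon> Q n w \<and> exp (- (real n * (H + \<epsilon>))) \<le> word_weight p w}"
        let ?X = "\<lambda>w. fast (lam 0) \<epsilon> Q n w"
        define M where "M = C * exp (real n * (\<gamma> * D - lyapunov_sum lam d m))"
        have WW: "W \<subseteq> words p n" by (auto simp: W_def)
        have finW: "finite W" using WW finite_words finite_subset by blast
        have cardW: "real (card W) \<le> exp (real n * (H + \<epsilon>))"
        proof -
          have "real (card W) * exp (- (real n * (H + \<epsilon>))) = (\<Sum>w\<in>W. exp (- (real n * (H + \<epsilon>))))" by simp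
          also have "\<dots> \<le> (\<Sum>w\<in>W. word_weight p w)" by (intro sum_mono) (auto simp: W_def)
          also have "\<dots> \<le> (\<Sum>w\<in>words p n. word_weight p w * 1)"
            using WW finite_words by (auto intro!: sum_mono2 word_weight_nonneg)
          also have "\<dots> = 1" unfolding word_mean_eq_sum[symmetric] by simp
          finally show ?thesis by (simp add: exp_minus inverse_eq_divide pos_divide_le_eq)
        qed
        have probW: "\<pi> / 2 \<le> (\<Sum>w\<in>W. word_weight p w)"
        proof -
          have "\<pi> \<le> word_prob p n (good_word s lam d \<epsilon> Q n)" by (rule good)
          also have "\<dots> \<le> word_prob p n (\<lambda>w. w \<in> W \<or> word_weight p w < exp (- (real n * (H + \<epsilon>))))"
            by (rule word_prob_mono) (auto simp: W_def)
          also have "\<dots> \<le> word_prob p n (\<lambda>w. w \<in> W) + word_prob p n (\<lambda>w. word_weight p w < exp (- (real n * (H + \<epsilon>))))"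
            by (rule word_prob_disj)
          also have "word_prob p n (\<lambda>w. w \<in> W) = (\<Sum>w\<in>W. word_weight p w)"
            unfolding word_mean_eq_sum using WW finite_words[of n]
            by (simp add: of_bool_def if_distrib[of "\<lambda>x. _ * x"] sum.If_cases Int_absorb1 cong: if_cong)
          finally show ?thesis using n1[OF elim(2)] by simp
        qed
        have mass: "2 * c \<le> (\<Sum>w\<in>W. word_weight p w * N.prob (?X w))"
        proof -
          have "2 * c = \<pi> / 2 * (1 / Q)" by (simp add: c_def)
          also have "\<dots> \<le> (\<Sum>w\<in>W. word_weight p w) * (1 / Q)" using probW Q by (intro mult_right_mono) auto
          also have "\<dots> \<le> (\<Sum>w\<in>W. word_weight p w * N.prob (?X w))"
            unfolding sum_distrib_right
            by (intro sum_mono mult_left_mono word_weight_nonneg) (auto simp: W_def good_word_def)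
          finally show ?thesis .
        qed
        have "\<exists>(\<kappa> :: 'a projective \<Rightarrow> 'a \<Rightarrow> int) T. \<kappa> ` ?X w \<subseteq> T \<and> finite T \<and> real (card T) \<le> M \<and>
            (\<forall>x\<in>?X w. \<forall>y\<in>?X w. \<kappa> x = \<kappa> y \<longrightarrow> dist (gl_act (word_prod A w) x) (gl_act (word_prod A w) y) \<le> C' * \<rho>)"
          if w: "w \<in> W" for w
        proof -
          have gw: "good_word s lam d \<epsilon> Q n w" and wGL: "word_prod A w \<in> GL"
            using w by (auto simp: W_def words_def intro: word_prod_GL)
          obtain B blk where B: "independent B" "span B = UNIV"
            and blk: "\<forall>b\<in>B. blk b \<le> s \<and> norm (blinfun_apply (word_prod A w) b) \<le> Q * exp (real n * (lam (blk b) + \<epsilon>))"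
            and card: "\<forall>i\<le>s. card {b \<in> B. blk b = i} = d i"
            and rep: "\<forall>b x. \<bar>representation B x b\<bar> \<le> Q * norm x"
            using gw unfolding good_word_def by blast
          have finB: "finite B" using independent_bound[OF B(1)] by simp
          \<comment> \<open>Grouping the axes by block expresses the exponent of the number of cells
            through the multiplicities.\<close>
          have "(\<Sum>b\<in>{b \<in> B. blk b \<in> {1..m}}. lam (blk b) - lam (Suc m))
              = (\<Sum>j\<in>{1..m}. \<Sum>b\<in>{b \<in> {b \<in> B. blk b \<in> {1..m}}. blk b = j}. lam (blk b) - lam (Suc m))"
            by (rule sum.group[symmetric]) (use finB in auto)
          also have "\<dots> = (\<Sum>j\<in>{1..m}. real (d j) * (lam j - lam (Suc m)))"
          proof (rule sum.cong)
            fix j assume j: "j \<in> {1..m}"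
            have "{b \<in> {b \<in> B. blk b \<in> {1..m}}. blk b = j} = {b \<in> B. blk b = j}" using j by auto
            moreover have "(\<Sum>b\<in>{b \<in> B. blk b = j}. lam (blk b) - lam (Suc m)) = (\<Sum>b\<in>{b \<in> B. blk b = j}. lam j - lam (Suc m))"
              by (rule sum.cong) auto
            moreover have "card {b \<in> B. blk b = j} = d j" using card j m by auto
            ultimately show "(\<Sum>b\<in>{b \<in> {b \<in> B. blk b \<in> {1..m}}. blk b = j}. lam (blk b) - lam (Suc m))
                = real (d j) * (lam j - lam (Suc m))" by simp
          qed simp
          also have "\<dots> = \<gamma> * D - lyapunov_sum lam d m"
            by (simp add: \<gamma>_def D_def lyapunov_sum_def sum_distrib_left sum.distrib[symmetric] algebra_simps)
          finally have exponent: "(\<Sum>b\<in>{b \<in> B. blk b \<in> {1..m}}. lam (blk b) - lam (Suc m)) = \<gamma> * D - lyapunov_sum lam d m" .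
          show ?thesis
            unfolding M_def C_def C'_def exponent[symmetric]
          proof (rule ellipsoid_keys[OF wGL B, where s = s and \<epsilon> = \<epsilon>])
            show "card {b \<in> B. blk b = 0} = 1" using card d0 by simp
          qed (use blk rep anti m Q elim(1) in \<open>auto simp: fast_def \<rho>_def\<close>)
        qed
        then obtain \<kappa> :: "'l list \<Rightarrow> 'a projective \<Rightarrow> 'a \<Rightarrow> int" and T where \<kappa>:
          "\<And>w. w \<in> W \<Longrightarrow> \<kappa> w ` ?X w \<subseteq> T w \<and> finite (T w) \<and> real (card (T w)) \<le> M"
          "\<And>w x y. w \<in> W \<Longrightarrow> x \<in> ?X w \<Longrightarrow> y \<in> ?X w \<Longrightarrow> \<kappa> w x = \<kappa> w y \<Longrightarrow>
             dist (gl_act (word_prod A w) x) (gl_act (word_prod A w) y) \<le> C' * \<rho>"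
          by metis
        have M0: "M \<ge> 0" using Q by (simp add: M_def C_def)
        have CM: "exp (real n * (H + \<epsilon>)) * M = C * exp (real n * (a + \<epsilon>))"
          by (simp add: M_def a_def exp_add[symmetric] algebra_simps)
        have R: "C' * \<rho> = C' * exp (- (real n * (\<gamma> - 2 * \<epsilon>)))" by (simp add: \<rho>_def \<gamma>_def algebra_simps)
        show ?case
        proof (intro ballI impI)
          fix G assume G: "G \<in> sets borel" "1 - c \<le> N.prob G"
          show "\<exists>Z. finite Z \<and> Z \<subseteq> G \<and> real (card Z) \<le> C * exp (real n * (a + \<epsilon>)) \<and>
            c \<le> N.prob (\<Union>x\<in>Z. cball x (C' * exp (- (real n * (\<gamma> - 2 * \<epsilon>)))))"
            unfolding CM[symmetric] R[symmetric]
            by (rule stationary_cover[OF WW cardW fast_sets \<kappa>(1) M0 \<kappa>(2) mass G])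
        qed
      qed
    qed
  qed
  have lhs: "((\<lambda>\<epsilon>. (\<alpha> - \<epsilon>) * (\<gamma> - 2 * \<epsilon>)) \<longlongrightarrow> (\<alpha> - 0) * (\<gamma> - 2 * 0)) (at_right 0)" by (intro tendsto_intros)
  have rhs: "((\<lambda>\<epsilon>. a + \<epsilon>) \<longlongrightarrow> a + 0) (at_right 0)" by (intro tendsto_intros)
  have "\<forall>\<^sub>F \<epsilon> in at_right (0::real). (\<alpha> - \<epsilon>) * (\<gamma> - 2 * \<epsilon>) \<le> a + \<epsilon>"
  proof -
    have "\<forall>\<^sub>F \<epsilon> in at_right (0::real). \<epsilon> < (lam 0 - lam 1) / 2"
      using order_tendstoD(2)[OF tendsto_ident_at[of "0::real" "{0<..}"], of "(lam 0 - lam 1) / 2"] gap by simp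
    with eventually_at_right_less[of "0::real"] show ?thesis
      by eventually_elim (rule bound, auto)
  qed
  from tendsto_le[OF trivial_limit_at_right_real rhs lhs this]
  have "(\<alpha> - 0) * (\<gamma> - 2 * 0) \<le> a + 0" .
  then show ?thesis by (simp add: a_def \<gamma>_def D_def H_def)
qed

end

theorem corollary1p7:
  fixes p :: "'l pmf"
    and A :: "'l \<Rightarrow> 'a::euclidean_space \<Rightarrow>\<^sub>L 'a"
    and \<nu> :: "'a projective measure"
    and dim_\<nu> :: real
    and s :: nat and lam :: "nat \<Rightarrow> real" and d :: "nat \<Rightarrow> nat"
  assumes "2 \<le> DIM('a)"
    and "finite (set_pmf p)"
    and "inj_on A (set_pmf p)"
    and "A ` set_pmf p \<subseteq> GL"
    and "strongly_irreducible (closed_semigroup_of (map_pmf A p))"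
    and "proximal (closed_semigroup_of (map_pmf A p))"
    and "furstenberg_measure p A \<nu>"
    and "exact_dimensional \<nu> dim_\<nu>"
    and "lyapunov_spectrum p A s lam d"
  shows "dim_\<nu> \<le> lyapunov_dimension DIM('a) p s lam d"
proof -
  interpret stationary_walk p A \<nu>
    by unfold_locales (use assms in auto)
  define m where "m = Max {i. i \<le> s \<and> shannon_entropy p \<ge> lyapunov_sum lam d i}"
  show ?thesis
  \<comment> \<open>For \<open>m < s\<close> the inequality is divided by the positive gap \<gamma>;
    otherwise the definition returns the dimension of the projective space, covered by
    \<open>ambient_dimension_bound\<close>.\<close>
  proof (cases "m < s")
    case True
    define \<gamma> where "\<gamma> = lam 0 - lam (Suc m)"
    have dec: "lam (Suc i) < lam i" if "i < s" for i using assms(9) that by (simp add: lyapunov_spectrum_def)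
    have "lam (Suc m) < lam m" "lam m \<le> lam 0"
      using dec[OF True] lyapunov_exponents_antimono[of s lam 0 m] dec True by auto
    then have \<gamma>: "\<gamma> > 0" by (simp add: \<gamma>_def)
    have "dim_\<nu> * \<gamma> \<le> shannon_entropy p - lyapunov_sum lam d m + \<gamma> * (\<Sum>j=1..m. real (d j))"
      unfolding \<gamma>_def by (rule lyapunov_dimension_bound[OF assms(9,8) True])
    then have "dim_\<nu> \<le> (\<Sum>j=1..m. real (d j)) + (shannon_entropy p - lyapunov_sum lam d m) / \<gamma>"
      using \<gamma> by (simp add: field_simps)
    moreover have "lyapunov_dimension DIM('a) p s lam d
        = (\<Sum>j=1..m. real (d j)) + (shannon_entropy p - lyapunov_sum lam d m) / \<gamma>"
      using True by (simp add: lyapunov_dimension_def m_def[symmetric] Let_def \<gamma>_def)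
    ultimately show ?thesis by simp
  next
    case False
    then have "lyapunov_dimension DIM('a) p s lam d = real DIM('a) - 1"
      by (simp add: lyapunov_dimension_def m_def[symmetric] Let_def)
    then show ?thesis using ambient_dimension_bound[OF assms(8)] by simp
  qed
qed

end
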